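(* Assume $p>n+1$ and $\chi$ analytic. Then for every $w\in W$, the action of the pro-$p$ Iwahori group $G$ on $\mathrm{ind}_{P_w^+}^B(\chi^w)$ by $(h\cdot f)(g)=f(h^{-1}g)$ is globally analytic.
   Context: $p$ prime, $n\ge2$, $K$ a finite extension of $\mathbb{Q}_p$ (ramification index $e$, $v_p(p)=1$). $G\subset GL_n(\mathbb{Z}_p)$ is the pro-$p$ Iwahori subgroup (diagonal in $1+p\mathbb{Z}_p$, above diagonal in $p\mathbb{Z}_p$, below in $\mathbb{Z}_p$); $B$ the Iwahori subgroup of matrices lower triangular mod $p$; $U$ the lower unipotent matrices over $\mathbb{Z}_p$; $P^+$ the upper triangular matrices in $GL_n(\mathbb{Z}_p)$; $W$ the group of $n\times n$ permutation matrices; $P_w^+=B\cap wP^+w^{-1}$; $B=(wUw^{-1}\cap B)P_w^+$ uniquely. $\chi(\mathrm{diag}(t_i))=\prod\chi_i(t_i)$, $\chi_i(1+pu)=\exp(c_i\log(1+pu))$, $c_i\in K$; $\chi$ analytic means $v_p(c_i)>\frac e{p-1}-1$ for all $i$; $\chi^w(h)=\chi(w^{-1}hw)$, extended to $P_w^+$ trivially on the non-diagonal part. $\mathrm{ind}_{P_w^+}^B(\chi^w)$ denotes the globally analytic vectors of $\{f$ locally analytic on $B$: $f(gb)=\chi^w(b^{-1})f(g),\ b\in P_w^+\}$, i.e. the Tate algebra $\mathcal{A}(wUw^{-1}\cap B,K)$ of power series with coefficients tending to $0$ on $wUw^{-1}\cap B\cong\mathbb{Z}_p^{n(n-1)/2}$.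 For $p>n+1$, $G$ is rigid-analytically the ordered product of one-parameter subgroups $1+yE_{i,j}$ ($i>j$, $y\in\mathbb{Z}_p$), diagonal subgroups ($t\in1+p\mathbb{Z}_p$) and $1+yE_{i,j}$ ($i<j$, $y\in p\mathbb{Z}_p$); an action on a Banach space is globally analytic if every orbit map is a convergent power series in these coordinates with coefficients tending to $0$. *)

theory Defs
  imports
    "HOL-Analysis.Infinite_Sum"
    "HOL-Library.Extended_Real"
    "HOL-Combinatorics.Permutations"
    "HOL-Computational_Algebra.Primes"
    "Jordan_Normal_Form.Gauss_Jordan_Elimination"
begin

class nonarch_field = field_char_0 + complete_space +
  fixes vabs :: "'a \<Rightarrow> real"
  assumes dist_vabs: "dist x y = vabs (x - y)"
    and vabs_mult: "vabs (x * y) = vabs x * vabs y"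
    and vabs_ultrametric: "vabs (x + y) \<le> max (vabs x) (vabs y)"

instance nonarch_field < topological_ab_group_add
proof
  fix a b :: 'a
  have n0: "vabs (- x) = vabs x" for x :: 'a
    using dist_commute[of 0 x] by (simp add: dist_vabs)
  show "((\<lambda>x. fst x + snd x) \<longlongrightarrow> a + b) (nhds a \<times>\<^sub>F nhds b)"
  proof (rule tendstoI)
    fix e :: real assume e: "0 < e"
    have "\<forall>\<^sub>F x in nhds a \<times>\<^sub>F nhds b. dist (fst x) a < e \<and> dist (snd x) b < e"
      using e by (intro eventually_prodI tendstoD[OF filterlim_ident])
    then show "\<forall>\<^sub>F x in nhds a \<times>\<^sub>F nhds b. dist (fst x + snd x) (a + b) < e"
    proof eventually_elim
      case (elim x)
      have "vabs ((fst x - a) + (snd x - b)) < e"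
        using vabs_ultrametric[of "fst x - a" "snd x - b"] elim by (auto simp: dist_vabs)
      then show ?case by (simp add: dist_vabs algebra_simps)
    qed
  qed
  show "(uminus \<longlongrightarrow> - a) (nhds a)"
  proof (rule tendstoI)
    fix e :: real assume "0 < e"
    then have "\<forall>\<^sub>F x in nhds a. dist x a < e"
      by (intro tendstoD[OF filterlim_ident])
    then show "\<forall>\<^sub>F x in nhds a. dist (- x) (- a) < e"
      by eventually_elim (metis dist_vabs minus_diff_minus n0)
  qed
qed

instance nonarch_field < topological_semigroup_mult
proof
  fix a b :: 'a
  show "((\<lambda>x. fst x * snd x) \<longlongrightarrow> a * b) (nhds a \<times>\<^sub>F nhds b)"
  proof (rule tendstoI)
    fix e :: real assume e: "0 < e"
    have nn: "vabs x \<ge> 0" for x :: 'a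
      using zero_le_dist[of x 0] by (simp add: dist_vabs)
    define d where "d = min 1 (e / (1 + vabs a + vabs b))"
    have d: "0 < d" "d \<le> 1" "d * (1 + vabs a + vabs b) \<le> e"
      using e nn[of a] nn[of b] by (auto simp: d_def min_def field_simps add_pos_nonneg)
    have "\<forall>\<^sub>F x in nhds a \<times>\<^sub>F nhds b. dist (fst x) a < d \<and> dist (snd x) b < d"
      using d by (intro eventually_prodI tendstoD[OF filterlim_ident])
    then show "\<forall>\<^sub>F x in nhds a \<times>\<^sub>F nhds b. dist (fst x * snd x) (a * b) < e"
    proof eventually_elim
      case (elim x)
      define s t where "s = fst x - a" and "t = snd x - b"
      have st: "vabs s < d" "vabs t < d" using elim by (auto simp: s_def t_def dist_vabs)
      have pos: "0 < 1 + vabs a + vabs b" using nn[of a] nn[of b] by linarith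
      have bd: "u * v < e"
        if "0 \<le> u" "u < d" "0 \<le> v" "v \<le> 1 + vabs a + vabs b" for u v :: real
        using that pos d(3) mult_strict_right_mono[OF that(2) pos] mult_left_mono[OF that(4,1)]
        by linarith
      have "fst x * snd x - a * b = s * t + (s * b + t * a)"
        by (simp add: s_def t_def algebra_simps)
      moreover have "vabs (s * t + (s * b + t * a)) \<le>
          max (vabs s * vabs t) (max (vabs s * vabs b) (vabs t * vabs a))"
        using vabs_ultrametric[of "s * t" "s * b + t * a"] vabs_ultrametric[of "s * b" "t * a"]
        by (auto simp: vabs_mult)
      moreover have "vabs s * vabs t < e" "vabs s * vabs b < e" "vabs t * vabs a < e"
        using bd nn st d(2) nn[of a] nn[of b] by (smt (verit))+
      ultimately show ?case by (simp add: dist_vabs)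
    qed
  qed
qed


text \<open>
  A complete non-archimedean field is used as a model of a finite extension \<open>K\<close> of
  \<open>\<rat>\<^sub>p\<close>: once \<open>\<bar>p\<bar> = 1/p\<close>, the absolute value restricts to the \<open>p\<close>-adic one on \<open>\<rat>\<close>, so the closure
  of \<open>\<rat>\<close> in \<open>K\<close> is its \<open>p\<close>-adic completion.
\<close>

definition Qp :: "'k::nonarch_field set" where
  "Qp = closure \<rat>"

definition Zp :: "'k::nonarch_field set" where
  "Zp = {x \<in> Qp. vabs x \<le> 1}"

definition Zp_units :: "'k::nonarch_field set" where
  "Zp_units = {x \<in> Zp. \<exists>y\<in>Zp. x * y = 1}"

definition pZp :: "nat \<Rightarrow> 'k::nonarch_field set" where
  "pZp p = {of_nat p * x | x. x \<in> Zp}"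

definition finite_extension_Qp :: "nat \<Rightarrow> 'k::nonarch_field itself \<Rightarrow> bool" where
  "finite_extension_Qp p _ \<longleftrightarrow>
     vabs (of_nat p :: 'k) = 1 / real p \<and>
     (\<exists>S::'k set. finite S \<and>
       (\<forall>x. \<exists>a. (\<forall>s\<in>S. a s \<in> Qp) \<and> x = (\<Sum>s\<in>S. a s * s)))"

definition padic_val :: "nat \<Rightarrow> 'k::nonarch_field \<Rightarrow> ereal" where
  "padic_val p x = (if x = 0 then \<infinity> else ereal (- log (real p) (vabs x)))"

text \<open>The index of the value group of \<open>\<rat>\<^sub>p\<close> in that of \<open>K\<close>, as the number of cosets.\<close>

definition ramification_index :: "'k::nonarch_field itself \<Rightarrow> nat" where
  "ramification_index _ =
     card ((\<lambda>r. (\<lambda>s. r * s) ` vabs ` (Qp - {0::'k})) ` vabs ` (UNIV - {0::'k}))"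

definition padic_exp :: "'k::nonarch_field \<Rightarrow> 'k" where
  "padic_exp x = (\<Sum>k. x ^ k / fact k)"

definition padic_log :: "'k::nonarch_field \<Rightarrow> 'k" where
  "padic_log x = (\<Sum>k. (- 1) ^ k * (x - 1) ^ Suc k / of_nat (Suc k))"


abbreviation minv :: "'k::nonarch_field mat \<Rightarrow> 'k mat" where
  "minv A \<equiv> the (mat_inverse A)"

definition Mat_Zp :: "nat \<Rightarrow> 'k::nonarch_field mat set" where
  "Mat_Zp n = {g \<in> carrier_mat n n. \<forall>i<n. \<forall>j<n. g $$ (i,j) \<in> Zp}"

definition GL_Zp :: "nat \<Rightarrow> 'k::nonarch_field mat set" where
  "GL_Zp n = {g \<in> Mat_Zp n. \<exists>g'\<in>Mat_Zp n. g * g' = 1\<^sub>m n \<and> g' * g = 1\<^sub>m n}"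

definition Iwahori :: "nat \<Rightarrow> nat \<Rightarrow> 'k::nonarch_field mat set" where
  "Iwahori p n = {g \<in> GL_Zp n. \<forall>i j. i < j \<and> j < n \<longrightarrow> g $$ (i,j) \<in> pZp p}"

definition pro_p_Iwahori :: "nat \<Rightarrow> nat \<Rightarrow> 'k::nonarch_field mat set" where
  "pro_p_Iwahori p n = {g \<in> GL_Zp n.
     (\<forall>i<n. g $$ (i,i) - 1 \<in> pZp p) \<and>
     (\<forall>i j. i < j \<and> j < n \<longrightarrow> g $$ (i,j) \<in> pZp p)}"

definition lower_unipotent :: "nat \<Rightarrow> 'k::nonarch_field mat set" where
  "lower_unipotent n = {g \<in> Mat_Zp n.
     (\<forall>i<n. g $$ (i,i) = 1) \<and> (\<forall>i j. i < j \<and> j < n \<longrightarrow> g $$ (i,j) = 0)}"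

definition upper_borel :: "nat \<Rightarrow> 'k::nonarch_field mat set" where
  "upper_borel n = {g \<in> GL_Zp n. upper_triangular g}"

definition perm_matrices :: "nat \<Rightarrow> 'k::nonarch_field mat set" where
  "perm_matrices n =
     {mat n n (\<lambda>(i,j). if i = \<sigma> j then 1 else 0) | \<sigma>. \<sigma> permutes {..<n}}"

definition conj_set :: "'k::nonarch_field mat \<Rightarrow> 'k mat set \<Rightarrow> 'k mat set" where
  "conj_set w H = (\<lambda>h. w * h * minv w) ` H"

definition Pw :: "nat \<Rightarrow> nat \<Rightarrow> 'k::nonarch_field mat \<Rightarrow> 'k mat set" where
  "Pw p n w = Iwahori p n \<inter> conj_set w (upper_borel n)"

definition Uw :: "nat \<Rightarrow> nat \<Rightarrow> 'k::nonarch_field mat \<Rightarrow> 'k mat set" where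
  "Uw p n w = conj_set w (lower_unipotent n) \<inter> Iwahori p n"

text \<open>\<open>\<chi>\<close> is given by its components \<open>\<chi> 0, \<dots>, \<chi> (n - 1)\<close>; since \<open>w\<inverse> b w\<close> is upper triangular
  for \<open>b\<close> in \<^term>\<open>Pw p n w\<close>, this reads off its diagonal part.\<close>

definition char_w :: "nat \<Rightarrow> (nat \<Rightarrow> 'k \<Rightarrow> 'k) \<Rightarrow> 'k mat \<Rightarrow> 'k mat \<Rightarrow> 'k::nonarch_field" where
  "char_w n \<chi> w b = (\<Prod>i<n. \<chi> i ((minv w * b * w) $$ (i,i)))"

definition is_character :: "('k \<Rightarrow> 'k::nonarch_field) \<Rightarrow> bool" where
  "is_character \<psi> \<longleftrightarrow> (\<forall>s\<in>Zp_units. \<psi> s \<noteq> 0) \<and>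
     (\<forall>s\<in>Zp_units. \<forall>t\<in>Zp_units. \<psi> (s * t) = \<psi> s * \<psi> t)"


definition multi_indices :: "'i set \<Rightarrow> ('i \<Rightarrow> nat) set" where
  "multi_indices I = {\<alpha>. \<forall>i. i \<notin> I \<longrightarrow> \<alpha> i = 0}"

definition mpower :: "'i set \<Rightarrow> ('i \<Rightarrow> 'k::nonarch_field) \<Rightarrow> ('i \<Rightarrow> nat) \<Rightarrow> 'k" where
  "mpower I x \<alpha> = (\<Prod>i\<in>I. x i ^ \<alpha> i)"

definition tends_to_0 :: "'i set \<Rightarrow> (('i \<Rightarrow> nat) \<Rightarrow> real) \<Rightarrow> bool" where
  "tends_to_0 I r \<longleftrightarrow> (\<forall>\<epsilon>>0. finite {\<alpha> \<in> multi_indices I. \<bar>r \<alpha>\<bar> \<ge> \<epsilon>})"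

text \<open>The function \<open>f\<close> on \<open>X\<close> is the power series with coefficients \<open>a\<close>, tending to \<open>0\<close>, in the
  coordinates \<open>crd x i\<close> for \<open>i \<in> I\<close>.\<close>

definition tate_expansion ::
  "'i set \<Rightarrow> 'x set \<Rightarrow> ('x \<Rightarrow> 'i \<Rightarrow> 'k) \<Rightarrow> ('x \<Rightarrow> 'k) \<Rightarrow> (('i \<Rightarrow> nat) \<Rightarrow> 'k::nonarch_field) \<Rightarrow> bool" where
  "tate_expansion I X crd f a \<longleftrightarrow>
     (\<forall>\<alpha>. \<alpha> \<notin> multi_indices I \<longrightarrow> a \<alpha> = 0) \<and>
     tends_to_0 I (\<lambda>\<alpha>. vabs (a \<alpha>)) \<and>
     (\<forall>x\<in>X. ((\<lambda>\<alpha>. a \<alpha> * mpower I (crd x) \<alpha>) has_sum f x) (multi_indices I))"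

definition all_pos :: "nat \<Rightarrow> (nat \<times> nat) set" where
  "all_pos n = {..<n} \<times> {..<n}"

definition Zp_points :: "'i set \<Rightarrow> ('i \<Rightarrow> 'k::nonarch_field) set" where
  "Zp_points I = {z. \<forall>i\<in>I. z i \<in> Zp}"

definition locally_analytic_on_Iwahori ::
  "nat \<Rightarrow> nat \<Rightarrow> ('k::nonarch_field mat \<Rightarrow> 'k) \<Rightarrow> bool" where
  "locally_analytic_on_Iwahori p n f \<longleftrightarrow>
     (\<forall>g\<in>Iwahori p n. \<exists>m::nat.
        (let nbhd = (\<lambda>z. g + mat n n (\<lambda>ij. of_nat p ^ m * z ij)) in
         (\<forall>z\<in>Zp_points (all_pos n). nbhd z \<in> Iwahori p n) \<and>
         (\<exists>a. tate_expansion (all_pos n) (Zp_points (all_pos n)) (\<lambda>z. z) (\<lambda>z. f (nbhd z)) a)))"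

text \<open>The positions of the free entries of \<open>w U w\<inverse>\<close>: conjugation by \<open>w\<close> moves the entry \<open>(i, j)\<close> to
  \<open>(a, b)\<close> when \<open>w\<close> maps the standard basis vectors \<open>e\<^sub>i, e\<^sub>j\<close> to \<open>e\<^sub>a, e\<^sub>b\<close>. On \<^term>\<open>Uw p n w\<close>
  those above the diagonal run over \<open>p\<int>\<^sub>p\<close> and are divided by \<open>p\<close>, which identifies
  \<^term>\<open>Uw p n w\<close> with \<open>\<int>\<^sub>p\<close>-points.\<close>

definition Uw_pos :: "nat \<Rightarrow> 'k::nonarch_field mat \<Rightarrow> (nat \<times> nat) set" where
  "Uw_pos n w = {(a,b). a < n \<and> b < n \<and>
     (\<exists>i j. j < i \<and> i < n \<and> w $$ (a,i) = 1 \<and> w $$ (b,j) = 1)}"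

definition Uw_crd :: "nat \<Rightarrow> 'k::nonarch_field mat \<Rightarrow> nat \<times> nat \<Rightarrow> 'k" where
  "Uw_crd p u = (\<lambda>(a,b). if a < b then u $$ (a,b) / of_nat p else u $$ (a,b))"

definition Uw_expansion ::
  "nat \<Rightarrow> nat \<Rightarrow> 'k::nonarch_field mat \<Rightarrow> ('k mat \<Rightarrow> 'k) \<Rightarrow> (((nat \<times> nat) \<Rightarrow> nat) \<Rightarrow> 'k) \<Rightarrow> bool" where
  "Uw_expansion p n w f a \<longleftrightarrow> tate_expansion (Uw_pos n w) (Uw p n w) (Uw_crd p) f a"

text \<open>Functions on \<^term>\<open>Iwahori p n\<close> are extended by \<open>0\<close>.\<close>

definition ind ::
  "nat \<Rightarrow> nat \<Rightarrow> (nat \<Rightarrow> 'k \<Rightarrow> 'k) \<Rightarrow> 'k mat \<Rightarrow> ('k::nonarch_field mat \<Rightarrow> 'k) set" where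
  "ind p n \<chi> w = {f.
     (\<forall>g. g \<notin> Iwahori p n \<longrightarrow> f g = 0) \<and>
     locally_analytic_on_Iwahori p n f \<and>
     (\<forall>g\<in>Iwahori p n. \<forall>b\<in>Pw p n w. f (g * b) = char_w n \<chi> w (minv b) * f g) \<and>
     (\<exists>a. Uw_expansion p n w f a)}"

text \<open>The Banach norm of the Tate algebra: the supremum of the (unique) coefficients.\<close>

definition ind_norm ::
  "nat \<Rightarrow> nat \<Rightarrow> 'k::nonarch_field mat \<Rightarrow> ('k mat \<Rightarrow> 'k) \<Rightarrow> real" where
  "ind_norm p n w f = (SUP \<alpha>\<in>multi_indices (Uw_pos n w). vabs ((THE a. Uw_expansion p n w f a) \<alpha>))"

definition left_transl ::
  "nat \<Rightarrow> nat \<Rightarrow> 'k::nonarch_field mat \<Rightarrow> ('k mat \<Rightarrow> 'k) \<Rightarrow> 'k mat \<Rightarrow> 'k" where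
  "left_transl p n h f = (\<lambda>g. if g \<in> Iwahori p n then f (minv h * g) else 0)"


text \<open>\<open>addrow_mat n y i j\<close> is \<open>1 + y E\<^sub>i\<^sub>,\<^sub>j\<close> for \<open>i \<noteq> j\<close>.\<close>

definition elementary_product ::
  "nat \<Rightarrow> ((nat \<times> nat) \<Rightarrow> 'k::nonarch_field) \<Rightarrow> (nat \<times> nat) list \<Rightarrow> 'k mat" where
  "elementary_product n y ps = foldr (\<lambda>(i,j) M. addrow_mat n (y (i,j)) i j * M) ps (1\<^sub>m n)"

text \<open>The lists \<open>lo\<close> and \<open>up\<close> give the order of the factors below and above the diagonal. The
  coordinates are normalised to run over \<open>\<int>\<^sub>p\<close>: the diagonal ones are \<open>t = 1 + p z\<close> and those
  above the diagonal are \<open>y = p z\<close>.\<close>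

definition G_point ::
  "nat \<Rightarrow> nat \<Rightarrow> (nat \<times> nat) list \<Rightarrow> (nat \<times> nat) list \<Rightarrow> ((nat \<times> nat) \<Rightarrow> 'k) \<Rightarrow> 'k::nonarch_field mat" where
  "G_point p n lo up z =
     elementary_product n z lo *
     mat_diag n (\<lambda>i. 1 + of_nat p * z (i,i)) *
     elementary_product n (\<lambda>ij. of_nat p * z ij) up"

text \<open>\<open>V\<close> is a space of functions with norm \<open>N\<close>, and \<open>act\<close> an action on it. The orbit map of
  \<open>f\<close> is the power series with coefficients \<open>F \<alpha> \<in> V\<close>, convergent in the norm \<open>N\<close>. The
  matrices \<^term>\<open>G_point p n lo up z\<close> with \<open>z\<close> over \<open>\<int>\<^sub>p\<close> are exactly the elements of
  \<^term>\<open>pro_p_Iwahori p n\<close>, for each choice of orders \<open>lo\<close>, \<open>up\<close>.\<close>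

definition globally_analytic_action ::
  "nat \<Rightarrow> nat \<Rightarrow> ('x \<Rightarrow> 'k) set \<Rightarrow> (('x \<Rightarrow> 'k) \<Rightarrow> real) \<Rightarrow>
   ('k mat \<Rightarrow> ('x \<Rightarrow> 'k) \<Rightarrow> 'x \<Rightarrow> 'k::nonarch_field) \<Rightarrow> bool" where
  "globally_analytic_action p n V N act \<longleftrightarrow>
     (\<forall>h\<in>pro_p_Iwahori p n. \<forall>f\<in>V. act h f \<in> V) \<and>
     (\<forall>lo up. distinct lo \<and> set lo = {(i,j). j < i \<and> i < n} \<and>
              distinct up \<and> set up = {(i,j). i < j \<and> j < n} \<longrightarrow>
       (\<forall>f\<in>V. \<exists>F.
          (\<forall>\<alpha>\<in>multi_indices (all_pos n). F \<alpha> \<in> V) \<and>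
          tends_to_0 (all_pos n) (\<lambda>\<alpha>. N (F \<alpha>)) \<and>
          (\<forall>z\<in>Zp_points (all_pos n).
             ((\<lambda>S. N (\<lambda>x. act (G_point p n lo up z) f x -
                            (\<Sum>\<alpha>\<in>S. mpower (all_pos n) z \<alpha> * F \<alpha> x)))
               \<longlongrightarrow> 0) (finite_subsets_at_top (multi_indices (all_pos n))))))"

end

theory Submission
  imports Defs
    "HOL-Analysis.Elementary_Metric_Spaces"
    "HOL-Algebra.Embedded_Algebras"
    "Jordan_Normal_Form.Determinant"
begin

text \<open>
  Let \<open>A\<close> be the ring of \<open>\<int>\<^sub>p\<close>-valued functions given by power series whose coefficients tend to \<open>0\<close>
  and have absolute value at most \<open>1\<close>, and call a matrix over \<open>A\<close> pro-\<open>p\<close> if its entries lie in \<open>p A\<close>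
  above, in \<open>1 + p A\<close> on, and in \<open>A\<close> below the diagonal. Such matrices are closed under products,
  inverses, and under Gaussian elimination with diagonal pivots in any order, because all
  pivots stay in \<open>1 + p A\<close>. Eliminating in the order given by \<open>w\<close> writes a pro-\<open>p\<close> matrix \<open>g\<close> over \<open>A\<close>
  as \<open>g = u b\<close> with \<open>u\<close> in \<open>w U w\<inverse> \<inter> B\<close>, \<open>b\<close> in \<open>P\<^sub>w\<^sup>+\<close>, both again pro-\<open>p\<close> over \<open>A\<close>. Hence
  \<open>f(g) = \<chi>\<^sup>w(b\<inverse>) f(u)\<close> is a convergent power series for every \<open>f\<close> in the induced representation: the
  second factor by substitution, the first because \<open>exp(c log(1 + p r))\<close> is a power series in \<open>r\<close>
  with coefficients tending to \<open>0\<close> when \<open>\<bar>c p\<bar> < p\<^bsup>-1/(p-1)\<^esup>\<close>.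

  Apply this to \<open>g = h\<inverse> u\<close>, with \<open>h\<close> the generic element of \<open>G\<close> and \<open>u\<close> the generic element of
  \<open>w U w\<inverse> \<inter> B\<close>, in both sets of coordinates at once. The coefficients with respect to the
  coordinates of \<open>h\<close> are the coefficients of the orbit map; they are equivariant because the
  coefficients of a convergent power series are determined by its values on \<open>\<int>\<^sub>p\<close>-points.
\<close>

section \<open>Non-archimedean absolute values\<close>

lemma vabs_zero [simp]: "vabs (0::'k::nonarch_field) = 0"
  using dist_vabs[of "0::'k" 0] by simp

lemma vabs_nonneg [simp]: "vabs (x::'k::nonarch_field) \<ge> 0"
  using zero_le_dist[of x 0] by (simp add: dist_vabs)

lemma vabs_eq_0_iff [simp]: "vabs (x::'k::nonarch_field) = 0 \<longleftrightarrow> x = 0"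
  using dist_eq_0_iff[of x 0] by (simp add: dist_vabs)

lemma vabs_pos_iff [simp]: "vabs (x::'k::nonarch_field) > 0 \<longleftrightarrow> x \<noteq> 0"
  by (metis less_eq_real_def not_less_iff_gr_or_eq vabs_eq_0_iff vabs_nonneg)

lemma vabs_one [simp]: "vabs (1::'k::nonarch_field) = 1"
  using vabs_mult[of "1::'k" 1] by simp

lemma vabs_minus [simp]: "vabs (- x) = vabs (x::'k::nonarch_field)"
  using dist_commute[of 0 x] by (simp add: dist_vabs)

lemma vabs_minus_commute: "vabs (x - y) = vabs (y - x :: 'k::nonarch_field)"
  by (metis minus_diff_eq vabs_minus)

lemma vabs_diff_le: "vabs (x - y) \<le> max (vabs x) (vabs (y::'k::nonarch_field))"
  using vabs_ultrametric[of x "- y"] by simp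

lemma vabs_power: "vabs (x ^ k) = vabs (x::'k::nonarch_field) ^ k"
  by (induction k) (auto simp: vabs_mult)

lemma vabs_divide: "vabs (x / y) = vabs x / vabs (y::'k::nonarch_field)"
proof (cases "y = 0")
  case False
  then have "vabs x = vabs (x / y) * vabs y" by (simp flip: vabs_mult)
  then show ?thesis using False by (simp add: field_simps)
qed auto

lemma vabs_prod: "vabs (\<Prod>i\<in>S. f i) = (\<Prod>i\<in>S. vabs (f i :: 'k::nonarch_field))"
  by (induction S rule: infinite_finite_induct) (auto simp: vabs_mult)

lemma vabs_mult_le_left: "vabs y \<le> 1 \<Longrightarrow> vabs (x * y) \<le> vabs (x::'k::nonarch_field)"
  by (simp add: vabs_mult mult_left_le)

lemma vabs_mult_le_right: "vabs x \<le> 1 \<Longrightarrow> vabs (x * y) \<le> vabs (y::'k::nonarch_field)"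
  by (simp add: vabs_mult mult_left_le_one_le)

lemma vabs_sum_le:
  "C \<ge> 0 \<Longrightarrow> (\<And>i. i \<in> S \<Longrightarrow> vabs (f i :: 'k::nonarch_field) \<le> C) \<Longrightarrow> vabs (\<Sum>i\<in>S. f i) \<le> C"
proof (induction S rule: infinite_finite_induct)
  case (insert x F)
  then show ?case using vabs_ultrametric[of "f x" "sum f F"] by fastforce
qed auto

lemma vabs_sum_less:
  "C > 0 \<Longrightarrow> (\<And>i. i \<in> S \<Longrightarrow> vabs (f i :: 'k::nonarch_field) < C) \<Longrightarrow> vabs (\<Sum>i\<in>S. f i) < C"
proof (induction S rule: infinite_finite_induct)
  case (insert x F)
  then show ?case using vabs_ultrametric[of "f x" "sum f F"] by fastforce
qed auto

lemma vabs_of_nat_le_1: "vabs (of_nat m :: 'k::nonarch_field) \<le> 1"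
proof (induction m)
  case (Suc m)
  then show ?case using vabs_ultrametric[of "of_nat m :: 'k" 1] by (simp add: add.commute)
qed auto

lemma vabs_of_int_le_1: "vabs (of_int m :: 'k::nonarch_field) \<le> 1"
  using vabs_of_nat_le_1[where 'k = 'k] by (cases m rule: int_cases2) auto

lemma vabs_eq_if_close: "vabs (x - y) < vabs (y::'k::nonarch_field) \<Longrightarrow> vabs x = vabs y"
  using vabs_ultrametric[of "x - y" y] vabs_diff_le[of x "x - y"]
  by (auto simp: max_def split: if_splits)

lemma vabs_add_eq_max:
  assumes "vabs x \<noteq> vabs (y::'k::nonarch_field)"
  shows "vabs (x + y) = max (vabs x) (vabs y)"
proof (cases "vabs x < vabs y")
  case True
  then show ?thesis using vabs_eq_if_close[of "x + y" y] by simp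
next
  case False
  then show ?thesis using assms vabs_eq_if_close[of "x + y" x] by simp
qed

lemma tendsto_iff_vabs_diff:
  fixes f :: "'a \<Rightarrow> 'k::nonarch_field"
  shows "(f \<longlongrightarrow> l) F \<longleftrightarrow> ((\<lambda>x. vabs (f x - l)) \<longlongrightarrow> 0) F"
  by (simp add: tendsto_dist_iff[of f] dist_vabs)

lemma tendsto_inverse_nonarch:
  fixes f :: "'a \<Rightarrow> 'k::nonarch_field"
  assumes f: "(f \<longlongrightarrow> a) F" and "a \<noteq> 0"
  shows "((\<lambda>x. inverse (f x)) \<longlongrightarrow> inverse a) F"
  unfolding tendsto_iff_vabs_diff[of "\<lambda>x. inverse (f x)"]
proof (rule Lim_transform_eventually)
  show "((\<lambda>x. vabs (f x - a) / (vabs a * vabs a)) \<longlongrightarrow> 0) F"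
    using f unfolding tendsto_iff_vabs_diff[of f] by (rule tendsto_divide_zero)
  have "\<forall>\<^sub>F x in F. vabs (f x - a) < vabs a"
    using tendstoD[OF f, of "vabs a"] assms(2) by (simp add: dist_vabs)
  then show "\<forall>\<^sub>F x in F. vabs (f x - a) / (vabs a * vabs a) = vabs (inverse (f x) - inverse a)"
  proof eventually_elim
    case (elim x)
    have eq: "vabs (f x) = vabs a" using elim by (rule vabs_eq_if_close)
    then have "f x \<noteq> 0" using assms(2) by (metis vabs_eq_0_iff)
    then have "inverse (f x) - inverse a = (a - f x) / (f x * a)"
      using assms(2) by (simp add: field_simps)
    then show ?case by (simp add: vabs_divide vabs_mult eq vabs_minus_commute[of a])
  qed
qed

lemma has_sum_vabs_le:
  fixes a :: "'i \<Rightarrow> 'k::nonarch_field"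
  assumes s: "(a has_sum s) A" and C: "C \<ge> 0" "\<And>i. i \<in> A \<Longrightarrow> vabs (a i) \<le> C"
  shows "vabs s \<le> C"
proof (rule ccontr)
  assume "\<not> vabs s \<le> C"
  then have less: "C < vabs s" by simp
  then have "vabs s > 0" using C by linarith
  with s have "\<forall>\<^sub>F F in finite_subsets_at_top A. dist (sum a F) s < vabs s"
    unfolding has_sum_def by (rule tendstoD)
  then obtain F where F: "F \<subseteq> A" "dist (sum a F) s < vabs s"
    unfolding eventually_finite_subsets_at_top by blast
  then have "vabs (sum a F) = vabs s" by (intro vabs_eq_if_close) (simp add: dist_vabs)
  moreover have "vabs (sum a F) \<le> C" using F C by (intro vabs_sum_le) auto
  ultimately show False using less by simp
qed

lemma vabs_infsum_le:
  "C \<ge> 0 \<Longrightarrow> (\<And>i. i \<in> A \<Longrightarrow> vabs (a i :: 'k::nonarch_field) \<le> C) \<Longrightarrow> vabs (infsum a A) \<le> C"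
  using has_sum_vabs_le[of a A "infsum a A" C]
  by (cases "a summable_on A") (auto simp: infsum_not_exists)

section \<open>Null families\<close>

definition null_family :: "'i set \<Rightarrow> ('i \<Rightarrow> 'k::nonarch_field) \<Rightarrow> bool" where
  "null_family A a \<longleftrightarrow> (a \<longlongrightarrow> 0) (inf cofinite (principal A))"

lemma null_family_iff_finite: "null_family A a \<longleftrightarrow> (\<forall>\<epsilon>>0. finite {i \<in> A. \<epsilon> \<le> vabs (a i)})"
  by (simp add: null_family_def tendsto_iff eventually_inf_principal eventually_cofinite
      dist_vabs not_less)

lemma null_familyD: "null_family A a \<Longrightarrow> \<epsilon> > 0 \<Longrightarrow> finite {i \<in> A. \<epsilon> \<le> vabs (a i)}"
  by (simp add: null_family_iff_finite)

lemma tends_to_0_vabs_iff: "tends_to_0 I (\<lambda>\<alpha>. vabs (a \<alpha>)) \<longleftrightarrow> null_family (multi_indices I) a"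
  by (simp add: tends_to_0_def null_family_iff_finite)

lemma null_family_le:
  assumes "null_family A a" "\<And>i. i \<in> A \<Longrightarrow> vabs (b i) \<le> vabs (a i)"
  shows "null_family A b"
  unfolding null_family_iff_finite
proof (intro allI impI)
  fix \<epsilon> :: real assume "\<epsilon> > 0"
  have "{i \<in> A. \<epsilon> \<le> vabs (b i)} \<subseteq> {i \<in> A. \<epsilon> \<le> vabs (a i)}" using assms(2) by force
  then show "finite {i \<in> A. \<epsilon> \<le> vabs (b i)}"
    using null_familyD[OF assms(1) \<open>\<epsilon> > 0\<close>] by (rule finite_subset)
qed

lemma null_family_cong:
  "null_family A a \<Longrightarrow> (\<And>i. i \<in> A \<Longrightarrow> b i = a i) \<Longrightarrow> null_family A b"
  by (erule null_family_le) simp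

lemma null_family_subset: "null_family A a \<Longrightarrow> B \<subseteq> A \<Longrightarrow> null_family B a"
  unfolding null_family_def by (erule tendsto_mono[rotated]) (simp add: le_infI2)

lemma null_family_finite: "finite A \<Longrightarrow> null_family A a"
  by (simp add: null_family_iff_finite)

lemma null_family_superset:
  assumes "null_family B a" "B \<subseteq> A" "\<And>i. i \<in> A - B \<Longrightarrow> a i = 0"
  shows "null_family A a"
  unfolding null_family_iff_finite
proof (intro allI impI)
  fix \<epsilon> :: real assume "\<epsilon> > 0"
  moreover from this have "{i \<in> A. \<epsilon> \<le> vabs (a i)} = {i \<in> B. \<epsilon> \<le> vabs (a i)}"
    using assms(2,3) by fastforce
  ultimately show "finite {i \<in> A. \<epsilon> \<le> vabs (a i)}" using null_familyD[OF assms(1)] by simp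
qed

lemma null_family_add:
  "null_family A a \<Longrightarrow> null_family A b \<Longrightarrow> null_family A (\<lambda>i. a i + b i)"
  unfolding null_family_def using tendsto_add[of a 0 _ b 0] by simp

lemma null_family_cmult: "null_family A a \<Longrightarrow> null_family A (\<lambda>i. c * a i)"
  unfolding null_family_def using tendsto_mult[OF tendsto_const[of c], of a 0] by simp

lemma null_family_nat_iff: "null_family (UNIV :: nat set) a \<longleftrightarrow> (\<lambda>k. vabs (a k)) \<longlonglongrightarrow> 0"
  by (simp add: null_family_def cofinite_eq_sequentially tendsto_iff_vabs_diff[of a])

lemma null_family_reindex:
  assumes "inj_on h B"
  shows "null_family (h ` B) a \<longleftrightarrow> null_family B (\<lambda>i. a (h i))"
proof -
  have "finite {i \<in> h ` B. \<epsilon> \<le> vabs (a i)} \<longleftrightarrow> finite {i \<in> B. \<epsilon> \<le> vabs (a (h i))}" for \<epsilon>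
  proof -
    have "{i \<in> h ` B. \<epsilon> \<le> vabs (a i)} = h ` {i \<in> B. \<epsilon> \<le> vabs (a (h i))}" by auto
    moreover have "inj_on h {i \<in> B. \<epsilon> \<le> vabs (a (h i))}"
      using assms by (rule inj_on_subset) auto
    ultimately show ?thesis by (simp add: finite_image_iff)
  qed
  then show ?thesis by (simp add: null_family_iff_finite)
qed

lemma null_family_reindex_bij_betw:
  "bij_betw h B A \<Longrightarrow> null_family A a \<Longrightarrow> null_family B (\<lambda>i. a (h i))"
  using null_family_reindex[of h B a] by (simp add: bij_betw_def)

lemma null_family_swap: "null_family (A \<times> B) a \<Longrightarrow> null_family (B \<times> A) (\<lambda>(j, k). a (k, j))"
  using null_family_reindex[of prod.swap "B \<times> A" a]
  by (simp add: product_swap) (simp add: case_prod_unfold prod.swap_def)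

lemma null_family_fiber:
  assumes "null_family (A \<times> B) a" "k \<in> A"
  shows "null_family B (\<lambda>j. a (k, j))"
proof -
  have "Pair k ` B \<subseteq> A \<times> B" using assms(2) by auto
  then have "null_family (Pair k ` B) a" by (rule null_family_subset[OF assms(1)])
  then show ?thesis by (simp add: null_family_reindex inj_on_def)
qed

lemma null_family_finite_large_fibers:
  assumes "null_family (A \<times> B) a" "\<epsilon> > 0"
  shows "finite {k \<in> A. \<exists>j\<in>B. \<epsilon> \<le> vabs (a (k, j))}"
proof -
  have "{k \<in> A. \<exists>j\<in>B. \<epsilon> \<le> vabs (a (k, j))} \<subseteq> fst ` {i \<in> A \<times> B. \<epsilon> \<le> vabs (a i)}" by force
  then show ?thesis using null_familyD[OF assms] by (meson finite_imageI finite_subset)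
qed

lemma null_family_bounded:
  assumes "null_family A a"
  obtains C where "C > 0" "\<And>i. i \<in> A \<Longrightarrow> vabs (a i) \<le> C"
proof -
  let ?S = "{i \<in> A. 1 \<le> vabs (a i)}"
  let ?C = "Max (insert 1 ((\<lambda>i. vabs (a i)) ` ?S))"
  have fin: "finite ?S" by (intro null_familyD[OF assms]) simp
  have "1 \<le> ?C" using fin by (intro Max_ge) auto
  have "vabs (a i) \<le> ?C" if "i \<in> A" for i
  proof (cases "1 \<le> vabs (a i)")
    case True
    then show ?thesis using fin that by (intro Max_ge) auto
  next
    case False
    then show ?thesis using \<open>1 \<le> ?C\<close> by linarith
  qed
  then show thesis using \<open>1 \<le> ?C\<close> by (intro that[of ?C]) auto
qed

text \<open>A finite partial sum changes by less than \<open>\<epsilon>\<close> when indices with \<open>\<bar>a\<^sub>i\<bar> < \<epsilon>\<close> are added to it;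
  so in the ultrametric case the general term tending to \<open>0\<close> is sufficient for convergence.\<close>

lemma null_family_summable:
  fixes a :: "'i \<Rightarrow> 'k::nonarch_field"
  assumes "null_family A a"
  shows "a summable_on A"
proof -
  have "cauchy_filter (filtermap (sum a) (finite_subsets_at_top A))"
    unfolding cauchy_filter_metric_filtermap
  proof (intro allI impI)
    fix \<epsilon> :: real assume "\<epsilon> > 0"
    define L where "L = {i \<in> A. \<epsilon> \<le> vabs (a i)}"
    have "finite L" unfolding L_def using assms \<open>\<epsilon> > 0\<close> by (rule null_familyD)
    have close: "dist (sum a F) (sum a G) < \<epsilon>"
      if "finite F \<and> L \<subseteq> F \<and> F \<subseteq> A" "finite G \<and> L \<subseteq> G \<and> G \<subseteq> A" for F G
    proof -
      have "sum a F - sum a G = sum a (F - L) - sum a (G - L)"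
        using that \<open>finite L\<close> by (simp add: sum_diff)
      moreover have "vabs (sum a (F - L)) < \<epsilon>" "vabs (sum a (G - L)) < \<epsilon>"
        using that \<open>\<epsilon> > 0\<close> by (auto simp: L_def not_le intro!: vabs_sum_less)
      ultimately show ?thesis
        using vabs_diff_le[of "sum a (F - L)" "sum a (G - L)"] by (simp add: dist_vabs)
    qed
    have "\<forall>\<^sub>F F in finite_subsets_at_top A. finite F \<and> L \<subseteq> F \<and> F \<subseteq> A"
      unfolding eventually_finite_subsets_at_top using \<open>finite L\<close> by (auto simp: L_def)
    then show "\<exists>P. eventually P (finite_subsets_at_top A) \<and>
        (\<forall>F G. P F \<and> P G \<longrightarrow> dist (sum a F) (sum a G) < \<epsilon>)"
      using close by (intro exI conjI) auto
  qed
  moreover have "complete (UNIV :: 'k set)"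
    by (rule complete_UNIV)
  ultimately obtain s where "(sum a \<longlongrightarrow> s) (finite_subsets_at_top A)"
    using complete_uniform[where S = "UNIV :: 'k set"] by (force simp: filterlim_def)
  then show ?thesis by (auto simp: summable_on_def has_sum_def)
qed

lemma null_family_has_sum: "null_family A a \<Longrightarrow> (a has_sum infsum a A) A"
  by (intro has_sum_infsum null_family_summable)

lemma null_family_infsum:
  assumes a: "null_family (A \<times> B) a"
  shows "null_family A (\<lambda>k. \<Sum>\<^sub>\<infinity>j\<in>B. a (k, j))"
  unfolding null_family_iff_finite
proof (intro allI impI)
  fix \<epsilon> :: real assume "\<epsilon> > 0"
  let ?L = "{k \<in> A. \<exists>j\<in>B. \<epsilon> / 2 \<le> vabs (a (k, j))}"
  have "vabs (\<Sum>\<^sub>\<infinity>j\<in>B. a (k, j)) \<le> \<epsilon> / 2" if "k \<in> A - ?L" for k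
    using that \<open>\<epsilon> > 0\<close> by (intro vabs_infsum_le) (auto simp: not_le less_imp_le)
  then have "{k \<in> A. \<epsilon> \<le> vabs (\<Sum>\<^sub>\<infinity>j\<in>B. a (k, j))} \<subseteq> ?L" using \<open>\<epsilon> > 0\<close> by fastforce
  moreover have "finite ?L" using a \<open>\<epsilon> > 0\<close> by (intro null_family_finite_large_fibers) auto
  ultimately show "finite {k \<in> A. \<epsilon> \<le> vabs (\<Sum>\<^sub>\<infinity>j\<in>B. a (k, j))}" by (rule finite_subset)
qed

lemma null_family_has_sum_infsum_left:
  assumes a: "null_family (A \<times> B) a"
  shows "((\<lambda>k. \<Sum>\<^sub>\<infinity>j\<in>B. a (k, j)) has_sum infsum a (A \<times> B)) A"
  by (rule has_sum_SigmaD[OF null_family_has_sum[OF a]])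
     (auto intro: null_family_has_sum null_family_fiber[OF a])

lemma null_family_has_sum_infsum_right:
  assumes a: "null_family (A \<times> B) a"
  shows "((\<lambda>j. \<Sum>\<^sub>\<infinity>k\<in>A. a (k, j)) has_sum infsum a (A \<times> B)) B"
  using null_family_has_sum_infsum_left[OF null_family_swap[OF a]]
    infsumI[OF has_sum_swap[THEN iffD1, OF null_family_has_sum[OF a]]]
  by (simp add: case_prod_unfold)

lemma null_family_mult:
  assumes c: "null_family A c" and a: "\<And>k. k \<in> A \<Longrightarrow> null_family B (a k)"
    and le_1: "\<And>k j. k \<in> A \<Longrightarrow> j \<in> B \<Longrightarrow> vabs (a k j) \<le> 1"
  shows "null_family (A \<times> B) (\<lambda>(k, j). c k * a k j)"
  unfolding null_family_iff_finite
proof (intro allI impI)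
  fix \<epsilon> :: real assume "\<epsilon> > 0"
  obtain C where C: "C > 0" "\<And>i. i \<in> A \<Longrightarrow> vabs (c i) \<le> C" using null_family_bounded[OF c] by blast
  let ?large = "SIGMA k:{k \<in> A. \<epsilon> \<le> vabs (c k)}. {j \<in> B. \<epsilon> / C \<le> vabs (a k j)}"
  have "k \<in> A \<and> \<epsilon> \<le> vabs (c k) \<and> \<epsilon> / C \<le> vabs (a k j)"
    if "k \<in> A" "j \<in> B" "\<epsilon> \<le> vabs (c k * a k j)" for k j
  proof -
    have "vabs (c k) * vabs (a k j) \<le> C * vabs (a k j)"
      using C that by (intro mult_right_mono) auto
    then show ?thesis using that C(1) vabs_mult_le_left[OF le_1[OF that(1,2)], of "c k"]
      by (simp add: vabs_mult field_simps)
  qed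
  then have "{i \<in> A \<times> B. \<epsilon> \<le> vabs (case i of (k, j) \<Rightarrow> c k * a k j)} \<subseteq> ?large" by auto
  moreover have "finite ?large"
    using null_familyD[OF c] null_familyD[OF a] \<open>\<epsilon> > 0\<close> C by (intro finite_SigmaI) auto
  ultimately show "finite {i \<in> A \<times> B. \<epsilon> \<le> vabs (case i of (k, j) \<Rightarrow> c k * a k j)}"
    by (rule finite_subset)
qed

lemma null_family_powers: "vabs (y::'k::nonarch_field) < 1 \<Longrightarrow> null_family UNIV (\<lambda>k. y ^ k)"
  by (simp add: null_family_nat_iff vabs_power LIMSEQ_power_zero)

lemma has_sum_geometric:
  assumes y: "vabs (y::'k::nonarch_field) < 1"
  shows "((\<lambda>k. y ^ k) has_sum 1 / (1 - y)) UNIV"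
proof -
  define S where "S = (\<Sum>\<^sub>\<infinity>k. y ^ k)"
  have S: "((\<lambda>k. y ^ k) has_sum S) UNIV"
    unfolding S_def by (rule null_family_has_sum[OF null_family_powers[OF y]])
  have "((\<lambda>k. y ^ k) has_sum y * S) (range Suc)"
    using has_sum_cmult_right[OF S, of y] by (subst has_sum_reindex) (auto simp: o_def)
  moreover have "((\<lambda>k. y ^ k) has_sum 1) {0}" by (simp add: has_sum_finite_iff)
  ultimately have "((\<lambda>k. y ^ k) has_sum (1 + y * S)) ({0} \<union> range Suc)"
    by (intro has_sum_Un_disjoint) auto
  then have "S = 1 + y * S"
    using S has_sum_unique by (fastforce simp: UNIV_nat_eq[symmetric])
  moreover have "y \<noteq> 1" using y by auto
  ultimately have "S = 1 / (1 - y)" by (simp add: field_simps)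
  then show ?thesis using S by simp
qed

section \<open>The p-adic numbers inside K\<close>

lemma Qp_iff_sequence: "x \<in> Qp \<longleftrightarrow> (\<exists>s. (\<forall>n. s n \<in> \<rat>) \<and> s \<longlonglongrightarrow> x)"
  unfolding Qp_def by (rule closure_sequential)

lemma Rats_subset_Qp: "\<rat> \<subseteq> Qp"
  unfolding Qp_def by (rule closure_subset)

lemma Qp_0 [simp]: "0 \<in> Qp" and Qp_1 [simp]: "1 \<in> Qp"
  using Rats_subset_Qp by auto

lemma Qp_add:
  assumes "x \<in> Qp" "y \<in> Qp" shows "x + y \<in> Qp"
proof -
  obtain s t where "\<forall>n. s n \<in> \<rat>" "s \<longlonglongrightarrow> x" "\<forall>n. t n \<in> \<rat>" "t \<longlonglongrightarrow> y"
    using assms by (auto simp: Qp_iff_sequence)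
  then show ?thesis
    unfolding Qp_iff_sequence by (intro exI[of _ "\<lambda>n. s n + t n"]) (auto intro: tendsto_add)
qed

lemma Qp_mult:
  assumes "x \<in> Qp" "y \<in> Qp" shows "x * y \<in> Qp"
proof -
  obtain s t where "\<forall>n. s n \<in> \<rat>" "s \<longlonglongrightarrow> x" "\<forall>n. t n \<in> \<rat>" "t \<longlonglongrightarrow> y"
    using assms by (auto simp: Qp_iff_sequence)
  then show ?thesis
    unfolding Qp_iff_sequence by (intro exI[of _ "\<lambda>n. s n * t n"]) (auto intro: tendsto_mult)
qed

lemma Qp_uminus: "x \<in> Qp \<Longrightarrow> - x \<in> Qp"
  using Qp_mult[of "- 1" x] subsetD[OF Rats_subset_Qp Rats_of_int[of "- 1"]] by simp

lemma Qp_inverse: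
  assumes "x \<in> Qp" shows "inverse x \<in> Qp"
proof (cases "x = 0")
  case False
  obtain s where "\<forall>n. s n \<in> \<rat>" "s \<longlonglongrightarrow> x" using assms by (auto simp: Qp_iff_sequence)
  then show ?thesis
    unfolding Qp_iff_sequence using False
    by (intro exI[of _ "\<lambda>n. inverse (s n)"]) (auto intro: tendsto_inverse_nonarch)
qed simp

lemma Qp_divide: "x \<in> Qp \<Longrightarrow> y \<in> Qp \<Longrightarrow> x / y \<in> Qp"
  by (simp add: divide_inverse Qp_mult Qp_inverse)

lemma vabs_Zp: "x \<in> Zp \<Longrightarrow> vabs x \<le> 1"
  by (simp add: Zp_def)

lemma Zp_0 [simp]: "0 \<in> Zp" and Zp_1 [simp]: "1 \<in> Zp"
  by (auto simp: Zp_def)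

lemma Zp_add: "x \<in> Zp \<Longrightarrow> y \<in> Zp \<Longrightarrow> x + y \<in> Zp"
  unfolding Zp_def using vabs_ultrametric[of x y] by (auto intro: Qp_add)

lemma Zp_mult: "x \<in> Zp \<Longrightarrow> y \<in> Zp \<Longrightarrow> x * y \<in> Zp"
  unfolding Zp_def by (auto intro: Qp_mult simp: vabs_mult mult_le_one)

lemma Zp_uminus: "x \<in> Zp \<Longrightarrow> - x \<in> Zp"
  unfolding Zp_def by (auto intro: Qp_uminus)

lemma Zp_of_nat [simp]: "of_nat m \<in> Zp"
  by (induction m) (auto intro: Zp_add)

lemma Zp_power: "x \<in> Zp \<Longrightarrow> x ^ k \<in> Zp"
  by (induction k) (auto intro: Zp_mult)

lemma Zp_divide: "x \<in> Zp \<Longrightarrow> y \<in> Zp \<Longrightarrow> vabs y = 1 \<Longrightarrow> x / y \<in> Zp"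
  unfolding Zp_def by (auto intro: Qp_divide simp: vabs_divide)

lemma Zp_sum: "(\<And>i. i \<in> S \<Longrightarrow> f i \<in> Zp) \<Longrightarrow> (\<Sum>i\<in>S. f i) \<in> Zp"
  by (induction S rule: infinite_finite_induct) (auto intro: Zp_add)

lemma signof_Zp: "(signof \<pi> :: 'k::nonarch_field) \<in> Zp"
  by (simp add: sign_def Zp_uminus)

locale padic_field =
  fixes p :: nat and ty :: "'k::nonarch_field itself"
  assumes prime_p: "prime p" and vabs_p: "vabs (of_nat p :: 'k) = 1 / real p"
begin

lemma p_ge_2: "p \<ge> 2"
  using prime_p by (rule prime_ge_2_nat)

lemma p_neq_0 [simp]: "p \<noteq> 0"
  using p_ge_2 by simp

lemma vabs_p_mult_less_1: "vabs x \<le> 1 \<Longrightarrow> vabs (of_nat p * x :: 'k) < 1"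
  using p_ge_2 by (simp add: vabs_mult vabs_p)

lemma pZp_iff: "(x::'k) \<in> pZp p \<longleftrightarrow> x / of_nat p \<in> Zp"
proof
  assume "x / of_nat p \<in> Zp"
  then show "x \<in> pZp p" by (auto simp: pZp_def intro!: exI[of _ "x / of_nat p"])
qed (auto simp: pZp_def)

lemma vabs_of_nat_coprime:
  assumes "\<not> p dvd m" shows "vabs (of_nat m :: 'k) = 1"
proof (rule antisym[OF vabs_of_nat_le_1])
  have "coprime p m" using assms prime_p by (simp add: prime_imp_coprime)
  then have "gcd (int p) (int m) = 1" by (simp add: gcd_int_def)
  then obtain u v where bezout: "u * int p + v * int m = 1"
    using bezout_int[of "int p" "int m"] by auto
  have "(1::'k) = of_int (u * int p + v * int m)" by (simp add: bezout)
  then have "of_int v * of_nat m - 1 = - (of_nat p * of_int u :: 'k)"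
    by (simp add: algebra_simps)
  then have "vabs (of_int v * of_nat m - 1 :: 'k) < vabs (1 :: 'k)"
    using vabs_p_mult_less_1[OF vabs_of_int_le_1] by simp
  then have "vabs (of_int v * of_nat m :: 'k) = 1" using vabs_eq_if_close by fastforce
  then show "1 \<le> vabs (of_nat m :: 'k)"
    using vabs_mult_le_right[OF vabs_of_int_le_1, of v "of_nat m :: 'k"] by simp
qed

lemma vabs_of_nat_ge: "k > 0 \<Longrightarrow> vabs (of_nat k :: 'k) \<ge> 1 / real k"
proof (induction k rule: less_induct)
  case (less k)
  show ?case
  proof (cases "p dvd k")
    case True
    then obtain m where k: "k = p * m" by blast
    have "m > 0" "m < k" using less.prems k p_ge_2 by auto
    then have "1 / real m \<le> vabs (of_nat m :: 'k)" by (intro less.IH)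
    then show ?thesis using \<open>m > 0\<close> p_ge_2 by (simp add: k vabs_mult vabs_p field_simps)
  next
    case False
    then show ?thesis using less.prems by (simp add: vabs_of_nat_coprime)
  qed
qed

lemma vabs_fact_div: "vabs (fact k :: 'k) = (1 / real p) ^ (k div p) * vabs (fact (k div p) :: 'k)"
proof (induction k)
  case (Suc k)
  have fact_Suc: "vabs (fact (Suc k) :: 'k) = vabs (of_nat (Suc k) :: 'k) * vabs (fact k :: 'k)"
    for k
    by (simp only: fact_Suc vabs_mult of_nat_id)
  show ?case
  proof (cases "p dvd Suc k")
    case True
    then have div: "Suc k div p = Suc (k div p)" by (simp add: div_Suc mod_eq_0_iff_dvd)
    have "Suc k = p * Suc (k div p)" using True div by (metis dvd_mult_div_cancel)
    then have "vabs (of_nat (Suc k) :: 'k) = 1 / real p * vabs (of_nat (Suc (k div p)) :: 'k)"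
      by (metis of_nat_mult vabs_mult vabs_p)
    then show ?thesis unfolding div fact_Suc Suc.IH by simp
  next
    case False
    then have div: "Suc k div p = k div p" by (simp add: div_Suc mod_eq_0_iff_dvd)
    show ?thesis
      unfolding div fact_Suc Suc.IH by (simp add: vabs_of_nat_coprime[OF False] del: of_nat_Suc)
  qed
qed auto

definition exp_radius :: real where "exp_radius = real p powr (- 1 / (real p - 1))"

lemma exp_radius_pos: "0 < exp_radius"
  using p_ge_2 by (simp add: exp_radius_def)

lemma exp_radius_le_1: "exp_radius \<le> 1"
proof -
  have "exp_radius \<le> real p powr 0"
    unfolding exp_radius_def using p_ge_2 by (intro powr_mono) auto
  then show ?thesis by simp
qed

lemma exp_radius_power: "exp_radius ^ (p - 1) = 1 / real p"
proof -
  have "exp_radius ^ (p - 1) = real p powr (- 1 / (real p - 1) * real (p - 1))"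
    unfolding exp_radius_def using p_ge_2 by (subst powr_power) auto
  also have "- 1 / (real p - 1) * real (p - 1) = - 1" using p_ge_2 by (simp add: of_nat_diff)
  finally show ?thesis by (simp add: powr_minus_divide)
qed

lemma vabs_fact_ge: "vabs (fact k :: 'k) \<ge> exp_radius ^ k"
proof (induction k rule: less_induct)
  case (less k)
  show ?case
  proof (cases "k = 0")
    case False
    let ?m = "k div p"
    have "?m < k" using False p_ge_2 by simp
    have "p * ?m \<le> k" by simp
    then have "exp_radius ^ k \<le> exp_radius ^ (p * ?m)"
      using exp_radius_pos exp_radius_le_1 by (intro power_decreasing) auto
    also have "p * ?m = (p - 1) * ?m + ?m" using p_ge_2 by (cases p) auto
    also have "exp_radius ^ \<dots> = (1 / real p) ^ ?m * exp_radius ^ ?m"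
      by (simp only: power_add power_mult exp_radius_power)
    also have "\<dots> \<le> (1 / real p) ^ ?m * vabs (fact ?m :: 'k)"
      using less.IH[OF \<open>?m < k\<close>] by (intro mult_left_mono) auto
    finally show ?thesis by (subst vabs_fact_div)
  qed auto
qed

lemma vabs_mult_p_less_exp_radius:
  assumes "padic_val p (c::'k) > ereal (real e / (real p - 1) - 1)" "e \<ge> 1"
  shows "vabs (c * of_nat p) < exp_radius"
proof (cases "c = 0")
  case True
  then show ?thesis using exp_radius_pos by simp
next
  case False
  have p: "real p \<ge> 2" using p_ge_2 by simp
  have "real e / (real p - 1) - 1 < - log (real p) (vabs c)"
    using assms(1) False by (simp add: padic_val_def)
  moreover have "1 / (real p - 1) \<le> real e / (real p - 1)"
    using assms(2) p by (intro divide_right_mono) auto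
  ultimately have "log (real p) (vabs c) < 1 + - 1 / (real p - 1)" by simp
  then have "vabs c < real p powr (1 + - 1 / (real p - 1))"
    using p False by (simp add: log_less_iff)
  also have "\<dots> = real p * exp_radius"
    unfolding exp_radius_def using p by (subst powr_add) simp
  finally show ?thesis using p by (simp add: vabs_mult vabs_p field_simps)
qed

end

section \<open>Finiteness of the ramification index\<close>

definition field_ring :: "'a::field ring" where
  "field_ring = \<lparr>carrier = UNIV, mult = (*), one = 1, zero = 0, add = (+)\<rparr>"

lemma field_ring_simps [simp]:
  "carrier field_ring = UNIV" "x \<otimes>\<^bsub>field_ring\<^esub> y = x * y" "\<one>\<^bsub>field_ring\<^esub> = 1"
  "\<zero>\<^bsub>field_ring\<^esub> = 0" "x \<oplus>\<^bsub>field_ring\<^esub> y = x + y"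
  by (simp_all add: field_ring_def)

interpretation field_ring: field "field_ring :: 'a::field ring"
proof -
  have "\<exists>y. x + y = 0" for x :: 'a by (intro exI[of _ "- x"]) simp
  moreover have "x \<noteq> 0 \<Longrightarrow> \<exists>y. x * y = 1" for x :: 'a by (intro exI[of _ "1 / x"]) simp
  ultimately show "field (field_ring :: 'a ring)"
    by unfold_locales (auto simp: Units_def algebra_simps)
qed

lemma subfield_Qp: "subfield (Qp :: 'k::nonarch_field set) field_ring"
proof (rule field_ring.subfieldI')
  have uminus: "\<ominus>\<^bsub>field_ring\<^esub> x = - x" for x :: 'k
    by (rule field_ring.minus_equality) simp_all
  show "subring (Qp :: 'k set) field_ring"
    by (rule field_ring.subringI) (auto simp: uminus intro: Qp_uminus Qp_mult Qp_add)
  have inverse: "inv\<^bsub>field_ring\<^esub> x = inverse x" if "x \<noteq> 0" for x :: 'k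
    using that by (intro field_ring.comm_inv_char) simp_all
  show "inv\<^bsub>field_ring\<^esub> x \<in> Qp" if "x \<in> Qp - {\<zero>\<^bsub>field_ring\<^esub>}" for x :: 'k
    using that inverse by (auto intro: Qp_inverse)
qed

lemma Span_Cons_iff:
  "x \<in> field_ring.Span Qp (u # us) \<longleftrightarrow> (\<exists>a\<in>Qp. \<exists>v\<in>field_ring.Span Qp us. x = a * u + v)"
  by (simp add: field_ring.line_extension_mem_iff)

lemma sum_in_Span:
  "distinct us \<Longrightarrow> (\<And>u. u \<in> set us \<Longrightarrow> a u \<in> Qp) \<Longrightarrow>
    (\<Sum>u\<in>set us. a u * u) \<in> field_ring.Span (Qp :: 'k::nonarch_field set) us"
proof (induction us)
  case (Cons u us)
  then have "(\<Sum>v\<in>set us. a v * v) \<in> field_ring.Span Qp us" by simp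
  moreover have "(\<Sum>v\<in>set (u # us). a v * v) = a u * u + (\<Sum>v\<in>set us. a v * v)"
    using Cons.prems by simp
  ultimately show ?case unfolding Span_Cons_iff using Cons.prems by auto
qed simp

definition value_coset :: "'k::nonarch_field \<Rightarrow> real set" where
  "value_coset x = (\<lambda>s. vabs x * s) ` vabs ` (Qp - {0::'k})"

lemma ramification_index_eq_card_value_cosets:
  "ramification_index TYPE('k::nonarch_field) = card (value_coset ` (UNIV - {0::'k}))"
  unfolding ramification_index_def value_coset_def by (simp add: image_image)

lemma value_coset_cong:
  fixes x y :: "'k::nonarch_field"
  shows "vabs x = vabs y \<Longrightarrow> value_coset x = value_coset y"
  by (simp add: value_coset_def)

lemma value_coset_mult:
  fixes a x :: "'k::nonarch_field"
  assumes a: "a \<in> Qp" "a \<noteq> 0"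
  shows "value_coset (a * x) = value_coset x"
proof -
  have subset: "value_coset (b * y) \<subseteq> value_coset y" if "b \<in> Qp" "b \<noteq> 0" for b y :: 'k
  proof
    fix r assume "r \<in> value_coset (b * y)"
    then obtain t :: 'k where "t \<in> Qp - {0}" "r = vabs y * vabs (b * t)"
      by (auto simp: value_coset_def vabs_mult mult_ac)
    moreover from this have "b * t \<in> Qp - {0}" using that by (auto intro: Qp_mult)
    ultimately show "r \<in> value_coset y" unfolding value_coset_def by blast
  qed
  have "value_coset x = value_coset (inverse a * (a * x))" using a by (simp flip: mult.assoc)
  also have "\<dots> \<subseteq> value_coset (a * x)" using a by (intro subset Qp_inverse) auto
  finally show ?thesis using subset[OF a] by blast
qed

text \<open>Summands with values in distinct cosets of \<open>\<bar>\<rat>\<^sub>p\<^sup>\<times>\<bar>\<close> have distinct absolute values, so no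
  cancellation is possible between them.\<close>

lemma value_coset_Span:
  "distinct (map value_coset us) \<Longrightarrow> 0 \<notin> set us \<Longrightarrow> x \<in> field_ring.Span Qp us \<Longrightarrow> x \<noteq> 0 \<Longrightarrow>
    value_coset x \<in> value_coset ` set us"
proof (induction us arbitrary: x)
  case (Cons u us)
  then obtain a v where a: "a \<in> Qp" and v: "v \<in> field_ring.Span Qp us" and x: "x = a * u + v"
    unfolding Span_Cons_iff by blast
  consider "a = 0" | "a \<noteq> 0" "v = 0" | "a \<noteq> 0" "v \<noteq> 0" by blast
  then show ?case
  proof cases
    case 1
    then show ?thesis using Cons v x by auto
  next
    case 2
    then show ?thesis using x value_coset_mult[OF a, of u] by auto
  next
    case 3
    have au: "value_coset (a * u) = value_coset u" by (rule value_coset_mult[OF a \<open>a \<noteq> 0\<close>])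
    have vus: "value_coset v \<in> value_coset ` set us" using Cons v 3 by auto
    then have "value_coset (a * u) \<noteq> value_coset v" using Cons.prems(1) au by auto
    then have "vabs (a * u) \<noteq> vabs v" using value_coset_cong by blast
    then have "vabs x = vabs (a * u) \<or> vabs x = vabs v"
      unfolding x by (simp add: vabs_add_eq_max max_def)
    then have "value_coset x = value_coset (a * u) \<or> value_coset x = value_coset v"
      using value_coset_cong by blast
    then show ?thesis using au vus by auto
  qed
qed simp

lemma independent_if_distinct_value_cosets:
  "distinct (map value_coset us) \<Longrightarrow> 0 \<notin> set us \<Longrightarrow> field_ring.independent Qp us"
proof (induction us)
  case (Cons u us)
  then have "u \<notin> field_ring.Span Qp us" using value_coset_Span[of us u] by auto
  then show ?case using Cons by (intro field_ring.li_Cons) auto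
qed simp

text \<open>The ramification index is defined as a cardinality: if the set of cosets were infinite, it would
  be \<open>0\<close> and the condition on the \<open>c\<^sub>i\<close> would be too weak.\<close>

lemma finite_value_cosets:
  assumes "finite_extension_Qp p TYPE('k::nonarch_field)"
  shows "finite (value_coset ` (UNIV - {0::'k}))"
proof (rule ccontr)
  obtain S :: "'k set" where S: "finite S" "\<And>x. \<exists>a. (\<forall>s\<in>S. a s \<in> Qp) \<and> x = (\<Sum>s\<in>S. a s * s)"
    using assms unfolding finite_extension_Qp_def by blast
  obtain ss where ss: "set ss = S" "distinct ss" using finite_distinct_list[OF S(1)] by blast
  obtain vs where vs: "field_ring.independent Qp vs"
      "field_ring.Span Qp vs = field_ring.Span Qp ss"
    using field_ring.filter_base[OF subfield_Qp, of ss] by auto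
  have Span_vs: "x \<in> field_ring.Span Qp vs" for x
    unfolding vs(2) using S(2)[of x] sum_in_Span[OF ss(2)] by (auto simp: ss(1))
  assume "infinite (value_coset ` (UNIV - {0::'k}))"
  then obtain T where T: "T \<subseteq> value_coset ` (UNIV - {0::'k})" "finite T" "card T = Suc (length vs)"
    using infinite_arbitrarily_large by blast
  obtain ts where ts: "set ts = T" "distinct ts" using finite_distinct_list[OF T(2)] by blast
  define us where "us = map (\<lambda>t. SOME x::'k. x \<noteq> 0 \<and> value_coset x = t) ts"
  have "(SOME x::'k. x \<noteq> 0 \<and> value_coset x = t) \<noteq> 0 \<and>
      value_coset (SOME x::'k. x \<noteq> 0 \<and> value_coset x = t) = t" if "t \<in> T" for t
    using T(1) that by (intro someI_ex[of "\<lambda>x::'k. x \<noteq> 0 \<and> value_coset x = t"]) auto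
  then have "map value_coset us = ts" "0 \<notin> set us"
    using ts(1) by (auto simp: us_def intro!: map_idI)
  then have "field_ring.independent Qp us"
    using ts(2) by (intro independent_if_distinct_value_cosets) auto
  then have "length us \<le> length vs"
    using vs(1) Span_vs by (intro field_ring.independent_length_le[OF subfield_Qp]) auto
  moreover have "length us = Suc (length vs)"
    using ts T(3) distinct_card[of ts] by (simp add: us_def)
  ultimately show False by simp
qed

lemma ramification_index_pos:
  assumes "finite_extension_Qp p TYPE('k::nonarch_field)"
  shows "ramification_index TYPE('k) \<ge> 1"
proof -
  have "value_coset (1::'k) \<in> value_coset ` (UNIV - {0::'k})" by (rule imageI) simp
  then have "card (value_coset ` (UNIV - {0::'k})) \<noteq> 0"
    using finite_value_cosets[OF assms] by (metis card_0_eq empty_iff)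
  then show ?thesis by (simp add: ramification_index_eq_card_value_cosets Suc_le_eq)
qed

section \<open>Power series with coefficients tending to zero\<close>

lemma mpower_cong: "(\<And>i. i \<in> I \<Longrightarrow> x i = y i) \<Longrightarrow> mpower I x \<alpha> = mpower I y \<alpha>"
  unfolding mpower_def by (rule prod.cong) auto

lemma vabs_mpower_le_1: "(\<And>i. i \<in> I \<Longrightarrow> vabs (x i) \<le> 1) \<Longrightarrow> vabs (mpower I x \<alpha>) \<le> 1"
  unfolding mpower_def vabs_prod vabs_power by (intro prod_le_1) (auto simp: power_le_one)

lemma mpower_add: "mpower I x (\<lambda>i. \<alpha> i + \<beta> i) = mpower I x \<alpha> * mpower I x \<beta>"
  unfolding mpower_def by (simp add: power_add prod.distrib)

lemma mpower_zero [simp]: "mpower I x (\<lambda>_. 0) = 1"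
  unfolding mpower_def by simp

lemma zero_multi_index [simp]: "(\<lambda>_. 0) \<in> multi_indices I"
  unfolding multi_indices_def by simp

lemma tate_expansionI:
  assumes "null_family (multi_indices I) a" "\<And>\<alpha>. \<alpha> \<notin> multi_indices I \<Longrightarrow> a \<alpha> = 0"
    and "\<And>x. x \<in> X \<Longrightarrow> ((\<lambda>\<alpha>. a \<alpha> * mpower I (crd x) \<alpha>) has_sum f x) (multi_indices I)"
  shows "tate_expansion I X crd f a"
  using assms by (simp add: tate_expansion_def tends_to_0_vabs_iff)

lemma
  assumes "tate_expansion I X crd f a"
  shows tate_expansion_null_family: "null_family (multi_indices I) a"
    and tate_expansion_outside: "\<alpha> \<notin> multi_indices I \<Longrightarrow> a \<alpha> = 0"
    and tate_expansion_has_sum: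
      "x \<in> X \<Longrightarrow> ((\<lambda>\<alpha>. a \<alpha> * mpower I (crd x) \<alpha>) has_sum f x) (multi_indices I)"
  using assms by (simp_all add: tate_expansion_def tends_to_0_vabs_iff)

lemma tate_expansion_cong:
  "(\<And>x. x \<in> X \<Longrightarrow> f x = g x) \<Longrightarrow> tate_expansion I X crd f a \<longleftrightarrow> tate_expansion I X crd g a"
  unfolding tate_expansion_def by auto

lemma tate_expansion_add:
  assumes f: "tate_expansion I X crd f a" and g: "tate_expansion I X crd g b"
  shows "tate_expansion I X crd (\<lambda>x. f x + g x) (\<lambda>\<alpha>. a \<alpha> + b \<alpha>)"
proof (rule tate_expansionI)
  show "null_family (multi_indices I) (\<lambda>\<alpha>. a \<alpha> + b \<alpha>)"
    by (intro null_family_add tate_expansion_null_family[OF f] tate_expansion_null_family[OF g])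
  show "((\<lambda>\<alpha>. (a \<alpha> + b \<alpha>) * mpower I (crd x) \<alpha>) has_sum f x + g x) (multi_indices I)"
    if "x \<in> X" for x
    unfolding distrib_right
    using that by (intro has_sum_add tate_expansion_has_sum[OF f] tate_expansion_has_sum[OF g])
qed (simp add: tate_expansion_outside[OF f] tate_expansion_outside[OF g])

lemma tate_expansion_cmult:
  assumes f: "tate_expansion I X crd f a"
  shows "tate_expansion I X crd (\<lambda>x. c * f x) (\<lambda>\<alpha>. c * a \<alpha>)"
proof (rule tate_expansionI)
  show "null_family (multi_indices I) (\<lambda>\<alpha>. c * a \<alpha>)"
    by (rule null_family_cmult[OF tate_expansion_null_family[OF f]])
  show "((\<lambda>\<alpha>. c * a \<alpha> * mpower I (crd x) \<alpha>) has_sum c * f x) (multi_indices I)" if "x \<in> X" for x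
    unfolding mult.assoc using that by (intro has_sum_cmult_right tate_expansion_has_sum[OF f])
qed (simp add: tate_expansion_outside[OF f])

lemma null_family_power_series_has_sum:
  assumes "null_family UNIV c" "vabs y \<le> 1"
  shows "((\<lambda>k. c k * y ^ k) has_sum (\<Sum>\<^sub>\<infinity>k. c k * y ^ k)) UNIV"
  using assms
  by (intro null_family_has_sum null_family_le[OF assms(1)] vabs_mult_le_left)
     (simp add: vabs_power power_le_one)

lemma vabs_leading_coeff_le:
  fixes g :: "nat \<Rightarrow> 'k::nonarch_field"
  assumes zero: "((\<lambda>k. g k * t ^ k) has_sum 0) UNIV" and t: "t \<noteq> 0" "vabs t \<le> 1"
    and bounded: "\<And>k. vabs (g k) \<le> C" and below: "\<And>j. j < m \<Longrightarrow> g j = 0"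
  shows "vabs (g m) \<le> C * vabs t"
proof -
  have "C \<ge> 0" using vabs_nonneg bounded by (rule order_trans)
  have "((\<lambda>k. g k * t ^ k) has_sum g m * t ^ m) {m}" by (simp add: has_sum_finite_iff)
  from has_sum_Diff[OF zero this]
  have "((\<lambda>k. g k * t ^ k) has_sum - (g m * t ^ m)) (UNIV - {m})" by simp
  then have "vabs (- (g m * t ^ m)) \<le> C * vabs t ^ Suc m"
  proof (rule has_sum_vabs_le)
    show "0 \<le> C * vabs t ^ Suc m" using \<open>C \<ge> 0\<close> by simp
    fix j assume "j \<in> UNIV - {m}"
    then consider "j < m" | "Suc m \<le> j" by fastforce
    then show "vabs (g j * t ^ j) \<le> C * vabs t ^ Suc m"
    proof cases
      case 1
      then show ?thesis using below \<open>C \<ge> 0\<close> by simp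
    next
      case 2
      then have "vabs t ^ j \<le> vabs t ^ Suc m" using t by (intro power_decreasing) auto
      then show ?thesis
        unfolding vabs_mult vabs_power using bounded \<open>C \<ge> 0\<close> by (intro mult_mono) auto
    qed
  qed
  then have "vabs (g m) * vabs t ^ m \<le> (C * vabs t) * vabs t ^ m"
    by (simp add: vabs_mult vabs_power mult_ac)
  then show ?thesis by (rule mult_right_le_imp_le) (use t in simp)
qed

definition insert_index :: "'j \<Rightarrow> nat \<times> ('j \<Rightarrow> nat) \<Rightarrow> 'j \<Rightarrow> nat" where
  "insert_index i = (\<lambda>(k, \<beta>). \<beta>(i := k))"

lemma bij_betw_insert_index:
  assumes "i \<notin> J"
  shows "bij_betw (insert_index i) (UNIV \<times> multi_indices J) (multi_indices (insert i J))"
proof (rule bij_betw_byWitness[where f' = "\<lambda>\<alpha>. (\<alpha> i, \<alpha>(i := 0))"])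
  show "\<forall>x\<in>UNIV \<times> multi_indices J.
      (insert_index i x i, (insert_index i x)(i := 0)) = x"
    using assms by (auto simp: insert_index_def multi_indices_def fun_eq_iff)
qed (auto simp: insert_index_def multi_indices_def)

lemma mpower_insert_index:
  assumes "finite J" "i \<notin> J"
  shows "mpower (insert i J) (z(i := t)) (insert_index i (k, \<beta>)) = t ^ k * mpower J z \<beta>"
proof -
  have "(\<Prod>j\<in>J. (z(i := t)) j ^ (\<beta>(i := k)) j) = (\<Prod>j\<in>J. z j ^ \<beta> j)"
    using assms(2) by (intro prod.cong) auto
  then show ?thesis unfolding mpower_def insert_index_def using assms by simp
qed

context padic_field
begin

lemma power_series_coeff_eq_0:
  fixes g :: "nat \<Rightarrow> 'k"
  assumes g: "null_family UNIV g"
    and zero: "\<And>t. t \<in> Zp \<Longrightarrow> ((\<lambda>k. g k * t ^ k) has_sum 0) UNIV"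
  shows "g k = 0"
proof (rule ccontr)
  assume "g k \<noteq> 0"
  define m where "m = (LEAST k. g k \<noteq> 0)"
  have gm: "g m \<noteq> 0" unfolding m_def using \<open>g k \<noteq> 0\<close> by (rule LeastI)
  have below: "g j = 0" if "j < m" for j using not_less_Least that unfolding m_def by blast
  obtain C where C: "C > 0" "\<And>k. vabs (g k) \<le> C" using null_family_bounded[OF g] by auto
  have "vabs (g m) \<le> C * (1 / real p) ^ N" for N
  proof -
    have "vabs (of_nat p ^ N :: 'k) = (1 / real p) ^ N" by (simp add: vabs_power vabs_p)
    moreover have "(1 / real p) ^ N \<le> 1" using p_ge_2 by (intro power_le_one) auto
    ultimately show ?thesis
      using vabs_leading_coeff_le[OF zero[of "of_nat p ^ N"] _ _ C(2) below] by (simp add: Zp_power)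
  qed
  moreover have "(\<lambda>N. C * (1 / real p) ^ N) \<longlonglongrightarrow> C * 0"
    using p_ge_2 by (intro tendsto_mult tendsto_const LIMSEQ_power_zero) auto
  ultimately have "vabs (g m) \<le> C * 0" by (intro LIMSEQ_le_const) auto
  then show False using iffD2[OF vabs_pos_iff gm] by simp
qed

lemma infsum_fiber_eq_0:
  fixes b :: "nat \<times> 'j \<Rightarrow> 'k"
  assumes b: "null_family (UNIV \<times> B) b"
    and zero: "\<And>t. t \<in> Zp \<Longrightarrow> ((\<lambda>(k, j). b (k, j) * t ^ k) has_sum 0) (UNIV \<times> B)"
  shows "(\<Sum>\<^sub>\<infinity>j\<in>B. b (k, j)) = 0"
proof (rule power_series_coeff_eq_0[of "\<lambda>k. \<Sum>\<^sub>\<infinity>j\<in>B. b (k, j)", OF null_family_infsum[OF b]])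
  fix t :: 'k assume "t \<in> Zp"
  have "((\<lambda>j. b (k, j)) has_sum (\<Sum>\<^sub>\<infinity>j\<in>B. b (k, j))) B" for k
    by (rule null_family_has_sum[OF null_family_fiber[OF b]]) simp
  then show "((\<lambda>k. (\<Sum>\<^sub>\<infinity>j\<in>B. b (k, j)) * t ^ k) has_sum 0) UNIV"
    by (intro has_sum_SigmaD[OF zero[OF \<open>t \<in> Zp\<close>]]) (simp add: has_sum_cmult_left)
qed

lemma multi_power_series_coeff_eq_0:
  fixes a :: "('j \<Rightarrow> nat) \<Rightarrow> 'k"
  assumes "finite J" "null_family (multi_indices J) a"
    and "\<And>z. z \<in> Zp_points J \<Longrightarrow> ((\<lambda>\<alpha>. a \<alpha> * mpower J z \<alpha>) has_sum 0) (multi_indices J)"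
    and "\<alpha> \<in> multi_indices J"
  shows "a \<alpha> = 0"
  using assms
proof (induction J arbitrary: a \<alpha> rule: finite_induct)
  case empty
  have "multi_indices {} = {\<lambda>_::'j. 0::nat}" by (auto simp: multi_indices_def)
  moreover have "(\<lambda>_. 0) \<in> (Zp_points {} :: ('j \<Rightarrow> 'k) set)" by (simp add: Zp_points_def)
  ultimately show ?case
    using empty.prems(2)[of "\<lambda>_. 0"] empty.prems(3) by (simp add: has_sum_finite_iff)
next
  case (insert i J)
  let ?M = "multi_indices J"
  define a' where "a' = (\<lambda>x. a (insert_index i x))"
  note bij = bij_betw_insert_index[OF insert.hyps(2)]
  have a': "null_family (UNIV \<times> ?M) a'"
    unfolding a'_def by (rule null_family_reindex_bij_betw[OF bij insert.prems(1)])
  have "a' (k, \<beta>) = 0" if "\<beta> \<in> ?M" for k \<beta>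
  proof (rule insert.IH[of "\<lambda>\<beta>. a' (k, \<beta>)"])
    show "null_family ?M (\<lambda>\<beta>. a' (k, \<beta>))" by (rule null_family_fiber[OF a']) simp
    fix z :: "'j \<Rightarrow> 'k" assume z: "z \<in> Zp_points J"
    define b where "b = (\<lambda>(k, \<beta>). a' (k, \<beta>) * mpower J z \<beta>)"
    have "vabs (mpower J z \<beta>) \<le> 1" for \<beta>
      using z by (intro vabs_mpower_le_1) (auto simp: Zp_points_def vabs_Zp)
    then have b: "null_family (UNIV \<times> ?M) b"
      by (intro null_family_le[OF a']) (auto simp: b_def intro: vabs_mult_le_left)
    have "((\<lambda>(k, \<beta>). b (k, \<beta>) * t ^ k) has_sum 0) (UNIV \<times> ?M)" if "t \<in> Zp" for t
    proof -
      have "z(i := t) \<in> Zp_points (insert i J)" using z that by (auto simp: Zp_points_def)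
      from insert.prems(2)[OF this]
      have "((\<lambda>x. a' x * mpower (insert i J) (z(i := t)) (insert_index i x)) has_sum 0) (UNIV \<times> ?M)"
        unfolding a'_def by (subst has_sum_reindex_bij_betw[OF bij])
      then show ?thesis
        by (rule has_sum_cong[THEN iffD1, rotated])
           (auto simp: mpower_insert_index[OF insert.hyps] b_def)
    qed
    from infsum_fiber_eq_0[OF b this, of k] null_family_has_sum[OF null_family_fiber[OF b, of k]]
    show "((\<lambda>\<beta>. a' (k, \<beta>) * mpower J z \<beta>) has_sum 0) ?M" by (simp add: b_def)
  qed (use that in auto)
  moreover have "\<alpha> \<in> insert_index i ` (UNIV \<times> ?M)"
    using insert.prems(3) bij_betw_imp_surj_on[OF bij] by simp
  ultimately show ?case by (auto simp: a'_def)
qed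

lemma tate_expansion_unique:
  fixes a b :: "('j \<Rightarrow> nat) \<Rightarrow> 'k"
  assumes "finite J" and a: "tate_expansion J X crd f a" and b: "tate_expansion J X crd f b"
    and onto: "\<And>z. z \<in> Zp_points J \<Longrightarrow> \<exists>x\<in>X. \<forall>j\<in>J. crd x j = z j"
  shows "a = b"
proof
  fix \<alpha>
  have diff: "tate_expansion J X crd (\<lambda>x. f x + - 1 * f x) (\<lambda>\<alpha>. a \<alpha> + - 1 * b \<alpha>)"
    by (intro tate_expansion_add tate_expansion_cmult a b)
  show "a \<alpha> = b \<alpha>"
  proof (cases "\<alpha> \<in> multi_indices J")
    case True
    have "a \<alpha> + - 1 * b \<alpha> = 0"
    proof (rule multi_power_series_coeff_eq_0[OF \<open>finite J\<close> _ _ True])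
      show "null_family (multi_indices J) (\<lambda>\<alpha>. a \<alpha> + - 1 * b \<alpha>)"
        by (rule tate_expansion_null_family[OF diff])
      fix z :: "'j \<Rightarrow> 'k" assume "z \<in> Zp_points J"
      then obtain x where x: "x \<in> X" "\<forall>j\<in>J. crd x j = z j" using onto by blast
      then have "mpower J (crd x) \<alpha> = mpower J z \<alpha>" for \<alpha> by (intro mpower_cong) auto
      then show "((\<lambda>\<alpha>. (a \<alpha> + - 1 * b \<alpha>) * mpower J z \<alpha>) has_sum 0) (multi_indices J)"
        using tate_expansion_has_sum[OF diff x(1)] by simp
    qed
    then show ?thesis by simp
  qed (simp add: tate_expansion_outside[OF a] tate_expansion_outside[OF b])
qed

end

section \<open>The unit ball of a Tate algebra\<close>

locale tate_coordinates =
  fixes I :: "'i set" and X :: "'x set" and crd :: "'x \<Rightarrow> 'i \<Rightarrow> 'k::nonarch_field"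
  assumes finite_I: "finite I" and vabs_crd_le_1: "\<And>x i. x \<in> X \<Longrightarrow> i \<in> I \<Longrightarrow> vabs (crd x i) \<le> 1"
begin

lemma vabs_mpower_crd_le_1: "x \<in> X \<Longrightarrow> vabs (mpower I (crd x) \<alpha>) \<le> 1"
  by (intro vabs_mpower_le_1 vabs_crd_le_1)

lemma tate_expansion_infsum:
  assumes a: "null_family (K \<times> multi_indices I) (\<lambda>(k, \<alpha>). a k \<alpha>)"
    and r: "\<And>k. k \<in> K \<Longrightarrow> tate_expansion I X crd (r k) (a k)"
    and f: "\<And>x. x \<in> X \<Longrightarrow> ((\<lambda>k. r k x) has_sum f x) K"
  shows "tate_expansion I X crd f (\<lambda>\<alpha>. \<Sum>\<^sub>\<infinity>k\<in>K. a k \<alpha>)"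
proof (rule tate_expansionI)
  let ?M = "multi_indices I"
  have a': "null_family (?M \<times> K) (\<lambda>(\<alpha>, k). a k \<alpha>)" using null_family_swap[OF a] by simp
  show "null_family ?M (\<lambda>\<alpha>. \<Sum>\<^sub>\<infinity>k\<in>K. a k \<alpha>)" using null_family_infsum[OF a'] by simp
  show "(\<Sum>\<^sub>\<infinity>k\<in>K. a k \<alpha>) = 0" if "\<alpha> \<notin> ?M" for \<alpha>
    using tate_expansion_outside[OF r that] by (intro infsum_0)
  fix x assume x: "x \<in> X"
  define b where "b = (\<lambda>(k, \<alpha>). a k \<alpha> * mpower I (crd x) \<alpha>)"
  have b: "null_family (K \<times> ?M) b"
    by (rule null_family_le[OF a])
       (auto simp: b_def intro: vabs_mult_le_left vabs_mpower_crd_le_1[OF x])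
  have "(\<Sum>\<^sub>\<infinity>\<alpha>\<in>?M. b (k, \<alpha>)) = r k x" if "k \<in> K" for k
    unfolding b_def using tate_expansion_has_sum[OF r[OF that] x] by (simp add: infsumI)
  then have "((\<lambda>k. r k x) has_sum infsum b (K \<times> ?M)) K"
    using null_family_has_sum_infsum_left[OF b] by (simp cong: has_sum_cong)
  then have "f x = infsum b (K \<times> ?M)" using f[OF x] has_sum_unique by blast
  then have "((\<lambda>\<alpha>. \<Sum>\<^sub>\<infinity>k\<in>K. b (k, \<alpha>)) has_sum f x) ?M"
    using null_family_has_sum_infsum_right[OF b] by simp
  moreover have "(\<Sum>\<^sub>\<infinity>k\<in>K. b (k, \<alpha>)) = (\<Sum>\<^sub>\<infinity>k\<in>K. a k \<alpha>) * mpower I (crd x) \<alpha>"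
    if "\<alpha> \<in> ?M" for \<alpha>
    using has_sum_cmult_left[OF null_family_has_sum[OF null_family_fiber[OF a' that]]]
    by (simp add: b_def infsumI)
  ultimately show "((\<lambda>\<alpha>. (\<Sum>\<^sub>\<infinity>k\<in>K. a k \<alpha>) * mpower I (crd x) \<alpha>) has_sum f x) ?M"
    by (simp cong: has_sum_cong)
qed

definition tate_ball :: "('x \<Rightarrow> 'k) set" where
  "tate_ball = {r. \<exists>a. tate_expansion I X crd r a \<and> (\<forall>\<alpha>. vabs (a \<alpha>) \<le> 1)}"

lemma tate_ballI: "tate_expansion I X crd r a \<Longrightarrow> (\<And>\<alpha>. vabs (a \<alpha>) \<le> 1) \<Longrightarrow> r \<in> tate_ball"
  by (auto simp: tate_ball_def)

lemma tate_ballE: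
  assumes "r \<in> tate_ball"
  obtains a where "tate_expansion I X crd r a" "\<And>\<alpha>. vabs (a \<alpha>) \<le> 1"
  using assms by (auto simp: tate_ball_def)

lemma tate_ball_cong:
  "r \<in> tate_ball \<Longrightarrow> (\<And>x. x \<in> X \<Longrightarrow> r x = s x) \<Longrightarrow> s \<in> tate_ball"
  unfolding tate_ball_def using tate_expansion_cong[of X r s I crd] by auto

lemma tate_ball_vabs_le_1:
  assumes "r \<in> tate_ball" "x \<in> X" shows "vabs (r x) \<le> 1"
proof -
  obtain a where a: "tate_expansion I X crd r a" "\<And>\<alpha>. vabs (a \<alpha>) \<le> 1"
    using assms(1) by (rule tate_ballE) blast
  have "vabs (a \<alpha> * mpower I (crd x) \<alpha>) \<le> 1" for \<alpha>
    using vabs_mult_le_left[OF vabs_mpower_crd_le_1[OF assms(2)]] a(2) by (rule order_trans)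
  then show ?thesis
    by (rule has_sum_vabs_le[OF tate_expansion_has_sum[OF a(1) assms(2)] zero_le_one])
qed

lemma tate_expansion_null_sum:
  assumes c: "null_family K c" and r: "\<And>k. k \<in> K \<Longrightarrow> r k \<in> tate_ball"
    and f: "\<And>x. x \<in> X \<Longrightarrow> ((\<lambda>k. c k * r k x) has_sum f x) K"
    and C: "C \<ge> 0" "\<And>k. k \<in> K \<Longrightarrow> vabs (c k) \<le> C"
  obtains b where "tate_expansion I X crd f b" "\<And>\<alpha>. vabs (b \<alpha>) \<le> C"
proof -
  have "\<exists>a. tate_expansion I X crd (r k) a \<and> (\<forall>\<alpha>. vabs (a \<alpha>) \<le> 1)" if "k \<in> K" for k
    using r[OF that] by (auto simp: tate_ball_def)
  then obtain a where a: "\<And>k. k \<in> K \<Longrightarrow> tate_expansion I X crd (r k) (a k)"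
      "\<And>k \<alpha>. k \<in> K \<Longrightarrow> vabs (a k \<alpha>) \<le> 1"
    by metis
  show thesis
  proof
    show "tate_expansion I X crd f (\<lambda>\<alpha>. \<Sum>\<^sub>\<infinity>k\<in>K. c k * a k \<alpha>)"
    proof (rule tate_expansion_infsum[OF _ _ f])
      show "null_family (K \<times> multi_indices I) (\<lambda>(k, \<alpha>). c k * a k \<alpha>)"
        using a by (intro null_family_mult[OF c]) (auto intro: tate_expansion_null_family)
    qed (rule tate_expansion_cmult[OF a(1)])
    show "vabs (\<Sum>\<^sub>\<infinity>k\<in>K. c k * a k \<alpha>) \<le> C" for \<alpha>
      using C by (intro vabs_infsum_le) (meson a(2) order_trans vabs_mult_le_left)+
  qed
qed

lemma tate_ball_null_sum:
  assumes "null_family K c" "\<And>k. k \<in> K \<Longrightarrow> vabs (c k) \<le> 1" "\<And>k. k \<in> K \<Longrightarrow> r k \<in> tate_ball"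
    and "\<And>x. x \<in> X \<Longrightarrow> ((\<lambda>k. c k * r k x) has_sum f x) K"
  shows "f \<in> tate_ball"
  by (rule tate_expansion_null_sum[OF assms(1,3,4) zero_le_one assms(2)]) (auto intro: tate_ballI)

lemma tate_ball_const:
  assumes "vabs c \<le> 1" shows "(\<lambda>_. c) \<in> tate_ball"
proof (rule tate_ballI)
  define a where "a = (\<lambda>\<alpha>::'i \<Rightarrow> nat. if \<alpha> = (\<lambda>_. 0) then c else 0)"
  show "vabs (a \<alpha>) \<le> 1" for \<alpha> using assms by (simp add: a_def)
  show "tate_expansion I X crd (\<lambda>_. c) a"
  proof (rule tate_expansionI)
    show "null_family (multi_indices I) a"
      by (rule null_family_superset[OF null_family_finite[of "{\<lambda>_. 0}"]]) (auto simp: a_def)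
    show "((\<lambda>\<alpha>. a \<alpha> * mpower I (crd x) \<alpha>) has_sum c) (multi_indices I)" for x
      by (rule has_sum_finite_neutralI[of "{\<lambda>_. 0}"]) (auto simp: a_def)
  qed (auto simp: a_def)
qed

lemma tate_ball_add:
  assumes "r \<in> tate_ball" "s \<in> tate_ball"
  shows "(\<lambda>x. r x + s x) \<in> tate_ball"
proof -
  obtain a b where "tate_expansion I X crd r a" "tate_expansion I X crd s b"
    and le_1: "\<And>\<alpha>. vabs (a \<alpha>) \<le> 1" "\<And>\<alpha>. vabs (b \<alpha>) \<le> 1"
    using assms by (metis tate_ballE)
  moreover have "vabs (a \<alpha> + b \<alpha>) \<le> 1" for \<alpha>
    using vabs_ultrametric[of "a \<alpha>" "b \<alpha>"] le_1[of \<alpha>] by simp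
  ultimately show ?thesis by (intro tate_ballI[OF tate_expansion_add])
qed

lemma tate_expansion_monomial_mult:
  assumes a: "tate_expansion I X crd r a" and \<beta>: "\<beta> \<in> multi_indices I"
  defines "shift \<equiv> \<lambda>\<alpha> i. \<alpha> i + \<beta> i"
  shows "tate_expansion I X crd (\<lambda>x. mpower I (crd x) \<beta> * r x)
    (\<lambda>\<gamma>. if \<gamma> \<in> shift ` multi_indices I then a (\<lambda>i. \<gamma> i - \<beta> i) else 0)"
    (is "tate_expansion I X crd _ ?b")
proof (rule tate_expansionI)
  let ?M = "multi_indices I"
  have subset: "shift ` ?M \<subseteq> ?M" using \<beta> by (auto simp: shift_def multi_indices_def)
  have inj: "inj_on shift ?M" by (rule inj_onI) (auto simp: shift_def fun_eq_iff)
  have b_shift: "?b (shift \<alpha>) = a \<alpha>" if "\<alpha> \<in> ?M" for \<alpha> using that by (auto simp: shift_def)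
  show "?b \<gamma> = 0" if "\<gamma> \<notin> ?M" for \<gamma> using that subset by auto
  have "null_family (shift ` ?M) ?b"
    unfolding null_family_reindex[OF inj]
    by (rule null_family_cong[OF tate_expansion_null_family[OF a] b_shift])
  then show "null_family ?M ?b" by (rule null_family_superset) (use subset in auto)
  fix x assume "x \<in> X"
  let ?m = "mpower I (crd x)"
  have "((\<lambda>\<alpha>. ?m \<beta> * (a \<alpha> * ?m \<alpha>)) has_sum ?m \<beta> * r x) ?M"
    using \<open>x \<in> X\<close> by (intro has_sum_cmult_right tate_expansion_has_sum[OF a])
  then have "((\<lambda>\<alpha>. ?b (shift \<alpha>) * ?m (shift \<alpha>)) has_sum ?m \<beta> * r x) ?M"
    by (rule has_sum_cong[THEN iffD1, rotated]) (simp only: b_shift, simp add: shift_def mpower_add)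
  then have "((\<lambda>\<gamma>. ?b \<gamma> * ?m \<gamma>) has_sum ?m \<beta> * r x) (shift ` ?M)"
    by (subst has_sum_reindex[OF inj]) (simp add: o_def)
  then show "((\<lambda>\<gamma>. ?b \<gamma> * ?m \<gamma>) has_sum ?m \<beta> * r x) ?M"
    by (rule has_sum_cong_neutral[THEN iffD1, rotated -1]) (use subset in auto)
qed

lemma tate_ball_monomial_mult:
  assumes "r \<in> tate_ball" "\<beta> \<in> multi_indices I"
  shows "(\<lambda>x. mpower I (crd x) \<beta> * r x) \<in> tate_ball"
proof -
  obtain a where "tate_expansion I X crd r a" "\<And>\<alpha>. vabs (a \<alpha>) \<le> 1"
    using assms(1) by (rule tate_ballE) blast
  then show ?thesis by (intro tate_ballI[OF tate_expansion_monomial_mult[OF _ assms(2)]]) auto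
qed

lemma tate_ball_crd:
  assumes "i \<in> I" shows "(\<lambda>x. crd x i) \<in> tate_ball"
proof -
  define \<delta> where "\<delta> = (\<lambda>j. if j = i then 1 else 0 :: nat)"
  have "\<delta> \<in> multi_indices I" using assms by (auto simp: \<delta>_def multi_indices_def)
  from tate_ball_monomial_mult[OF tate_ball_const[of 1] this]
  have "(\<lambda>x. mpower I (crd x) \<delta>) \<in> tate_ball" by simp
  moreover have "mpower I (crd x) \<delta> = crd x i" for x
  proof -
    have "mpower I (crd x) \<delta> = (\<Prod>j\<in>I. if j = i then crd x j else 1)"
      unfolding mpower_def \<delta>_def by (intro prod.cong) auto
    then show ?thesis using finite_I assms by simp
  qed
  ultimately show ?thesis by simp
qed

lemma tate_ball_mult:
  assumes r: "r \<in> tate_ball" and s: "s \<in> tate_ball"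
  shows "(\<lambda>x. r x * s x) \<in> tate_ball"
proof -
  obtain b where b: "tate_expansion I X crd s b" "\<And>\<alpha>. vabs (b \<alpha>) \<le> 1"
    using s by (rule tate_ballE) blast
  show ?thesis
  proof (rule tate_ball_null_sum[OF tate_expansion_null_family[OF b(1)] b(2)])
    fix x assume "x \<in> X"
    then have "((\<lambda>\<beta>. r x * (b \<beta> * mpower I (crd x) \<beta>)) has_sum r x * s x) (multi_indices I)"
      by (intro has_sum_cmult_right tate_expansion_has_sum[OF b(1)])
    then show "((\<lambda>\<beta>. b \<beta> * (mpower I (crd x) \<beta> * r x)) has_sum r x * s x) (multi_indices I)"
      by (simp add: mult_ac)
  qed (rule tate_ball_monomial_mult[OF r])
qed

lemma tate_ball_power: "r \<in> tate_ball \<Longrightarrow> (\<lambda>x. r x ^ k) \<in> tate_ball"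
  by (induction k) (auto intro: tate_ball_mult tate_ball_const)

lemma tate_ball_prod:
  "(\<And>i. i \<in> S \<Longrightarrow> r i \<in> tate_ball) \<Longrightarrow> (\<lambda>x. \<Prod>i\<in>S. r i x) \<in> tate_ball"
  by (induction S rule: infinite_finite_induct) (auto intro: tate_ball_mult tate_ball_const)

lemma tate_ball_power_series:
  assumes "null_family UNIV c" "\<And>k. vabs (c k) \<le> 1" "r \<in> tate_ball"
  shows "(\<lambda>x. \<Sum>\<^sub>\<infinity>k. c k * r x ^ k) \<in> tate_ball"
  by (rule tate_ball_null_sum[OF assms(1,2) tate_ball_power[OF assms(3)]])
     (rule null_family_power_series_has_sum[OF assms(1) tate_ball_vabs_le_1[OF assms(3)]])

end

section \<open>The p-adic logarithm and exponential as power series\<close>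

context padic_field
begin

definition log_coeff :: "nat \<Rightarrow> 'k" where
  "log_coeff k = (- 1) ^ k * of_nat p ^ k / of_nat (Suc k)"

lemma vabs_log_coeff_le: "vabs (log_coeff k) \<le> real (Suc k) * (1 / real p) ^ k"
proof -
  have "vabs (log_coeff k) = (1 / real p) ^ k / vabs (of_nat (Suc k) :: 'k)"
    by (simp add: log_coeff_def vabs_divide vabs_mult vabs_power vabs_p del: of_nat_Suc)
  also have "\<dots> \<le> (1 / real p) ^ k / (1 / real (Suc k))"
    using vabs_of_nat_ge[of "Suc k"] by (intro divide_left_mono) (auto simp del: of_nat_Suc)
  finally show ?thesis by (simp add: mult.commute)
qed

lemma vabs_log_coeff_le_1: "vabs (log_coeff k) \<le> 1"
proof -
  have "Suc k \<le> 2 ^ k" by (induction k) auto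
  also have "(2::nat) ^ k \<le> p ^ k" using p_ge_2 by (intro power_mono) auto
  finally have "real (Suc k) \<le> real p ^ k" by (metis of_nat_le_iff of_nat_power)
  then have "real (Suc k) * (1 / real p) ^ k \<le> 1"
    using p_ge_2 by (simp add: power_one_over divide_simps)
  then show ?thesis using vabs_log_coeff_le[of k] by linarith
qed

lemma null_family_log_coeff: "null_family UNIV log_coeff"
  unfolding null_family_nat_iff
proof (rule tendsto_sandwich[OF _ _ tendsto_const])
  have "norm (1 / real p) < 1" using p_ge_2 by simp
  then have "(\<lambda>k. real k * (1 / real p) ^ k + (1 / real p) ^ k) \<longlonglongrightarrow> 0 + 0"
    by (intro tendsto_add powser_times_n_limit_0 LIMSEQ_power_zero) auto
  then show "(\<lambda>k. real (Suc k) * (1 / real p) ^ k) \<longlonglongrightarrow> 0" by (simp add: algebra_simps)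
qed (use vabs_log_coeff_le in \<open>auto intro!: always_eventually\<close>)

lemma padic_log_one_plus_p_mult:
  assumes "vabs (y::'k) \<le> 1"
  shows "padic_log (1 + of_nat p * y) = of_nat p * (y * (\<Sum>\<^sub>\<infinity>k. log_coeff k * y ^ k))"
proof -
  have "(\<lambda>k. of_nat p * (y * (log_coeff k * y ^ k))) sums
      (of_nat p * (y * (\<Sum>\<^sub>\<infinity>k. log_coeff k * y ^ k)))"
    using null_family_power_series_has_sum[OF null_family_log_coeff assms]
    by (intro has_sum_imp_sums has_sum_cmult_right)
  moreover have "of_nat p * (y * (log_coeff k * y ^ k))
      = (- 1) ^ k * (1 + of_nat p * y - 1) ^ Suc k / of_nat (Suc k)" for k
    by (simp add: log_coeff_def power_mult_distrib mult_ac del: of_nat_Suc)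
  ultimately show ?thesis unfolding padic_log_def by (simp only: sums_unique[symmetric])
qed

definition exp_coeff :: "'k \<Rightarrow> nat \<Rightarrow> 'k" where
  "exp_coeff b k = b ^ k / fact k"

lemma vabs_exp_coeff_le: "vabs (exp_coeff b k) \<le> (vabs b / exp_radius) ^ k"
proof -
  have "vabs (exp_coeff b k) = vabs b ^ k / vabs (fact k :: 'k)"
    by (simp add: exp_coeff_def vabs_divide vabs_power)
  also have "\<dots> \<le> vabs b ^ k / exp_radius ^ k"
    using vabs_fact_ge[of k] exp_radius_pos by (intro divide_left_mono) auto
  finally show ?thesis by (simp add: power_divide)
qed

lemma
  assumes b: "vabs b < exp_radius"
  shows vabs_exp_coeff_le_1: "vabs (exp_coeff b k) \<le> 1"
    and null_family_exp_coeff: "null_family UNIV (exp_coeff b)"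
proof -
  let ?q = "vabs b / exp_radius"
  have q: "0 \<le> ?q" "?q < 1" using b exp_radius_pos by auto
  then show "vabs (exp_coeff b k) \<le> 1"
    using vabs_exp_coeff_le[of b k] power_le_one[of ?q k] by linarith
  show "null_family UNIV (exp_coeff b)"
    unfolding null_family_nat_iff
  proof (rule tendsto_sandwich[OF _ _ tendsto_const])
    show "(\<lambda>k. ?q ^ k) \<longlonglongrightarrow> 0" using q by (intro LIMSEQ_power_zero) simp
  qed (use vabs_exp_coeff_le in \<open>auto intro!: always_eventually\<close>)
qed

lemma padic_exp_mult:
  assumes "vabs b < exp_radius" "vabs y \<le> 1"
  shows "padic_exp (b * y) = (\<Sum>\<^sub>\<infinity>k. exp_coeff b k * y ^ k)"
proof -
  have "(\<lambda>k. exp_coeff b k * y ^ k) sums (\<Sum>\<^sub>\<infinity>k. exp_coeff b k * y ^ k)"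
    by (intro has_sum_imp_sums null_family_power_series_has_sum null_family_exp_coeff assms)
  moreover have "exp_coeff b k * y ^ k = (b * y) ^ k / fact k" for k
    by (simp add: exp_coeff_def power_mult_distrib)
  ultimately show ?thesis unfolding padic_exp_def by (simp only: sums_unique[symmetric])
qed

end

locale tate_space = padic_field p ty + tate_coordinates I X crd
  for p :: nat and ty :: "'k::nonarch_field itself"
    and I :: "'i set" and X :: "'x set" and crd :: "'x \<Rightarrow> 'i \<Rightarrow> 'k" +
  assumes crd_Zp: "\<And>x i. x \<in> X \<Longrightarrow> i \<in> I \<Longrightarrow> crd x i \<in> Zp"
begin

lemma tate_ball_inverse:
  assumes r: "r \<in> tate_ball"
  shows "(\<lambda>x. 1 / (1 + of_nat p * r x)) \<in> tate_ball"
proof (rule tate_ball_cong[OF tate_ball_power_series[OF _ _ r]])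
  have less_1: "vabs (- of_nat p :: 'k) < 1" using vabs_p p_ge_2 by simp
  then show "null_family UNIV (\<lambda>k. (- of_nat p :: 'k) ^ k)" by (rule null_family_powers)
  show "vabs ((- of_nat p :: 'k) ^ k) \<le> 1" for k
    unfolding vabs_power using less_1 by (intro power_le_one) auto
  fix x assume "x \<in> X"
  then have "vabs (- of_nat p * r x) < 1"
    using vabs_p_mult_less_1[OF tate_ball_vabs_le_1[OF r]] by simp
  then show "(\<Sum>\<^sub>\<infinity>k. (- of_nat p) ^ k * r x ^ k) = 1 / (1 + of_nat p * r x)"
    using infsumI[OF has_sum_geometric] by (fastforce simp: power_mult_distrib[symmetric])
qed

lemma tate_ball_exp_log:
  assumes r: "r \<in> tate_ball" and c: "vabs (c * of_nat p) < exp_radius"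
  shows "(\<lambda>x. padic_exp (c * padic_log (1 + of_nat p * r x))) \<in> tate_ball"
proof -
  define L where "L = (\<lambda>x. r x * (\<Sum>\<^sub>\<infinity>k. log_coeff k * r x ^ k))"
  have L: "L \<in> tate_ball"
    unfolding L_def
    by (intro tate_ball_mult tate_ball_power_series null_family_log_coeff vabs_log_coeff_le_1 r)
  show ?thesis
  proof (rule tate_ball_cong)
    show "(\<lambda>x. \<Sum>\<^sub>\<infinity>k. exp_coeff (c * of_nat p) k * L x ^ k) \<in> tate_ball"
      by (intro tate_ball_power_series null_family_exp_coeff vabs_exp_coeff_le_1 c L)
    fix x assume x: "x \<in> X"
    have "padic_exp (c * padic_log (1 + of_nat p * r x)) = padic_exp (c * of_nat p * L x)"
      by (simp add: padic_log_one_plus_p_mult[OF tate_ball_vabs_le_1[OF r x]] L_def mult.assoc)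
    then show "(\<Sum>\<^sub>\<infinity>k. exp_coeff (c * of_nat p) k * L x ^ k)
        = padic_exp (c * padic_log (1 + of_nat p * r x))"
      using padic_exp_mult[OF c tate_ball_vabs_le_1[OF L x]] by simp
  qed
qed

end

section \<open>The Gauss norm\<close>

definition gauss_norm ::
  "'i set \<Rightarrow> 'x set \<Rightarrow> ('x \<Rightarrow> 'i \<Rightarrow> 'k) \<Rightarrow> ('x \<Rightarrow> 'k::nonarch_field) \<Rightarrow> real" where
  "gauss_norm I X crd f = (SUP \<alpha>\<in>multi_indices I. vabs ((THE a. tate_expansion I X crd f a) \<alpha>))"

lemma ind_norm_eq_gauss_norm: "ind_norm p n w = gauss_norm (Uw_pos n w) (Uw p n w) (Uw_crd p)"
  by (simp add: fun_eq_iff ind_norm_def gauss_norm_def Uw_expansion_def)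

locale full_tate_space = tate_space p ty I X crd
  for p :: nat and ty :: "'k::nonarch_field itself"
    and I :: "'i set" and X :: "'x set" and crd :: "'x \<Rightarrow> 'i \<Rightarrow> 'k" +
  assumes crd_onto: "\<And>z. z \<in> Zp_points I \<Longrightarrow> \<exists>x\<in>X. \<forall>i\<in>I. crd x i = z i"
begin

lemma expansion_unique: "tate_expansion I X crd f a \<Longrightarrow> tate_expansion I X crd f b \<Longrightarrow> a = b"
  by (rule tate_expansion_unique[OF finite_I]) (auto intro: crd_onto)

lemma gauss_norm_eq:
  assumes "tate_expansion I X crd f a"
  shows "gauss_norm I X crd f = (SUP \<alpha>\<in>multi_indices I. vabs (a \<alpha>))"
proof -
  have "(THE a. tate_expansion I X crd f a) = a" using assms expansion_unique by blast
  then show ?thesis by (simp add: gauss_norm_def)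
qed

lemma gauss_norm_le:
  assumes "tate_expansion I X crd f a" "\<And>\<alpha>. vabs (a \<alpha>) \<le> C"
  shows "gauss_norm I X crd f \<le> C"
  unfolding gauss_norm_eq[OF assms(1)] using assms(2) zero_multi_index by (intro cSUP_least) blast+

lemma gauss_norm_nonneg:
  assumes "tate_expansion I X crd f a"
  shows "0 \<le> gauss_norm I X crd f"
proof -
  obtain C where "\<And>\<alpha>. \<alpha> \<in> multi_indices I \<Longrightarrow> vabs (a \<alpha>) \<le> C"
    using null_family_bounded[OF tate_expansion_null_family[OF assms]] by blast
  then have "vabs (a (\<lambda>_. 0)) \<le> gauss_norm I X crd f"
    unfolding gauss_norm_eq[OF assms] by (intro cSUP_upper bdd_aboveI2[of _ _ C]) auto
  then show ?thesis by (rule order_trans[OF vabs_nonneg])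
qed

context
  fixes K :: "'j set" and r :: "'j \<Rightarrow> 'x \<Rightarrow> 'k" and a :: "'j \<Rightarrow> ('i \<Rightarrow> nat) \<Rightarrow> 'k"
  assumes null: "null_family (K \<times> multi_indices I) (\<lambda>(k, \<alpha>). a k \<alpha>)"
    and expansion: "\<And>k. k \<in> K \<Longrightarrow> tate_expansion I X crd (r k) (a k)"
begin

definition large_terms :: "real \<Rightarrow> 'j set" where
  "large_terms \<epsilon> = {k \<in> K. \<exists>\<alpha>\<in>multi_indices I. \<epsilon> \<le> vabs (a k \<alpha>)}"

lemma finite_large_terms: "\<epsilon> > 0 \<Longrightarrow> finite (large_terms \<epsilon>)"
  unfolding large_terms_def using null_family_finite_large_fibers[OF null] by simp

lemma vabs_coeff_le_if_not_large:
  assumes "k \<in> K - large_terms \<epsilon>" "\<epsilon> > 0"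
  shows "vabs (a k \<alpha>) \<le> \<epsilon>"
proof (cases "\<alpha> \<in> multi_indices I")
  case True
  then show ?thesis using assms by (auto simp: large_terms_def not_le less_imp_le)
next
  case False
  then show ?thesis using assms by (simp add: tate_expansion_outside[OF expansion])
qed

lemma finite_gauss_norm_ge:
  assumes "\<epsilon> > 0"
  shows "finite {k \<in> K. \<epsilon> \<le> gauss_norm I X crd (r k)}"
proof (rule finite_subset[OF _ finite_large_terms[of "\<epsilon> / 2"]])
  show "{k \<in> K. \<epsilon> \<le> gauss_norm I X crd (r k)} \<subseteq> large_terms (\<epsilon> / 2)"
  proof (rule subsetI, rule ccontr)
    fix k assume k: "k \<in> {k \<in> K. \<epsilon> \<le> gauss_norm I X crd (r k)}" "k \<notin> large_terms (\<epsilon> / 2)"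
    then have "gauss_norm I X crd (r k) \<le> \<epsilon> / 2"
      using assms by (intro gauss_norm_le[OF expansion] vabs_coeff_le_if_not_large) auto
    then show False using k assms by simp
  qed
qed (use assms in simp)

lemma partial_sums_tendsto_gauss_norm:
  assumes f: "\<And>x. x \<in> X \<Longrightarrow> ((\<lambda>k. r k x) has_sum f x) K"
  shows "((\<lambda>S. gauss_norm I X crd (\<lambda>x. f x - (\<Sum>k\<in>S. r k x))) \<longlongrightarrow> 0) (finite_subsets_at_top K)"
proof (rule tendstoI)
  fix \<epsilon> :: real assume "\<epsilon> > 0"
  have "dist (gauss_norm I X crd (\<lambda>x. f x - (\<Sum>k\<in>S. r k x))) 0 < \<epsilon>"
    if S: "finite S" "large_terms (\<epsilon> / 2) \<subseteq> S" "S \<subseteq> K" for S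
  proof -
    have tail: "tate_expansion I X crd (\<lambda>x. f x - (\<Sum>k\<in>S. r k x)) (\<lambda>\<alpha>. \<Sum>\<^sub>\<infinity>k\<in>K - S. a k \<alpha>)"
    proof (rule tate_expansion_infsum)
      show "null_family ((K - S) \<times> multi_indices I) (\<lambda>(k, \<alpha>). a k \<alpha>)"
        by (rule null_family_subset[OF null]) auto
      show "((\<lambda>k. r k x) has_sum f x - (\<Sum>k\<in>S. r k x)) (K - S)" if "x \<in> X" for x
        using f[OF that] S by (intro has_sum_Diff) auto
    qed (use expansion in auto)
    have "vabs (\<Sum>\<^sub>\<infinity>k\<in>K - S. a k \<alpha>) \<le> \<epsilon> / 2" for \<alpha>
      using S \<open>\<epsilon> > 0\<close> by (intro vabs_infsum_le vabs_coeff_le_if_not_large) auto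
    from gauss_norm_le[OF tail this] gauss_norm_nonneg[OF tail] show ?thesis
      using \<open>\<epsilon> > 0\<close> by (simp add: dist_real_def)
  qed
  moreover have "finite (large_terms (\<epsilon> / 2))" "large_terms (\<epsilon> / 2) \<subseteq> K"
    using finite_large_terms[of "\<epsilon> / 2"] \<open>\<epsilon> > 0\<close> by (simp_all add: large_terms_def)
  ultimately show "\<forall>\<^sub>F S in finite_subsets_at_top K.
      dist (gauss_norm I X crd (\<lambda>x. f x - (\<Sum>k\<in>S. r k x))) 0 < \<epsilon>"
    unfolding eventually_finite_subsets_at_top by blast
qed

end

end

section \<open>Power series in two groups of variables\<close>

definition Plus_crd :: "('x \<Rightarrow> 'i \<Rightarrow> 'k) \<Rightarrow> ('y \<Rightarrow> 'j \<Rightarrow> 'k) \<Rightarrow> 'x \<times> 'y \<Rightarrow> 'i + 'j \<Rightarrow> 'k" where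
  "Plus_crd crd crd' = (\<lambda>(x, y). case_sum (crd x) (crd' y))"

lemma case_sum_in_multi_indices_iff:
  "case_sum \<alpha> \<beta> \<in> multi_indices (I <+> J) \<longleftrightarrow> \<alpha> \<in> multi_indices I \<and> \<beta> \<in> multi_indices J"
  unfolding multi_indices_def by (auto split: sum.split)

lemma bij_betw_case_sum_multi_indices:
  "bij_betw (\<lambda>(\<alpha>, \<beta>). case_sum \<alpha> \<beta>) (multi_indices I \<times> multi_indices J) (multi_indices (I <+> J))"
proof (rule bij_betw_byWitness[where f' = "\<lambda>\<gamma>. (\<gamma> \<circ> Inl, \<gamma> \<circ> Inr)"])
  have case_sum_comp: "case_sum (\<gamma> \<circ> Inl) (\<gamma> \<circ> Inr) = \<gamma>" for \<gamma> :: "'a + 'b \<Rightarrow> nat"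
    by (simp add: fun_eq_iff split: sum.split)
  then show "\<forall>\<gamma>\<in>multi_indices (I <+> J).
      (\<lambda>(\<alpha>, \<beta>). case_sum \<alpha> \<beta>) (\<gamma> \<circ> Inl, \<gamma> \<circ> Inr) = \<gamma>"
    by simp
  have "(\<gamma> \<circ> Inl, \<gamma> \<circ> Inr) \<in> multi_indices I \<times> multi_indices J"
    if "\<gamma> \<in> multi_indices (I <+> J)" for \<gamma>
    using that case_sum_in_multi_indices_iff[of "\<gamma> \<circ> Inl" "\<gamma> \<circ> Inr" I J]
    by (simp only: case_sum_comp) simp
  then show "(\<lambda>\<gamma>. (\<gamma> \<circ> Inl, \<gamma> \<circ> Inr)) ` multi_indices (I <+> J)
      \<subseteq> multi_indices I \<times> multi_indices J"
    by blast
qed (auto simp: case_sum_in_multi_indices_iff fun_eq_iff)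

lemma mpower_Plus:
  assumes "finite I" "finite J"
  shows "mpower (I <+> J) (Plus_crd crd crd' (x, y)) (case_sum \<alpha> \<beta>)
    = mpower I (crd x) \<alpha> * mpower J (crd' y) \<beta>"
  unfolding mpower_def by (subst prod.Plus[OF assms]) (simp add: Plus_crd_def)

locale tate_coordinates_pair = fst: tate_coordinates I X crd + snd: tate_coordinates J Y crd'
  for I :: "'i set" and X :: "'x set" and crd :: "'x \<Rightarrow> 'i \<Rightarrow> 'k::nonarch_field"
    and J :: "'j set" and Y :: "'y set" and crd' :: "'y \<Rightarrow> 'j \<Rightarrow> 'k" +
  fixes F :: "'x \<times> 'y \<Rightarrow> 'k" and c :: "('i + 'j \<Rightarrow> nat) \<Rightarrow> 'k"
  assumes expansion: "tate_expansion (I <+> J) (X \<times> Y) (Plus_crd crd crd') F c"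
begin

definition fst_coeff :: "('i \<Rightarrow> nat) \<Rightarrow> 'y \<Rightarrow> 'k" where
  "fst_coeff \<alpha> y = (\<Sum>\<^sub>\<infinity>\<beta>\<in>multi_indices J. c (case_sum \<alpha> \<beta>) * mpower J (crd' y) \<beta>)"

lemma null_family_coeff:
  "null_family (multi_indices I \<times> multi_indices J) (\<lambda>(\<alpha>, \<beta>). c (case_sum \<alpha> \<beta>))"
  using null_family_reindex_bij_betw[OF bij_betw_case_sum_multi_indices
      tate_expansion_null_family[OF expansion]]
  by (simp add: case_prod_unfold)

lemma coeff_outside: "\<alpha> \<notin> multi_indices I \<or> \<beta> \<notin> multi_indices J \<Longrightarrow> c (case_sum \<alpha> \<beta>) = 0"
  by (intro tate_expansion_outside[OF expansion]) (auto simp: case_sum_in_multi_indices_iff)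

lemma null_family_coeff_snd:
  assumes "y \<in> Y"
  shows "null_family (multi_indices I \<times> multi_indices J)
    (\<lambda>(\<alpha>, \<beta>). c (case_sum \<alpha> \<beta>) * mpower J (crd' y) \<beta>)"
  by (rule null_family_le[OF null_family_coeff])
     (auto intro: vabs_mult_le_left snd.vabs_mpower_crd_le_1[OF assms])

lemma fst_coeff_has_sum:
  assumes "\<alpha> \<in> multi_indices I" "y \<in> Y"
  shows "((\<lambda>\<beta>. c (case_sum \<alpha> \<beta>) * mpower J (crd' y) \<beta>) has_sum fst_coeff \<alpha> y) (multi_indices J)"
  unfolding fst_coeff_def
  using null_family_has_sum[OF null_family_fiber[OF null_family_coeff_snd[OF assms(2)] assms(1)]]
  by simp

lemma tate_expansion_fst_coeff:
  assumes "\<alpha> \<in> multi_indices I"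
  shows "tate_expansion J Y crd' (fst_coeff \<alpha>) (\<lambda>\<beta>. c (case_sum \<alpha> \<beta>))"
proof (rule tate_expansionI)
  show "null_family (multi_indices J) (\<lambda>\<beta>. c (case_sum \<alpha> \<beta>))"
    using null_family_fiber[OF null_family_coeff assms] by simp
qed (simp_all add: coeff_outside fst_coeff_has_sum assms)

lemma tate_expansion_fst:
  assumes y: "y \<in> Y"
  shows "tate_expansion I X crd (\<lambda>x. F (x, y)) (\<lambda>\<alpha>. fst_coeff \<alpha> y)"
proof (rule tate_expansionI)
  show "null_family (multi_indices I) (\<lambda>\<alpha>. fst_coeff \<alpha> y)"
    unfolding fst_coeff_def using null_family_infsum[OF null_family_coeff_snd[OF y]] by simp
  show "fst_coeff \<alpha> y = 0" if "\<alpha> \<notin> multi_indices I" for \<alpha>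
    unfolding fst_coeff_def using that by (intro infsum_0) (simp add: coeff_outside)
  fix x assume x: "x \<in> X"
  have "((\<lambda>\<gamma>. c \<gamma> * mpower (I <+> J) (Plus_crd crd crd' (x, y)) \<gamma>) has_sum F (x, y))
      (multi_indices (I <+> J))"
    using x y by (intro tate_expansion_has_sum[OF expansion]) auto
  then have "((\<lambda>(\<alpha>, \<beta>). c (case_sum \<alpha> \<beta>) * mpower J (crd' y) \<beta> * mpower I (crd x) \<alpha>)
      has_sum F (x, y)) (multi_indices I \<times> multi_indices J)"
    unfolding has_sum_reindex_bij_betw[OF bij_betw_case_sum_multi_indices, symmetric]
    by (rule has_sum_cong[THEN iffD1, rotated])
       (auto simp: mpower_Plus[OF fst.finite_I snd.finite_I] mult_ac)
  then show "((\<lambda>\<alpha>. fst_coeff \<alpha> y * mpower I (crd x) \<alpha>) has_sum F (x, y)) (multi_indices I)"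
    by (rule has_sum_SigmaD) (simp add: has_sum_cmult_left[OF fst_coeff_has_sum[OF _ y]])
qed

end

section \<open>Inverses and LU decompositions of matrices over a field\<close>

lemma mat_mult_index:
  assumes "M \<in> carrier_mat n n" "N \<in> carrier_mat n n" "i < n" "j < n"
  shows "(M * N) $$ (i,j) = (\<Sum>k<n. M $$ (i,k) * N $$ (k,j))"
  using assms by (auto simp: scalar_prod_def atLeast0LessThan intro!: sum.cong)

lemma permutes_less: "\<sigma> permutes {..<n} \<Longrightarrow> k < n \<Longrightarrow> \<sigma> k < (n::nat)"
  using permutes_in_image[of \<sigma> "{..<n}" k] by simp

lemma permutes_ex_less: "\<sigma> permutes {..<n} \<Longrightarrow> a < n \<Longrightarrow> \<exists>k<(n::nat). a = \<sigma> k"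
  using permutes_image[of \<sigma> "{..<n}"] by (metis image_iff lessThan_iff)

lemma minv_eqI:
  fixes M N :: "'k::nonarch_field mat"
  assumes M: "M \<in> carrier_mat n n" and N: "N \<in> carrier_mat n n" and MN: "M * N = 1\<^sub>m n"
  shows "minv M = N"
proof -
  have "N * M = 1\<^sub>m n" by (rule mat_mult_left_right_inverse[OF M N MN])
  then have "M \<in> Units (ring_mat TYPE('k) n ())"
    unfolding Units_def using assms by (auto simp: ring_mat_simps)
  then obtain B where B: "mat_inverse M = Some B"
    using mat_inverse(1)[OF M, of "()"] by (cases "mat_inverse M") auto
  have BM: "B * M = 1\<^sub>m n" "B \<in> carrier_mat n n" using mat_inverse(2)[OF M B] by auto
  have "B = B * (M * N)" using BM by (simp add: MN)
  also have "\<dots> = (B * M) * N" using BM(2) M N by simp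
  also have "\<dots> = N" using BM(1) N by simp
  finally show ?thesis using B by simp
qed

lemma
  fixes M :: "'k::nonarch_field mat"
  assumes M: "M \<in> carrier_mat n n" and det: "det M \<noteq> 0"
  shows minv_carrier: "minv M \<in> carrier_mat n n"
    and mat_mult_minv: "M * minv M = 1\<^sub>m n"
    and minv_mat_mult: "minv M * M = 1\<^sub>m n"
    and minv_index: "\<And>i j. i < n \<Longrightarrow> j < n \<Longrightarrow> minv M $$ (i,j) = cofactor M j i / det M"
proof -
  define N where "N = (1 / det M) \<cdot>\<^sub>m adj_mat M"
  have N: "N \<in> carrier_mat n n" using adj_mat(1)[OF M] by (simp add: N_def)
  have "(1 / det M) \<cdot>\<^sub>m (det M \<cdot>\<^sub>m 1\<^sub>m n) = 1\<^sub>m n" using det by (intro eq_matI) auto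
  then have MN: "M * N = 1\<^sub>m n"
    unfolding N_def using adj_mat[OF M] M by (simp add: mult_smult_distrib)
  have minv: "minv M = N" by (rule minv_eqI[OF M N MN])
  show "minv M \<in> carrier_mat n n" "M * minv M = 1\<^sub>m n" "minv M * M = 1\<^sub>m n"
    unfolding minv using N MN mat_mult_left_right_inverse[OF M N MN] by auto
  show "minv M $$ (i,j) = cofactor M j i / det M" if "i < n" "j < n" for i j
    unfolding minv N_def adj_mat_def using that M by simp
qed

lemma mult_upper_triangular_index:
  fixes S T :: "'a::semiring_0 mat"
  assumes S: "S \<in> carrier_mat n n" and T: "T \<in> carrier_mat n n" "upper_triangular T"
    and ij: "i < n" "j < n" and zero: "\<And>k. k < j \<Longrightarrow> S $$ (i,k) = 0"
  shows "(S * T) $$ (i,j) = S $$ (i,j) * T $$ (j,j)"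
proof -
  have "S $$ (i,k) * T $$ (k,j) = 0" if "k \<in> {..<n} - {j}" for k
    using that zero T upper_triangularD[of T j k] by (cases "k < j") auto
  then have "(\<Sum>k<n. S $$ (i,k) * T $$ (k,j)) = (\<Sum>k\<in>{j}. S $$ (i,k) * T $$ (k,j))"
    using ij by (intro sum.mono_neutral_right) auto
  then show ?thesis using mat_mult_index[OF S T(1) ij] by simp
qed

context
  fixes n :: nat and S T :: "'k::field mat"
  assumes S: "S \<in> carrier_mat n n" and T: "T \<in> carrier_mat n n" "upper_triangular T"
    and ST: "S * T = 1\<^sub>m n"
begin

lemma left_inverse_upper_triangular: "j < i \<Longrightarrow> i < n \<Longrightarrow> S $$ (i,j) = 0"
proof (induction j rule: less_induct)
  case (less j)
  have "det S * det T = 1" using det_mult[OF S T(1)] ST by simp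
  then have "T $$ (j,j) \<noteq> 0"
    using upper_triangular_imp_det_eq_0_iff[OF T] less.prems T(1) by (auto simp: diag_mat_def)
  moreover have "S $$ (i,j) * T $$ (j,j) = (S * T) $$ (i,j)"
    by (rule mult_upper_triangular_index[OF S T, symmetric]) (use less in auto)
  ultimately show ?case using less.prems by (simp add: ST)
qed

lemma left_inverse_upper_triangular_diag:
  assumes "i < n"
  shows "S $$ (i,i) = 1 / T $$ (i,i)"
proof -
  have "S $$ (i,i) * T $$ (i,i) = (S * T) $$ (i,i)"
    by (rule mult_upper_triangular_index[OF S T, symmetric])
       (use assms left_inverse_upper_triangular in auto)
  then have "S $$ (i,i) * T $$ (i,i) = 1" using assms by (simp add: ST)
  then show ?thesis by (metis mult_zero_right nonzero_eq_divide_eq zero_neq_one)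
qed

end

text \<open>\<open>schur \<sigma> M k\<close> is the matrix \<open>M\<close> after elimination with the pivots
  \<open>(\<sigma> 0, \<sigma> 0), \<dots>, (\<sigma> (k - 1), \<sigma> (k - 1))\<close>, whose rows and columns are then zero.\<close>

primrec schur :: "(nat \<Rightarrow> nat) \<Rightarrow> 'k::field mat \<Rightarrow> nat \<Rightarrow> nat \<Rightarrow> nat \<Rightarrow> 'k" where
  "schur \<sigma> M 0 = (\<lambda>a b. M $$ (a,b))"
| "schur \<sigma> M (Suc k) = (\<lambda>a b. schur \<sigma> M k a b -
     schur \<sigma> M k a (\<sigma> k) * schur \<sigma> M k (\<sigma> k) b / schur \<sigma> M k (\<sigma> k) (\<sigma> k))"

lemma schur_eliminated:
  assumes "\<And>j. j < k \<Longrightarrow> schur \<sigma> M j (\<sigma> j) (\<sigma> j) \<noteq> 0" "j < k"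
  shows "schur \<sigma> M k a (\<sigma> j) = 0 \<and> schur \<sigma> M k (\<sigma> j) b = 0"
  using assms
proof (induction k arbitrary: a b)
  case (Suc k)
  show ?case
  proof (cases "j = k")
    case True
    then show ?thesis using Suc.prems(1)[of k] by simp
  next
    case False
    then have "j < k" using Suc.prems by simp
    then show ?thesis using Suc.IH Suc.prems by auto
  qed
qed auto

lemma schur_telescope:
  "M $$ (a,b) = schur \<sigma> M n a b +
    (\<Sum>k<n. schur \<sigma> M k a (\<sigma> k) * schur \<sigma> M k (\<sigma> k) b / schur \<sigma> M k (\<sigma> k) (\<sigma> k))"
  by (induction n) auto

definition lu_lower :: "(nat \<Rightarrow> nat) \<Rightarrow> nat \<Rightarrow> 'k::field mat \<Rightarrow> 'k mat" where
  "lu_lower \<sigma> n M = mat n n (\<lambda>(a,c).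
     schur \<sigma> M (inv_into UNIV \<sigma> c) a c / schur \<sigma> M (inv_into UNIV \<sigma> c) c c)"

definition lu_upper :: "(nat \<Rightarrow> nat) \<Rightarrow> nat \<Rightarrow> 'k::field mat \<Rightarrow> 'k mat" where
  "lu_upper \<sigma> n M = mat n n (\<lambda>(c,b). schur \<sigma> M (inv_into UNIV \<sigma> c) c b)"

lemma lu_carrier [simp]:
  "lu_lower \<sigma> n M \<in> carrier_mat n n" "lu_upper \<sigma> n M \<in> carrier_mat n n"
  by (auto simp: lu_lower_def lu_upper_def)

lemma
  assumes \<sigma>: "\<sigma> permutes {..<n}" and "k < n" "a < n"
  shows lu_lower_index:
      "lu_lower \<sigma> n M $$ (a, \<sigma> k) = schur \<sigma> M k a (\<sigma> k) / schur \<sigma> M k (\<sigma> k) (\<sigma> k)"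
    and lu_upper_index: "lu_upper \<sigma> n M $$ (\<sigma> k, a) = schur \<sigma> M k (\<sigma> k) a"
  using assms permutes_less[OF \<sigma>] permutes_inverses(2)[OF \<sigma>]
  by (simp_all add: lu_lower_def lu_upper_def)

lemma
  assumes M: "M \<in> carrier_mat n n" and \<sigma>: "\<sigma> permutes {..<n}"
    and pivots: "\<And>k. k < n \<Longrightarrow> schur \<sigma> M k (\<sigma> k) (\<sigma> k) \<noteq> 0"
  shows lu_decomposition: "M = lu_lower \<sigma> n M * lu_upper \<sigma> n M"
    and lu_lower_diag: "i < n \<Longrightarrow> lu_lower \<sigma> n M $$ (\<sigma> i, \<sigma> i) = 1"
    and lu_lower_eq_0: "i < j \<Longrightarrow> j < n \<Longrightarrow> lu_lower \<sigma> n M $$ (\<sigma> i, \<sigma> j) = 0"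
    and lu_upper_eq_0: "j < i \<Longrightarrow> i < n \<Longrightarrow> lu_upper \<sigma> n M $$ (\<sigma> i, \<sigma> j) = 0"
proof -
  note less = permutes_less[OF \<sigma>] and index = lu_lower_index[OF \<sigma>] lu_upper_index[OF \<sigma>]
  have eliminated: "schur \<sigma> M k a (\<sigma> j) = 0" "schur \<sigma> M k (\<sigma> j) b = 0"
    if "j < k" "k \<le> n" for j k a b
    using schur_eliminated[of k \<sigma> M j a b] pivots that by auto
  show "lu_lower \<sigma> n M $$ (\<sigma> i, \<sigma> i) = 1" if "i < n" using that less pivots by (simp add: index)
  show "lu_lower \<sigma> n M $$ (\<sigma> i, \<sigma> j) = 0" if "i < j" "j < n"
    using that less eliminated by (simp add: index)
  show "lu_upper \<sigma> n M $$ (\<sigma> i, \<sigma> j) = 0" if "j < i" "i < n"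
    using that less eliminated by (simp add: index)
  show "M = lu_lower \<sigma> n M * lu_upper \<sigma> n M"
  proof (rule eq_matI)
    fix a b assume "a < dim_row (lu_lower \<sigma> n M * lu_upper \<sigma> n M)"
      "b < dim_col (lu_lower \<sigma> n M * lu_upper \<sigma> n M)"
    then have ab: "a < n" "b < n" by (auto simp: lu_lower_def lu_upper_def)
    obtain i where "i < n" "a = \<sigma> i" using permutes_ex_less[OF \<sigma> ab(1)] by blast
    then have "schur \<sigma> M n a b = 0" using eliminated(2) by simp
    then have "M $$ (a,b) =
        (\<Sum>k<n. schur \<sigma> M k a (\<sigma> k) * schur \<sigma> M k (\<sigma> k) b / schur \<sigma> M k (\<sigma> k) (\<sigma> k))"
      using schur_telescope[of M a b \<sigma> n] by simp
    also have "\<dots> = (\<Sum>k<n. lu_lower \<sigma> n M $$ (a, \<sigma> k) * lu_upper \<sigma> n M $$ (\<sigma> k, b))"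
      using ab by (intro sum.cong) (auto simp: index)
    also have "\<dots> = (\<Sum>c<n. lu_lower \<sigma> n M $$ (a, c) * lu_upper \<sigma> n M $$ (c, b))"
      by (rule sum.permute[OF \<sigma>, symmetric, unfolded o_def])
    also have "\<dots> = (lu_lower \<sigma> n M * lu_upper \<sigma> n M) $$ (a,b)"
      using ab by (intro mat_mult_index[symmetric]) auto
    finally show "M $$ (a,b) = (lu_lower \<sigma> n M * lu_upper \<sigma> n M) $$ (a,b)" .
  qed (use M in \<open>auto simp: lu_lower_def lu_upper_def\<close>)
qed

section \<open>Pro-p matrices over algebras of functions\<close>

locale zp_algebra = padic_field p ty
  for p :: nat and ty :: "'k::nonarch_field itself" +
  fixes X :: "'x set" and A :: "('x \<Rightarrow> 'k) set"
  assumes A_Zp: "\<And>r x. r \<in> A \<Longrightarrow> x \<in> X \<Longrightarrow> r x \<in> Zp"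
    and A_const: "\<And>c. c \<in> Zp \<Longrightarrow> (\<lambda>_. c) \<in> A"
    and A_add: "\<And>r s. r \<in> A \<Longrightarrow> s \<in> A \<Longrightarrow> (\<lambda>x. r x + s x) \<in> A"
    and A_mult: "\<And>r s. r \<in> A \<Longrightarrow> s \<in> A \<Longrightarrow> (\<lambda>x. r x * s x) \<in> A"
    and A_inverse: "\<And>r. r \<in> A \<Longrightarrow> (\<lambda>x. 1 / (1 + of_nat p * r x)) \<in> A"
    and A_cong: "\<And>r s. r \<in> A \<Longrightarrow> (\<And>x. x \<in> X \<Longrightarrow> r x = s x) \<Longrightarrow> s \<in> A"
begin

lemma A_uminus: "r \<in> A \<Longrightarrow> (\<lambda>x. - r x) \<in> A"
  using A_mult[OF A_const[of "-1"], of r] Zp_uminus[OF Zp_1] by simp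

lemma A_diff: "r \<in> A \<Longrightarrow> s \<in> A \<Longrightarrow> (\<lambda>x. r x - s x) \<in> A"
  using A_add[OF _ A_uminus, of r s] by simp

lemma A_sum: "(\<And>i. i \<in> S \<Longrightarrow> r i \<in> A) \<Longrightarrow> (\<lambda>x. \<Sum>i\<in>S. r i x) \<in> A"
  by (induction S rule: infinite_finite_induct) (auto intro: A_add A_const)

lemma A_prod: "(\<And>i. i \<in> S \<Longrightarrow> r i \<in> A) \<Longrightarrow> (\<lambda>x. \<Prod>i\<in>S. r i x) \<in> A"
  by (induction S rule: infinite_finite_induct) (auto intro: A_mult A_const)

definition pA :: "('x \<Rightarrow> 'k) set" where
  "pA = {r. (\<lambda>x. r x / of_nat p) \<in> A}"

lemma pA_cong: "r \<in> pA \<Longrightarrow> (\<And>x. x \<in> X \<Longrightarrow> r x = s x) \<Longrightarrow> s \<in> pA"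
  unfolding pA_def using A_cong[of "\<lambda>x. r x / of_nat p" "\<lambda>x. s x / of_nat p"] by auto

lemma pA_0: "(\<lambda>_. 0) \<in> pA"
  unfolding pA_def by (simp add: A_const)

lemma pA_add: "r \<in> pA \<Longrightarrow> s \<in> pA \<Longrightarrow> (\<lambda>x. r x + s x) \<in> pA"
  unfolding pA_def using A_add[of "\<lambda>x. r x / of_nat p" "\<lambda>x. s x / of_nat p"]
  by (simp add: add_divide_distrib)

lemma pA_uminus: "r \<in> pA \<Longrightarrow> (\<lambda>x. - r x) \<in> pA"
  unfolding pA_def using A_uminus[of "\<lambda>x. r x / of_nat p"] by simp

lemma pA_diff: "r \<in> pA \<Longrightarrow> s \<in> pA \<Longrightarrow> (\<lambda>x. r x - s x) \<in> pA"
  using pA_add[OF _ pA_uminus, of r s] by simp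

lemma pA_mult_left: "r \<in> A \<Longrightarrow> s \<in> pA \<Longrightarrow> (\<lambda>x. r x * s x) \<in> pA"
  unfolding pA_def using A_mult[of r "\<lambda>x. s x / of_nat p"] by simp

lemma pA_mult_right: "r \<in> pA \<Longrightarrow> s \<in> A \<Longrightarrow> (\<lambda>x. r x * s x) \<in> pA"
  using pA_mult_left[of s r] by (simp add: mult.commute)

lemma pA_sum: "(\<And>i. i \<in> S \<Longrightarrow> r i \<in> pA) \<Longrightarrow> (\<lambda>x. \<Sum>i\<in>S. r i x) \<in> pA"
  by (induction S rule: infinite_finite_induct) (auto intro: pA_add pA_0)

lemma pA_p_mult: "r \<in> A \<Longrightarrow> (\<lambda>x. of_nat p * r x) \<in> pA"
  unfolding pA_def by simp

lemma pA_imp_A: "r \<in> pA \<Longrightarrow> r \<in> A"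
  unfolding pA_def using A_mult[OF A_const[of "of_nat p"], of "\<lambda>x. r x / of_nat p"] by simp

lemma pA_pZp: "r \<in> pA \<Longrightarrow> x \<in> X \<Longrightarrow> r x \<in> pZp p"
  unfolding pA_def pZp_iff using A_Zp by auto

lemma one_plus_pA_vabs:
  assumes "(\<lambda>x. d x - 1) \<in> pA" "x \<in> X" shows "vabs (d x) = 1"
proof -
  have "vabs ((d x - 1) / of_nat p) \<le> 1" using assms A_Zp vabs_Zp by (auto simp: pA_def)
  from vabs_p_mult_less_1[OF this] have "vabs (d x - 1) < vabs (1::'k)" by simp
  then show ?thesis using vabs_eq_if_close by fastforce
qed

lemma one_plus_pA_nonzero: "(\<lambda>x. d x - 1) \<in> pA \<Longrightarrow> x \<in> X \<Longrightarrow> d x \<noteq> 0"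
  using one_plus_pA_vabs by fastforce

lemma A_one_plus_pA: "(\<lambda>x. d x - 1) \<in> pA \<Longrightarrow> d \<in> A"
  using A_add[OF pA_imp_A A_const[of 1], of "\<lambda>x. d x - 1"] by simp

lemma A_inverse_one_plus_pA: "(\<lambda>x. d x - 1) \<in> pA \<Longrightarrow> (\<lambda>x. 1 / d x) \<in> A"
  using A_inverse[of "\<lambda>x. (d x - 1) / of_nat p"] by (simp add: pA_def)

lemma A_divide: "r \<in> A \<Longrightarrow> (\<lambda>x. d x - 1) \<in> pA \<Longrightarrow> (\<lambda>x. r x / d x) \<in> A"
  using A_mult[OF _ A_inverse_one_plus_pA, of r d] by simp

lemma pA_divide: "r \<in> pA \<Longrightarrow> (\<lambda>x. d x - 1) \<in> pA \<Longrightarrow> (\<lambda>x. r x / d x) \<in> pA"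
  using pA_mult_right[OF _ A_inverse_one_plus_pA, of r d] by simp

lemma one_plus_pA_inverse:
  assumes "(\<lambda>x. d x - 1) \<in> pA" shows "(\<lambda>x. 1 / d x - 1) \<in> pA"
  by (rule pA_cong[OF pA_divide[OF pA_uminus[OF assms] assms]])
     (simp add: one_plus_pA_nonzero[OF assms] field_simps)

lemma one_plus_pA_mult:
  assumes "(\<lambda>x. d x - 1) \<in> pA" "(\<lambda>x. e x - 1) \<in> pA"
  shows "(\<lambda>x. d x * e x - 1) \<in> pA"
  using pA_add[OF pA_mult_right[OF assms(1) A_one_plus_pA[OF assms(2)]] assms(2)]
  by (simp add: left_diff_distrib)

lemma one_plus_pA_prod:
  "(\<And>i. i \<in> S \<Longrightarrow> (\<lambda>x. d i x - 1) \<in> pA) \<Longrightarrow> (\<lambda>x. (\<Prod>i\<in>S. d i x) - 1) \<in> pA"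
  by (induction S rule: infinite_finite_induct) (auto intro: pA_0 one_plus_pA_mult)

lemma A_det:
  assumes "\<And>x. x \<in> X \<Longrightarrow> M x \<in> carrier_mat m m"
    and "\<And>i j. i < m \<Longrightarrow> j < m \<Longrightarrow> (\<lambda>x. M x $$ (i,j)) \<in> A"
  shows "(\<lambda>x. det (M x)) \<in> A"
proof (rule A_cong)
  show "(\<lambda>x. \<Sum>\<pi> | \<pi> permutes {0..<m}. signof \<pi> * (\<Prod>i = 0..<m. M x $$ (i, \<pi> i))) \<in> A"
  proof (intro A_sum A_mult A_prod A_const signof_Zp)
    fix \<pi> i assume "\<pi> \<in> {\<pi>. \<pi> permutes {0..<m}}" "i \<in> {0..<m}"
    then show "(\<lambda>x. M x $$ (i, \<pi> i)) \<in> A"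
      using permutes_in_image[of \<pi> "{0..<m}" i] assms(2) by auto
  qed
qed (simp add: det_def'[OF assms(1)])

lemma A_cofactor:
  assumes carrier: "\<And>x. x \<in> X \<Longrightarrow> M x \<in> carrier_mat n n"
    and entries: "\<And>i j. i < n \<Longrightarrow> j < n \<Longrightarrow> (\<lambda>x. M x $$ (i,j)) \<in> A"
    and ij: "i < n" "j < n"
  shows "(\<lambda>x. cofactor (M x) i j) \<in> A"
  unfolding cofactor_def
proof (intro A_mult A_const Zp_power Zp_uminus Zp_1 A_det)
  show "mat_delete (M x) i j \<in> carrier_mat (n - 1) (n - 1)" if "x \<in> X" for x
    using carrier[OF that] by (rule mat_delete_carrier)
  fix a b assume ab: "a < n - 1" "b < n - 1"
  show "(\<lambda>x. mat_delete (M x) i j $$ (a,b)) \<in> A"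
  proof (rule A_cong)
    show "(\<lambda>x. M x $$ (if a < i then a else Suc a, if b < j then b else Suc b)) \<in> A"
      using ab by (intro entries) auto
    fix x assume "x \<in> X"
    then show "M x $$ (if a < i then a else Suc a, if b < j then b else Suc b)
        = mat_delete (M x) i j $$ (a,b)"
      using ab carrier_matD[OF carrier] by (simp add: mat_delete_def)
  qed
qed

text \<open>Any permutation other than the identity moves some index up, to an entry above the diagonal.\<close>

lemma pA_det_minus_prod_diag:
  assumes carrier: "\<And>x. x \<in> X \<Longrightarrow> g x \<in> carrier_mat n n"
    and entries: "\<And>i j. i < n \<Longrightarrow> j < n \<Longrightarrow> (\<lambda>x. g x $$ (i,j)) \<in> A"
    and upper: "\<And>i j. i < j \<Longrightarrow> j < n \<Longrightarrow> (\<lambda>x. g x $$ (i,j)) \<in> pA"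
  shows "(\<lambda>x. det (g x) - (\<Prod>i = 0..<n. g x $$ (i,i))) \<in> pA"
proof (rule pA_cong)
  let ?P = "{\<pi>. \<pi> permutes {0..<n}}"
  let ?t = "\<lambda>\<pi> x. signof \<pi> * (\<Prod>i = 0..<n. g x $$ (i, \<pi> i))"
  have "?t \<pi> \<in> pA" if \<pi>: "\<pi> \<in> ?P - {id}" for \<pi>
  proof -
    obtain i where i: "i \<in> {0..<n}" "i < \<pi> i"
      using permutes_natset_le[of \<pi> "{0..<n}"] \<pi> by (metis DiffE mem_Collect_eq not_le singletonI)
    have "\<pi> j < n" if "j < n" for j using permutes_in_image[of \<pi> "{0..<n}" j] \<pi> that by auto
    then have "(\<lambda>x. signof \<pi> * (g x $$ (i, \<pi> i) * (\<Prod>j\<in>{0..<n} - {i}. g x $$ (j, \<pi> j)))) \<in> pA"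
      using i by (intro pA_mult_left pA_mult_right A_prod A_const signof_Zp entries upper) auto
    then show ?thesis using i by (simp add: prod.remove[of "{0..<n}" i])
  qed
  then show "(\<lambda>x. \<Sum>\<pi>\<in>?P - {id}. ?t \<pi> x) \<in> pA" by (rule pA_sum)
  fix x assume x: "x \<in> X"
  have "det (g x) = ?t id x + (\<Sum>\<pi>\<in>?P - {id}. ?t \<pi> x)"
    unfolding det_def'[OF carrier[OF x]]
    by (rule sum.remove) (auto simp: finite_permutations permutes_id)
  then show "(\<Sum>\<pi>\<in>?P - {id}. ?t \<pi> x) = det (g x) - (\<Prod>i = 0..<n. g x $$ (i,i))"
    by (simp add: sign_id)
qed

definition pro_p_outside :: "nat \<Rightarrow> nat set \<Rightarrow> (nat \<Rightarrow> nat \<Rightarrow> 'x \<Rightarrow> 'k) \<Rightarrow> bool" where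
  "pro_p_outside n S m \<longleftrightarrow> (\<forall>a<n. \<forall>b<n. m a b \<in> A) \<and> (\<forall>a b. a < b \<and> b < n \<longrightarrow> m a b \<in> pA) \<and>
     (\<forall>a<n. a \<notin> S \<longrightarrow> (\<lambda>x. m a a x - 1) \<in> pA)"

lemma pro_p_outsideD:
  assumes "pro_p_outside n S m"
  shows "a < n \<Longrightarrow> b < n \<Longrightarrow> m a b \<in> A" "a < b \<Longrightarrow> b < n \<Longrightarrow> m a b \<in> pA"
    "a < n \<Longrightarrow> a \<notin> S \<Longrightarrow> (\<lambda>x. m a a x - 1) \<in> pA"
  using assms by (auto simp: pro_p_outside_def)

lemma pro_p_outside_eliminate:
  assumes m: "pro_p_outside n S m" and c: "c < n" "c \<notin> S"
  shows "pro_p_outside n (insert c S) (\<lambda>a b x. m a b x - m a c x * m c b x / m c c x)"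
proof -
  note mD = pro_p_outsideD[OF m]
  note pivot = mD(3)[OF c]
  have correction: "(\<lambda>x. m a c x * m c b x / m c c x) \<in> pA"
    if "a < n" "b < n" "a < c \<or> c < b" for a b
    using that c mD(1,2) by (auto intro!: pA_divide[OF _ pivot] intro: pA_mult_left pA_mult_right)
  have "(\<lambda>x. m a a x - m a c x * m c a x / m c c x - 1) \<in> pA" if "a < n" "a \<notin> insert c S" for a
  proof -
    have "(\<lambda>x. (m a a x - 1) - m a c x * m c a x / m c c x) \<in> pA"
      using that by (intro pA_diff mD(3) correction) auto
    then show ?thesis by (simp add: algebra_simps)
  qed
  moreover have "(\<lambda>x. m a b x - m a c x * m c b x / m c c x) \<in> pA" if "a < b" "b < n" for a b
    using that by (intro pA_diff mD(2) correction) auto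
  moreover have "(\<lambda>x. m a b x - m a c x * m c b x / m c c x) \<in> A" if "a < n" "b < n" for a b
    using that c by (intro A_diff A_divide[OF _ pivot] A_mult mD(1))
  ultimately show ?thesis by (auto simp: pro_p_outside_def)
qed

definition pro_p_family :: "nat \<Rightarrow> ('x \<Rightarrow> 'k mat) \<Rightarrow> bool" where
  "pro_p_family n g \<longleftrightarrow> (\<forall>x\<in>X. g x \<in> carrier_mat n n) \<and> pro_p_outside n {} (\<lambda>i j x. g x $$ (i,j))"

lemma pro_p_familyI:
  assumes "\<And>x. x \<in> X \<Longrightarrow> g x \<in> carrier_mat n n"
    and "\<And>i j. j < i \<Longrightarrow> i < n \<Longrightarrow> (\<lambda>x. g x $$ (i,j)) \<in> A"
    and "\<And>i j. i < j \<Longrightarrow> j < n \<Longrightarrow> (\<lambda>x. g x $$ (i,j)) \<in> pA"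
    and "\<And>i. i < n \<Longrightarrow> (\<lambda>x. g x $$ (i,i) - 1) \<in> pA"
  shows "pro_p_family n g"
proof -
  have "(\<lambda>x. g x $$ (i,j)) \<in> A" if "i < n" "j < n" for i j
    using assms that pA_imp_A A_one_plus_pA by (cases i j rule: linorder_cases) auto
  then show ?thesis unfolding pro_p_family_def pro_p_outside_def using assms by auto
qed

lemma pro_p_familyD:
  assumes "pro_p_family n g"
  shows pro_p_family_carrier: "x \<in> X \<Longrightarrow> g x \<in> carrier_mat n n"
    and pro_p_family_entry: "i < n \<Longrightarrow> j < n \<Longrightarrow> (\<lambda>x. g x $$ (i,j)) \<in> A"
    and pro_p_family_upper: "i < j \<Longrightarrow> j < n \<Longrightarrow> (\<lambda>x. g x $$ (i,j)) \<in> pA"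
    and pro_p_family_diag: "i < n \<Longrightarrow> (\<lambda>x. g x $$ (i,i) - 1) \<in> pA"
  using assms unfolding pro_p_family_def pro_p_outside_def by auto

lemma pro_p_family_one: "pro_p_family n (\<lambda>_. 1\<^sub>m n)"
  by (rule pro_p_familyI) (auto simp: A_const pA_0)

lemma pro_p_family_mult:
  assumes g: "pro_p_family n g" and h: "pro_p_family n h"
  shows "pro_p_family n (\<lambda>x. g x * h x)"
proof (rule pro_p_familyI)
  note gD = pro_p_familyD[OF g] and hD = pro_p_familyD[OF h]
  have index: "(\<Sum>k<n. g x $$ (i,k) * h x $$ (k,j)) = (g x * h x) $$ (i,j)"
    if "x \<in> X" "i < n" "j < n" for x i j
    using that by (intro mat_mult_index[symmetric] gD(1) hD(1))
  show "g x * h x \<in> carrier_mat n n" if "x \<in> X" for x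
    using gD(1)[OF that] hD(1)[OF that] by simp
  show "(\<lambda>x. (g x * h x) $$ (i,j)) \<in> A" if ij: "j < i" "i < n" for i j
    by (rule A_cong[of "\<lambda>x. \<Sum>k<n. g x $$ (i,k) * h x $$ (k,j)"])
       (use ij in \<open>auto intro!: A_sum A_mult gD(2) hD(2) index\<close>)
  have off_diag: "(\<lambda>x. g x $$ (i,k) * h x $$ (k,j)) \<in> pA"
    if "i < n" "j < n" "k < n" "i < k \<or> k < j" for i j k
    using that gD hD by (auto intro: pA_mult_left pA_mult_right)
  show "(\<lambda>x. (g x * h x) $$ (i,j)) \<in> pA" if ij: "i < j" "j < n" for i j
    by (rule pA_cong[of "\<lambda>x. \<Sum>k<n. g x $$ (i,k) * h x $$ (k,j)"])
       (use ij in \<open>auto intro!: pA_sum off_diag index\<close>)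
  show "(\<lambda>x. (g x * h x) $$ (i,i) - 1) \<in> pA" if i: "i < n" for i
  proof (rule pA_cong)
    show "(\<lambda>x. (g x $$ (i,i) * h x $$ (i,i) - 1) +
        (\<Sum>k\<in>{..<n} - {i}. g x $$ (i,k) * h x $$ (k,i))) \<in> pA"
      using i by (intro pA_add pA_sum off_diag one_plus_pA_mult gD(4) hD(4)) auto
    fix x assume x: "x \<in> X"
    show "(g x $$ (i,i) * h x $$ (i,i) - 1) + (\<Sum>k\<in>{..<n} - {i}. g x $$ (i,k) * h x $$ (k,i))
        = (g x * h x) $$ (i,i) - 1"
      unfolding index[OF x i i, symmetric] using i by (simp add: sum.remove[of "{..<n}" i])
  qed
qed

context
  fixes n :: nat and g :: "'x \<Rightarrow> 'k mat"
  assumes g: "pro_p_family n g"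
begin

lemma pro_p_family_det: "(\<lambda>x. det (g x) - 1) \<in> pA"
proof -
  have "(\<lambda>x. (\<Prod>i = 0..<n. g x $$ (i,i)) - 1) \<in> pA"
    by (intro one_plus_pA_prod pro_p_family_diag[OF g]) auto
  from pA_add[OF pA_det_minus_prod_diag[OF pro_p_familyD(1-3)[OF g]] this] show ?thesis by simp
qed

lemma
  assumes x: "x \<in> X"
  shows pro_p_family_minv_carrier: "minv (g x) \<in> carrier_mat n n"
    and pro_p_family_mult_minv: "g x * minv (g x) = 1\<^sub>m n"
    and pro_p_family_minv_mult: "minv (g x) * g x = 1\<^sub>m n"
  using pro_p_family_carrier[OF g x] one_plus_pA_nonzero[OF pro_p_family_det x]
  by (simp_all add: minv_carrier mat_mult_minv minv_mat_mult)

lemma A_minv_entry: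
  assumes ij: "i < n" "j < n"
  shows "(\<lambda>x. minv (g x) $$ (i,j)) \<in> A"
proof (rule A_cong)
  show "(\<lambda>x. cofactor (g x) j i / det (g x)) \<in> A"
    using ij by (intro A_divide pro_p_family_det A_cofactor pro_p_family_entry[OF g])
      (auto intro: pro_p_family_carrier[OF g])
  show "cofactor (g x) j i / det (g x) = minv (g x) $$ (i,j)" if "x \<in> X" for x
    using that ij one_plus_pA_nonzero[OF pro_p_family_det that]
    by (simp add: minv_index[OF pro_p_family_carrier[OF g that]])
qed

lemma pA_minv_minus_one:
  assumes "i \<le> j" "j < n"
  shows "(\<lambda>x. minv (g x) $$ (i,j) - (if i = j then 1 else 0)) \<in> pA"
  using assms
proof (induction i arbitrary: j rule: less_induct)
  case (less i)
  have i: "i < n" using less.prems by simp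
  have off_diag: "(\<lambda>x. g x $$ (i,k) * minv (g x) $$ (k,j)) \<in> pA" if "k \<in> {..<n} - {i}" for k
  proof (cases "k < i")
    case True
    then have "(\<lambda>x. minv (g x) $$ (k,j)) \<in> pA" using less.IH[of k j] less.prems by simp
    then show ?thesis using that i by (intro pA_mult_left pro_p_family_entry[OF g]) auto
  next
    case False
    then show ?thesis
      using that less.prems by (intro pA_mult_right pro_p_family_upper[OF g] A_minv_entry) auto
  qed
  show ?case
  proof (rule pA_cong)
    show "(\<lambda>x. - ((g x $$ (i,i) - 1) * minv (g x) $$ (i,j))
            - (\<Sum>k\<in>{..<n} - {i}. g x $$ (i,k) * minv (g x) $$ (k,j))) \<in> pA"
      using i less.prems
      by (intro pA_diff pA_uminus pA_sum off_diag pA_mult_right pro_p_family_diag[OF g]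
          A_minv_entry)
    fix x assume x: "x \<in> X"
    have "(if i = j then 1 else 0) = (g x * minv (g x)) $$ (i,j)"
      using pro_p_family_mult_minv[OF x] i less.prems by simp
    also have "\<dots> = (\<Sum>k<n. g x $$ (i,k) * minv (g x) $$ (k,j))"
      using x i less.prems
      by (intro mat_mult_index pro_p_family_carrier[OF g] pro_p_family_minv_carrier)
    also have "\<dots> = g x $$ (i,i) * minv (g x) $$ (i,j)
        + (\<Sum>k\<in>{..<n} - {i}. g x $$ (i,k) * minv (g x) $$ (k,j))"
      using i by (simp add: sum.remove[of "{..<n}" i])
    finally have "g x $$ (i,i) * minv (g x) $$ (i,j)
        + (\<Sum>k\<in>{..<n} - {i}. g x $$ (i,k) * minv (g x) $$ (k,j)) = (if i = j then 1 else 0)" ..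
    then show "- ((g x $$ (i,i) - 1) * minv (g x) $$ (i,j))
            - (\<Sum>k\<in>{..<n} - {i}. g x $$ (i,k) * minv (g x) $$ (k,j))
        = minv (g x) $$ (i,j) - (if i = j then 1 else 0)"
      by (simp add: algebra_simps)
  qed
qed

lemma pro_p_family_minv: "pro_p_family n (\<lambda>x. minv (g x))"
proof (rule pro_p_familyI)
  show "(\<lambda>x. minv (g x) $$ (i,j)) \<in> pA" if "i < j" "j < n" for i j
    using pA_minv_minus_one[of i j] that by simp
  show "(\<lambda>x. minv (g x) $$ (i,i) - 1) \<in> pA" if "i < n" for i
    using pA_minv_minus_one[of i i] that by simp
qed (use pro_p_family_minv_carrier A_minv_entry in auto)

lemma pro_p_outside_schur:
  assumes \<sigma>: "\<sigma> permutes {..<n}" and "k \<le> n"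
  shows "pro_p_outside n (\<sigma> ` {..<k}) (\<lambda>a b x. schur \<sigma> (g x) k a b)"
  using assms(2)
proof (induction k)
  case 0
  then show ?case using g by (simp add: pro_p_family_def)
next
  case (Suc k)
  have "\<sigma> k < n" "\<sigma> k \<notin> \<sigma> ` {..<k}"
    using Suc.prems permutes_less[OF \<sigma>, of k] permutes_inj[OF \<sigma>] by (auto dest: injD)
  from pro_p_outside_eliminate[OF _ this] show ?case
    using Suc by (simp add: lessThan_Suc)
qed

lemma schur_pivot_one_plus_pA:
  assumes \<sigma>: "\<sigma> permutes {..<n}" and k: "k < n"
  shows "(\<lambda>x. schur \<sigma> (g x) k (\<sigma> k) (\<sigma> k) - 1) \<in> pA"
proof -
  have "\<sigma> k < n" "\<sigma> k \<notin> \<sigma> ` {..<k}"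
    using k permutes_less[OF \<sigma>, of k] permutes_inj[OF \<sigma>] by (auto dest: injD)
  then show ?thesis using pro_p_outsideD(3)[OF pro_p_outside_schur[OF \<sigma>, of k]] k by simp
qed

lemma pro_p_family_lu_lower:
  assumes \<sigma>: "\<sigma> permutes {..<n}"
  shows "pro_p_family n (\<lambda>x. lu_lower \<sigma> n (g x))"
proof (rule pro_p_familyI)
  note schurD = pro_p_outsideD[OF pro_p_outside_schur[OF \<sigma> less_imp_le]]
    and pivot = schur_pivot_one_plus_pA[OF \<sigma>]
  fix i j
  show "(\<lambda>x. lu_lower \<sigma> n (g x) $$ (i,j)) \<in> A" if ij: "j < i" "i < n"
  proof -
    obtain k where "k < n" "j = \<sigma> k" using permutes_ex_less[OF \<sigma> less_trans[OF ij]] by blast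
    then show ?thesis using ij by (simp add: lu_lower_index[OF \<sigma>] A_divide schurD(1) pivot)
  qed
  show "(\<lambda>x. lu_lower \<sigma> n (g x) $$ (i,j)) \<in> pA" if ij: "i < j" "j < n"
  proof -
    obtain k where "k < n" "j = \<sigma> k" using permutes_ex_less[OF \<sigma> ij(2)] by blast
    then show ?thesis using ij by (simp add: lu_lower_index[OF \<sigma>] pA_divide schurD(2) pivot)
  qed
  show "(\<lambda>x. lu_lower \<sigma> n (g x) $$ (i,i) - 1) \<in> pA" if i: "i < n"
  proof -
    obtain k where "k < n" "i = \<sigma> k" using permutes_ex_less[OF \<sigma> i] by blast
    then show ?thesis
      using i
      by (intro pA_cong[OF pA_0]) (simp add: lu_lower_index[OF \<sigma>] one_plus_pA_nonzero[OF pivot])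
  qed
qed simp

lemma pro_p_family_lu_upper:
  assumes \<sigma>: "\<sigma> permutes {..<n}"
  shows "pro_p_family n (\<lambda>x. lu_upper \<sigma> n (g x))"
proof (rule pro_p_familyI)
  note schurD = pro_p_outsideD[OF pro_p_outside_schur[OF \<sigma> less_imp_le]]
  fix i j
  show "(\<lambda>x. lu_upper \<sigma> n (g x) $$ (i,j)) \<in> A" if ij: "j < i" "i < n"
  proof -
    obtain k where "k < n" "i = \<sigma> k" using permutes_ex_less[OF \<sigma> ij(2)] by blast
    then show ?thesis using ij by (simp add: lu_upper_index[OF \<sigma>] schurD(1))
  qed
  show "(\<lambda>x. lu_upper \<sigma> n (g x) $$ (i,j)) \<in> pA" if ij: "i < j" "j < n"
  proof -
    obtain k where "k < n" "i = \<sigma> k" using permutes_ex_less[OF \<sigma> less_trans[OF ij]] by blast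
    then show ?thesis using ij by (simp add: lu_upper_index[OF \<sigma>] schurD(2))
  qed
  show "(\<lambda>x. lu_upper \<sigma> n (g x) $$ (i,i) - 1) \<in> pA" if i: "i < n"
  proof -
    obtain k where "k < n" "i = \<sigma> k" using permutes_ex_less[OF \<sigma> i] by blast
    then show ?thesis using i by (simp add: lu_upper_index[OF \<sigma>] schur_pivot_one_plus_pA[OF \<sigma>])
  qed
qed simp

lemma pro_p_family_imp_pro_p_Iwahori: "x \<in> X \<Longrightarrow> g x \<in> pro_p_Iwahori p n"
proof -
  assume x: "x \<in> X"
  have "g x \<in> Mat_Zp n" "minv (g x) \<in> Mat_Zp n"
    unfolding Mat_Zp_def
    using pro_p_family_carrier[OF g x] pro_p_family_minv_carrier[OF x]
      A_Zp[OF pro_p_family_entry[OF g] x] A_Zp[OF A_minv_entry x] by blast+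
  then have "g x \<in> GL_Zp n"
    unfolding GL_Zp_def using pro_p_family_mult_minv[OF x] pro_p_family_minv_mult[OF x] by blast
  then show ?thesis
    unfolding pro_p_Iwahori_def
    using pA_pZp[OF pro_p_family_diag[OF g] x] pA_pZp[OF pro_p_family_upper[OF g] x] by blast
qed

end

lemma pro_p_family_const: "h \<in> pro_p_Iwahori p n \<Longrightarrow> pro_p_family n (\<lambda>_. h)"
  unfolding pro_p_Iwahori_def GL_Zp_def Mat_Zp_def
  by (intro pro_p_familyI) (auto simp: pZp_iff pA_def intro!: A_const)

end

section \<open>Permutation matrices and Iwahori subgroups\<close>

definition perm_mat :: "nat \<Rightarrow> (nat \<Rightarrow> nat) \<Rightarrow> 'a::{zero,one} mat" where
  "perm_mat n \<sigma> = mat n n (\<lambda>(i,j). if i = \<sigma> j then 1 else 0)"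

lemma perm_mat_carrier [simp]: "perm_mat n \<sigma> \<in> carrier_mat n n"
  by (simp add: perm_mat_def)

lemma perm_matrices_eq: "perm_matrices n = {perm_mat n \<sigma> | \<sigma>. \<sigma> permutes {..<n}}"
  by (simp add: perm_matrices_def perm_mat_def)

context
  fixes n :: nat and \<sigma> :: "nat \<Rightarrow> nat"
  assumes \<sigma>: "\<sigma> permutes {..<n}"
begin

lemma mult_perm_mat_index:
  fixes M :: "'a::comm_semiring_1 mat"
  assumes "M \<in> carrier_mat n n" "i < n" "j < n"
  shows "(M * perm_mat n \<sigma>) $$ (i,j) = M $$ (i, \<sigma> j)"
proof -
  have "(M * perm_mat n \<sigma>) $$ (i,j) = (\<Sum>k<n. M $$ (i,k) * perm_mat n \<sigma> $$ (k,j))"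
    using assms by (intro mat_mult_index) auto
  also have "\<dots> = (\<Sum>k<n. if k = \<sigma> j then M $$ (i,k) else 0)"
    using assms by (intro sum.cong) (auto simp: perm_mat_def)
  finally show ?thesis using permutes_less[OF \<sigma> assms(3)] by simp
qed

lemma transpose_perm_mat_mult_index:
  fixes M :: "'a::comm_semiring_1 mat"
  assumes "M \<in> carrier_mat n n" "i < n" "j < n"
  shows "(transpose_mat (perm_mat n \<sigma>) * M) $$ (i,j) = M $$ (\<sigma> i, j)"
proof -
  have "(transpose_mat (perm_mat n \<sigma>) * M) $$ (i,j)
      = (\<Sum>k<n. transpose_mat (perm_mat n \<sigma>) $$ (i,k) * M $$ (k,j))"
    using assms by (intro mat_mult_index) auto
  also have "\<dots> = (\<Sum>k<n. if k = \<sigma> i then M $$ (k,j) else 0)"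
    using assms by (intro sum.cong) (auto simp: perm_mat_def)
  finally show ?thesis using permutes_less[OF \<sigma> assms(2)] by simp
qed

lemma transpose_mult_perm_mat:
  "transpose_mat (perm_mat n \<sigma>) * perm_mat n \<sigma> = (1\<^sub>m n :: 'a::comm_semiring_1 mat)"
proof (rule eq_matI)
  let ?w = "perm_mat n \<sigma> :: 'a mat"
  fix i j assume "i < dim_row (1\<^sub>m n :: 'a mat)" "j < dim_col (1\<^sub>m n :: 'a mat)"
  then have ij: "i < n" "j < n" by auto
  then have "(transpose_mat ?w * ?w) $$ (i,j) = ?w $$ (\<sigma> i, j)"
    by (intro transpose_perm_mat_mult_index) auto
  also have "\<dots> = 1\<^sub>m n $$ (i,j)"
    using ij permutes_less[OF \<sigma>] permutes_inj[OF \<sigma>] by (simp add: perm_mat_def inj_eq)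
  finally show "(transpose_mat ?w * ?w) $$ (i,j) = 1\<^sub>m n $$ (i,j)" .
qed (simp_all add: perm_mat_def)

lemma perm_mat_mult_transpose:
  "perm_mat n \<sigma> * transpose_mat (perm_mat n \<sigma>) = (1\<^sub>m n :: 'a::field mat)"
  by (rule mat_mult_left_right_inverse[OF _ _ transpose_mult_perm_mat]) auto

lemma minv_perm_mat: "minv (perm_mat n \<sigma> :: 'k::nonarch_field mat) = transpose_mat (perm_mat n \<sigma>)"
  by (rule minv_eqI[OF _ _ perm_mat_mult_transpose]) auto

lemma perm_conj_carrier:
  "(M :: 'k::nonarch_field mat) \<in> carrier_mat n n \<Longrightarrow>
    minv (perm_mat n \<sigma>) * M * perm_mat n \<sigma> \<in> carrier_mat n n"
  by (simp add: minv_perm_mat mult_carrier_mat[of _ n n _ n])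

lemma perm_conj_index:
  fixes M :: "'k::nonarch_field mat"
  assumes M: "M \<in> carrier_mat n n" and "i < n" "j < n"
  shows "(minv (perm_mat n \<sigma>) * M * perm_mat n \<sigma>) $$ (i,j) = M $$ (\<sigma> i, \<sigma> j)"
  unfolding minv_perm_mat
  using assms permutes_less[OF \<sigma>]
  by (simp add: mult_perm_mat_index transpose_perm_mat_mult_index mult_carrier_mat[of _ n n _ n]
      del: index_mult_mat(1))

lemma perm_conj_mult:
  fixes M N :: "'k::nonarch_field mat"
  assumes "M \<in> carrier_mat n n" "N \<in> carrier_mat n n"
  shows "(minv (perm_mat n \<sigma>) * M * perm_mat n \<sigma>) * (minv (perm_mat n \<sigma>) * N * perm_mat n \<sigma>)
    = minv (perm_mat n \<sigma>) * (M * N) * perm_mat n \<sigma>"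
proof -
  let ?w = "perm_mat n \<sigma> :: 'k mat" and ?w' = "transpose_mat (perm_mat n \<sigma>) :: 'k mat"
  have "(?w' * M * ?w) * (?w' * N * ?w) = ?w' * M * (?w * ?w') * N * ?w"
    using assms by (simp add: assoc_mult_mat[of _ n n _ n _ n] mult_carrier_mat[of _ n n _ n])
  then show ?thesis
    using assms by (simp add: minv_perm_mat perm_mat_mult_transpose assoc_mult_mat[of _ n n _ n _ n]
        mult_carrier_mat[of _ n n _ n])
qed

lemma conj_set_perm_mat_iff:
  fixes g :: "'k::nonarch_field mat"
  assumes "H \<subseteq> carrier_mat n n"
  shows "g \<in> conj_set (perm_mat n \<sigma>) H \<longleftrightarrow>
    g \<in> carrier_mat n n \<and> minv (perm_mat n \<sigma>) * g * perm_mat n \<sigma> \<in> H"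
proof -
  let ?w = "perm_mat n \<sigma> :: 'k mat" and ?w' = "transpose_mat (perm_mat n \<sigma>) :: 'k mat"
  have "?w' * (?w * M * ?w') * ?w = (?w' * ?w) * M * (?w' * ?w)"
    and "?w * (?w' * M * ?w) * ?w' = (?w * ?w') * M * (?w * ?w')" if "M \<in> carrier_mat n n" for M
    using that by (simp_all add: assoc_mult_mat[of _ n n _ n _ n] mult_carrier_mat[of _ n n _ n])
  then have cancel: "?w' * (?w * M * ?w') * ?w = M" "?w * (?w' * M * ?w) * ?w' = M"
    if "M \<in> carrier_mat n n" for M
    using that by (simp_all add: perm_mat_mult_transpose transpose_mult_perm_mat)
  show ?thesis
    unfolding conj_set_def minv_perm_mat
  proof (intro iffI conjI)
    assume "g \<in> (\<lambda>h. ?w * h * ?w') ` H"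
    then obtain h where h: "h \<in> H" "g = ?w * h * ?w'" by blast
    then show "g \<in> carrier_mat n n" "?w' * g * ?w \<in> H"
      using assms cancel(1)[of h] by (auto simp: mult_carrier_mat[of _ n n _ n])
  next
    assume "g \<in> carrier_mat n n \<and> ?w' * g * ?w \<in> H"
    then show "g \<in> (\<lambda>h. ?w * h * ?w') ` H" using cancel(2)[of g] by (metis imageI)
  qed
qed

end

lemma GL_Zp_carrier: "g \<in> GL_Zp n \<Longrightarrow> g \<in> carrier_mat n n"
  by (auto simp: GL_Zp_def Mat_Zp_def)

lemma GL_Zp_entry: "g \<in> GL_Zp n \<Longrightarrow> i < n \<Longrightarrow> j < n \<Longrightarrow> g $$ (i,j) \<in> Zp"
  by (auto simp: GL_Zp_def Mat_Zp_def)

lemma GL_Zp_minv: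
  assumes "g \<in> GL_Zp n"
  shows "minv g \<in> GL_Zp n" "g * minv g = 1\<^sub>m n" "minv g * g = 1\<^sub>m n"
proof -
  obtain g' where g': "g' \<in> Mat_Zp n" "g * g' = 1\<^sub>m n" "g' * g = 1\<^sub>m n" and g: "g \<in> Mat_Zp n"
    using assms by (auto simp: GL_Zp_def)
  then have "minv g = g'" by (intro minv_eqI) (auto simp: Mat_Zp_def)
  then show "minv g \<in> GL_Zp n" "g * minv g = 1\<^sub>m n" "minv g * g = 1\<^sub>m n"
    using g g' by (auto simp: GL_Zp_def)
qed

lemma Mat_Zp_mult: "g \<in> Mat_Zp n \<Longrightarrow> h \<in> Mat_Zp n \<Longrightarrow> g * h \<in> Mat_Zp n"
  unfolding Mat_Zp_def
  by (auto simp: mat_mult_index simp del: index_mult_mat(1) intro!: Zp_sum Zp_mult)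

lemma GL_Zp_mult:
  assumes "g \<in> GL_Zp n" "h \<in> GL_Zp n" shows "g * h \<in> GL_Zp n"
proof -
  obtain g' h' where inverses: "g' \<in> Mat_Zp n" "g * g' = 1\<^sub>m n" "g' * g = 1\<^sub>m n"
      "h' \<in> Mat_Zp n" "h * h' = 1\<^sub>m n" "h' * h = 1\<^sub>m n" and gh: "g \<in> Mat_Zp n" "h \<in> Mat_Zp n"
    using assms by (auto simp: GL_Zp_def)
  have carrier:
      "g \<in> carrier_mat n n" "h \<in> carrier_mat n n" "g' \<in> carrier_mat n n" "h' \<in> carrier_mat n n"
    using gh inverses by (auto simp: Mat_Zp_def)
  have "g * h * (h' * g') = g * (h * h') * g'" "h' * g' * (g * h) = h' * (g' * g) * h"
    using carrier by (simp_all add: assoc_mult_mat[of _ n n _ n _ n] mult_carrier_mat[of _ n n _ n])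
  then have "g * h * (h' * g') = 1\<^sub>m n" "h' * g' * (g * h) = 1\<^sub>m n"
    using carrier inverses by simp_all
  then show ?thesis unfolding GL_Zp_def using Mat_Zp_mult gh inverses by blast
qed

lemma perm_conj_GL_Zp:
  assumes \<sigma>: "\<sigma> permutes {..<n}" and "b \<in> GL_Zp n"
  shows "minv (perm_mat n \<sigma>) * b * perm_mat n \<sigma> \<in> GL_Zp n"
proof -
  have "(perm_mat n \<sigma> :: 'a mat) \<in> Mat_Zp n" "(transpose_mat (perm_mat n \<sigma>) :: 'a mat) \<in> Mat_Zp n"
    by (auto simp: Mat_Zp_def perm_mat_def)
  then have w: "(perm_mat n \<sigma> :: 'a mat) \<in> GL_Zp n"
    unfolding GL_Zp_def
    using perm_mat_mult_transpose[OF \<sigma>, where 'a = 'a] transpose_mult_perm_mat[OF \<sigma>, where 'a = 'a]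
    by blast
  then show ?thesis using assms(2) by (intro GL_Zp_mult GL_Zp_minv)
qed

lemma Iwahori_GL_Zp: "g \<in> Iwahori p n \<Longrightarrow> g \<in> GL_Zp n"
  by (simp add: Iwahori_def)

lemma Iwahori_carrier: "g \<in> Iwahori p n \<Longrightarrow> g \<in> carrier_mat n n"
  by (auto simp: Iwahori_def GL_Zp_carrier)

lemma pro_p_Iwahori_imp_Iwahori: "g \<in> pro_p_Iwahori p n \<Longrightarrow> g \<in> Iwahori p n"
  by (auto simp: pro_p_Iwahori_def Iwahori_def)

lemma Pw_imp_Iwahori: "b \<in> Pw p n w \<Longrightarrow> b \<in> Iwahori p n"
  and Uw_imp_Iwahori: "u \<in> Uw p n w \<Longrightarrow> u \<in> Iwahori p n"
  by (auto simp: Pw_def Uw_def)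

context
  fixes n :: nat and \<sigma> :: "nat \<Rightarrow> nat"
  assumes \<sigma>: "\<sigma> permutes {..<n}"
begin

lemma Uw_iff:
  fixes u :: "'k::nonarch_field mat"
  shows "u \<in> Uw p n (perm_mat n \<sigma>) \<longleftrightarrow> u \<in> Iwahori p n \<and> (\<forall>i<n. u $$ (\<sigma> i, \<sigma> i) = 1) \<and>
    (\<forall>i j. i < j \<and> j < n \<longrightarrow> u $$ (\<sigma> i, \<sigma> j) = 0)"
proof (cases "u \<in> Iwahori p n")
  case True
  let ?h = "minv (perm_mat n \<sigma>) * u * perm_mat n \<sigma>"
  have "lower_unipotent n \<subseteq> (carrier_mat n n :: 'k mat set)"
    by (auto simp: lower_unipotent_def Mat_Zp_def)
  then have "u \<in> Uw p n (perm_mat n \<sigma>) \<longleftrightarrow> ?h \<in> lower_unipotent n"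
    unfolding Uw_def using True Iwahori_carrier[OF True] by (simp add: conj_set_perm_mat_iff[OF \<sigma>])
  moreover have "?h $$ (i,j) = u $$ (\<sigma> i, \<sigma> j)" if "i < n" "j < n" for i j
    by (rule perm_conj_index[OF \<sigma> Iwahori_carrier[OF True] that])
  moreover have "?h \<in> Mat_Zp n"
    using perm_conj_GL_Zp[OF \<sigma> Iwahori_GL_Zp[OF True]] by (simp add: GL_Zp_def)
  ultimately show ?thesis using True by (simp add: lower_unipotent_def)
qed (simp add: Uw_def)

lemma Pw_iff:
  fixes b :: "'k::nonarch_field mat"
  shows "b \<in> Pw p n (perm_mat n \<sigma>) \<longleftrightarrow> b \<in> Iwahori p n \<and> (\<forall>i j. j < i \<and> i < n \<longrightarrow> b $$ (\<sigma> i, \<sigma> j) = 0)"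
proof (cases "b \<in> Iwahori p n")
  case True
  let ?h = "minv (perm_mat n \<sigma>) * b * perm_mat n \<sigma>"
  have "upper_borel n \<subseteq> (carrier_mat n n :: 'k mat set)"
    by (auto simp: upper_borel_def GL_Zp_carrier)
  then have "b \<in> Pw p n (perm_mat n \<sigma>) \<longleftrightarrow> ?h \<in> upper_borel n"
    unfolding Pw_def using True Iwahori_carrier[OF True] by (simp add: conj_set_perm_mat_iff[OF \<sigma>])
  moreover have "?h $$ (i,j) = b $$ (\<sigma> i, \<sigma> j)" if "i < n" "j < n" for i j
    by (rule perm_conj_index[OF \<sigma> Iwahori_carrier[OF True] that])
  moreover have "?h \<in> GL_Zp n" by (rule perm_conj_GL_Zp[OF \<sigma> Iwahori_GL_Zp[OF True]])
  moreover have "dim_row ?h = n"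
    using perm_conj_carrier[OF \<sigma> Iwahori_carrier[OF True]] by (rule carrier_matD(1))
  ultimately show ?thesis using True by (auto simp: upper_borel_def upper_triangular_def)
qed (simp add: Pw_def)

lemma char_w_minv:
  assumes b: "b \<in> Pw p n (perm_mat n \<sigma>)"
  shows "char_w n \<chi> (perm_mat n \<sigma>) (minv b) = (\<Prod>i<n. \<chi> i (1 / b $$ (\<sigma> i, \<sigma> i)))"
proof -
  let ?T = "minv (perm_mat n \<sigma>) * b * perm_mat n \<sigma>"
    and ?S = "minv (perm_mat n \<sigma>) * minv b * perm_mat n \<sigma>"
  have GL: "b \<in> GL_Zp n" using b by (intro Iwahori_GL_Zp Pw_imp_Iwahori)
  note carrier = GL_Zp_carrier[OF GL] GL_Zp_carrier[OF GL_Zp_minv(1)[OF GL]]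
  have T: "?T \<in> carrier_mat n n" "upper_triangular ?T"
    using b perm_conj_index[OF \<sigma> carrier(1)] perm_conj_carrier[OF \<sigma> carrier(1)]
    by (auto simp: Pw_iff upper_triangular_def)
  have "?S * ?T = minv (perm_mat n \<sigma>) * (minv b * b) * perm_mat n \<sigma>"
    by (rule perm_conj_mult[OF \<sigma> carrier(2,1)])
  then have ST: "?S * ?T = 1\<^sub>m n"
    by (simp add: GL_Zp_minv(3)[OF GL] minv_perm_mat[OF \<sigma>] transpose_mult_perm_mat[OF \<sigma>]
        right_mult_one_mat[of _ n n])
  have "?S $$ (i,i) = 1 / b $$ (\<sigma> i, \<sigma> i)" if "i < n" for i
    using left_inverse_upper_triangular_diag[OF perm_conj_carrier[OF \<sigma> carrier(2)] T ST that]
    by (simp only: perm_conj_index[OF \<sigma> carrier(1) that that])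
  then show ?thesis by (simp add: char_w_def)
qed

lemma Uw_pos_iff:
  "(a,b) \<in> Uw_pos n (perm_mat n \<sigma> :: 'k::nonarch_field mat) \<longleftrightarrow>
    (\<exists>i j. j < i \<and> i < n \<and> a = \<sigma> i \<and> b = \<sigma> j)"
proof -
  have "(perm_mat n \<sigma> :: 'k mat) $$ (a,i) = 1 \<longleftrightarrow> a = \<sigma> i" if "a < n" "i < n" for a i
    using that by (simp add: perm_mat_def)
  then have "a < n \<and> b < n \<and> j < i \<and> i < n \<and> (perm_mat n \<sigma> :: 'k mat) $$ (a,i) = 1 \<and>
      (perm_mat n \<sigma> :: 'k mat) $$ (b,j) = 1 \<longleftrightarrow> j < i \<and> i < n \<and> a = \<sigma> i \<and> b = \<sigma> j" for i j
    using permutes_less[OF \<sigma>, of i] permutes_less[OF \<sigma>, of j] by auto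
  then show ?thesis unfolding Uw_pos_def by blast
qed

lemma Uw_pos_imp_neq: "(a,b) \<in> Uw_pos n (perm_mat n \<sigma> :: 'k::nonarch_field mat) \<Longrightarrow> a \<noteq> b"
  using permutes_inj[OF \<sigma>] by (auto simp: Uw_pos_iff dest: injD)

lemma
  assumes u: "(u :: 'k::nonarch_field mat) \<in> Uw p n (perm_mat n \<sigma>)"
  shows Uw_diag: "a < n \<Longrightarrow> u $$ (a,a) = 1"
    and Uw_entry_eq_0: "a < n \<Longrightarrow> b < n \<Longrightarrow> a \<noteq> b \<Longrightarrow>
      (a,b) \<notin> Uw_pos n (perm_mat n \<sigma> :: 'k mat) \<Longrightarrow> u $$ (a,b) = 0"
proof -
  show "u $$ (a,a) = 1" if "a < n" using permutes_ex_less[OF \<sigma> that] u by (auto simp: Uw_iff)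
  assume ab: "a < n" "b < n" "a \<noteq> b" "(a,b) \<notin> Uw_pos n (perm_mat n \<sigma> :: 'k mat)"
  obtain i j where ij: "i < n" "j < n" "a = \<sigma> i" "b = \<sigma> j"
    using permutes_ex_less[OF \<sigma> ab(1)] permutes_ex_less[OF \<sigma> ab(2)] by blast
  then have "i < j" using ab(3,4) unfolding Uw_pos_iff by (metis linorder_neqE_nat)
  then show "u $$ (a,b) = 0" using u ij by (auto simp: Uw_iff)
qed

end

lemma Uw_pos_less: "(a,b) \<in> Uw_pos n w \<Longrightarrow> a < n \<and> b < n"
  by (simp add: Uw_pos_def)

lemma finite_Uw_pos: "finite (Uw_pos n w)"
  by (rule finite_subset[of _ "{..<n} \<times> {..<n}"]) (auto simp: Uw_pos_def)

lemma factor_eq_1_if_prod_eq_1: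
  fixes f :: "'i \<Rightarrow> real"
  assumes "finite S" "\<And>i. i \<in> S \<Longrightarrow> 0 \<le> f i \<and> f i \<le> 1" "prod f S = 1" "i \<in> S"
  shows "f i = 1"
proof -
  have "prod f (S - {i}) \<le> 1" using assms(2) by (intro prod_le_1) auto
  then have "f i * prod f (S - {i}) \<le> f i" using assms(2,4) by (intro mult_left_le) auto
  then show ?thesis using assms by (simp add: prod.remove[of S i] order_antisym)
qed

context padic_field
begin

lemma pZp_0: "(0::'k) \<in> pZp p"
  by (simp add: pZp_iff)

lemma pZp_add: "(x::'k) \<in> pZp p \<Longrightarrow> y \<in> pZp p \<Longrightarrow> x + y \<in> pZp p"
  unfolding pZp_iff by (simp add: add_divide_distrib Zp_add)

lemma pZp_sum: "(\<And>i. i \<in> S \<Longrightarrow> (f i :: 'k) \<in> pZp p) \<Longrightarrow> (\<Sum>i\<in>S. f i) \<in> pZp p"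
  by (induction S rule: infinite_finite_induct) (auto intro: pZp_add simp: pZp_0)

lemma pZp_mult_left: "(x::'k) \<in> Zp \<Longrightarrow> y \<in> pZp p \<Longrightarrow> x * y \<in> pZp p"
  unfolding pZp_iff using Zp_mult[of x "y / of_nat p"] by simp

lemma pZp_mult_right: "(x::'k) \<in> pZp p \<Longrightarrow> y \<in> Zp \<Longrightarrow> x * y \<in> pZp p"
  using pZp_mult_left[of y x] by (simp add: mult.commute)

lemma Iwahori_mult:
  assumes g: "(g :: 'k mat) \<in> Iwahori p n" and h: "h \<in> Iwahori p n"
  shows "g * h \<in> Iwahori p n"
proof -
  note GL = Iwahori_GL_Zp[OF g] Iwahori_GL_Zp[OF h]
  have "(g * h) $$ (i,j) \<in> pZp p" if ij: "i < j" "j < n" for i j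
  proof -
    have "g $$ (i,k) * h $$ (k,j) \<in> pZp p" if k: "k < n" for k
    proof (cases "i < k")
      case True
      then show ?thesis
        using g k ij by (intro pZp_mult_right GL_Zp_entry[OF GL(2)]) (auto simp: Iwahori_def)
    next
      case False
      then show ?thesis
        using h k ij by (intro pZp_mult_left GL_Zp_entry[OF GL(1)]) (auto simp: Iwahori_def)
    qed
    then have "(\<Sum>k<n. g $$ (i,k) * h $$ (k,j)) \<in> pZp p" by (intro pZp_sum) simp
    then show ?thesis
      using ij mat_mult_index[OF GL_Zp_carrier[OF GL(1)] GL_Zp_carrier[OF GL(2)], of i j]
      by (simp del: index_mult_mat(1))
  qed
  then show ?thesis using GL_Zp_mult[OF GL] by (auto simp: Iwahori_def)
qed

lemma zp_algebra_Zp_valued: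
  fixes X :: "'x set"
  shows "zp_algebra p X {r. \<forall>x\<in>X. (r x :: 'k) \<in> Zp}"
proof unfold_locales
  fix r :: "'x \<Rightarrow> 'k" assume r: "r \<in> {r. \<forall>x\<in>X. r x \<in> Zp}"
  have "vabs (1 + of_nat p * r x) = 1" if "x \<in> X" for x
    using vabs_eq_if_close[of "1 + of_nat p * r x" 1] vabs_p_mult_less_1[of "r x"] vabs_Zp[of "r x"]
      r that by simp
  then show "(\<lambda>x. 1 / (1 + of_nat p * r x)) \<in> {r. \<forall>x\<in>X. r x \<in> Zp}"
    using r by (auto intro!: Zp_divide Zp_add Zp_mult)
qed (auto intro: Zp_add Zp_mult)

interpretation point: zp_algebra p ty "UNIV :: unit set" "{r. r () \<in> Zp}"
  using zp_algebra_Zp_valued[of "UNIV :: unit set"] by simp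

lemma point_pA_iff: "(\<lambda>_. x) \<in> point.pA \<longleftrightarrow> x \<in> pZp p"
  by (simp add: point.pA_def pZp_iff)

lemma pro_p_IwahoriI:
  assumes "(g :: 'k mat) \<in> Mat_Zp n" "\<And>i j. i < j \<Longrightarrow> j < n \<Longrightarrow> g $$ (i,j) \<in> pZp p"
    and "\<And>i. i < n \<Longrightarrow> g $$ (i,i) - 1 \<in> pZp p"
  shows "g \<in> pro_p_Iwahori p n"
proof -
  have "point.pro_p_family n (\<lambda>_. g)"
    using assms by (intro point.pro_p_familyI) (auto simp: Mat_Zp_def point_pA_iff)
  then show ?thesis by (rule point.pro_p_family_imp_pro_p_Iwahori) simp
qed

lemma minv_pro_p_Iwahori: "(g :: 'k mat) \<in> pro_p_Iwahori p n \<Longrightarrow> minv g \<in> pro_p_Iwahori p n"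
  by (rule point.pro_p_family_imp_pro_p_Iwahori[OF point.pro_p_family_minv])
     (auto intro: point.pro_p_family_const)

lemma vabs_det_GL_Zp:
  assumes "(g :: 'k mat) \<in> GL_Zp n" shows "vabs (det g) = 1"
proof -
  have det_le_1: "vabs (det M) \<le> 1" if "M \<in> GL_Zp n" for M :: "'k mat"
    using point.A_det[of "\<lambda>_. M" n] GL_Zp_carrier[OF that] GL_Zp_entry[OF that]
    by (auto intro: vabs_Zp)
  have "det g * det (minv g) = 1"
    using det_mult[OF GL_Zp_carrier[OF assms] GL_Zp_carrier[OF GL_Zp_minv(1)[OF assms]]]
      GL_Zp_minv(2)[OF assms] by simp
  then have "vabs (det g) * vabs (det (minv g)) = 1" by (metis vabs_mult vabs_one)
  moreover have "vabs (det g) * vabs (det (minv g)) \<le> vabs (det g)"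
    using det_le_1[OF GL_Zp_minv(1)[OF assms]] by (intro mult_left_le) auto
  ultimately show ?thesis using det_le_1[OF assms] by simp
qed

lemma vabs_Iwahori_diag:
  assumes g: "(g :: 'k mat) \<in> Iwahori p n" and i: "i < n"
  shows "vabs (g $$ (i,i)) = 1"
proof -
  note GL = Iwahori_GL_Zp[OF g]
  have "(\<lambda>_. det g - (\<Prod>i = 0..<n. g $$ (i,i))) \<in> point.pA"
    using g GL_Zp_carrier[OF GL] GL_Zp_entry[OF GL]
    by (intro point.pA_det_minus_prod_diag) (auto simp: Iwahori_def point_pA_iff)
  then obtain y where y: "y \<in> Zp" "det g - (\<Prod>i = 0..<n. g $$ (i,i)) = of_nat p * y"
    by (auto simp: point_pA_iff pZp_def)
  have "vabs ((\<Prod>i = 0..<n. g $$ (i,i)) - det g) < vabs (det g)"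
    using vabs_p_mult_less_1[OF vabs_Zp[OF y(1)]]
    by (simp add: vabs_minus_commute[of _ "det g"] y(2) vabs_det_GL_Zp[OF GL])
  then have "(\<Prod>i = 0..<n. vabs (g $$ (i,i))) = 1"
    using vabs_eq_if_close vabs_det_GL_Zp[OF GL] by (metis vabs_prod)
  then show ?thesis
    using i GL_Zp_entry[OF GL] factor_eq_1_if_prod_eq_1[of "{0..<n}" "\<lambda>i. vabs (g $$ (i,i))" i]
    by (simp add: vabs_Zp)
qed

lemma mat_diag_in_Pw:
  fixes d :: "nat \<Rightarrow> 'k"
  assumes d: "\<And>i. i < n \<Longrightarrow> d i \<in> Zp" "\<And>i. i < n \<Longrightarrow> vabs (d i) = 1" and \<sigma>: "\<sigma> permutes {..<n}"
  shows "mat_diag n d \<in> Pw p n (perm_mat n \<sigma>)"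
  unfolding Pw_iff[OF \<sigma>]
proof (intro conjI allI impI)
  have "d i \<noteq> 0" if "i < n" for i using d(2)[OF that] by auto
  then have "mat_diag n d * mat_diag n (\<lambda>i. 1 / d i) = 1\<^sub>m n"
    "mat_diag n (\<lambda>i. 1 / d i) * mat_diag n d = 1\<^sub>m n"
    unfolding mat_diag_diag by (auto simp: mat_diag_def intro!: eq_matI)
  moreover have "mat_diag n d \<in> Mat_Zp n" "mat_diag n (\<lambda>i. 1 / d i) \<in> Mat_Zp n"
    using d by (auto simp: Mat_Zp_def mat_diag_def intro: Zp_divide)
  ultimately have "mat_diag n d \<in> GL_Zp n" unfolding GL_Zp_def by blast
  then show "mat_diag n d \<in> Iwahori p n" by (auto simp: Iwahori_def mat_diag_def pZp_0)
  fix i j assume ij: "j < i \<and> i < n"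
  then have "\<sigma> i \<noteq> \<sigma> j" using permutes_inj[OF \<sigma>] by (auto dest: injD)
  then show "mat_diag n d $$ (\<sigma> i, \<sigma> j) = 0"
    using ij permutes_less[OF \<sigma>, of i] permutes_less[OF \<sigma>, of j] by (simp add: mat_diag_def)
qed

lemma Iwahori_eq_pro_p_mult_Pw:
  assumes g: "(g :: 'k mat) \<in> Iwahori p n" and \<sigma>: "\<sigma> permutes {..<n}"
  obtains h b where "h \<in> pro_p_Iwahori p n" "b \<in> Pw p n (perm_mat n \<sigma>)" "g = h * b"
proof
  note GL = Iwahori_GL_Zp[OF g] and unit = vabs_Iwahori_diag[OF g]
  let ?h = "mat n n (\<lambda>(i,j). g $$ (i,j) / g $$ (j,j))"
  have nonzero: "g $$ (i,i) \<noteq> 0" if "i < n" for i using unit[OF that] by auto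
  show "?h \<in> pro_p_Iwahori p n"
  proof (rule pro_p_IwahoriI)
    show "?h \<in> Mat_Zp n" using GL_Zp_entry[OF GL] unit by (auto simp: Mat_Zp_def intro: Zp_divide)
    show "?h $$ (i,j) \<in> pZp p" if "i < j" "j < n" for i j
    proof -
      have "g $$ (i,j) * (1 / g $$ (j,j)) \<in> pZp p"
        using g GL_Zp_entry[OF GL] unit that
        by (intro pZp_mult_right Zp_divide) (auto simp: Iwahori_def)
      then show ?thesis using that by simp
    qed
  qed (simp add: nonzero pZp_0)
  show "mat_diag n (\<lambda>i. g $$ (i,i)) \<in> Pw p n (perm_mat n \<sigma>)"
    by (rule mat_diag_in_Pw[OF _ unit \<sigma>]) (rule GL_Zp_entry[OF GL])
  show "g = ?h * mat_diag n (\<lambda>i. g $$ (i,i))"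
    using GL_Zp_carrier[OF GL] nonzero
    by (subst mat_diag_mult_right[of _ n n]) (auto intro!: eq_matI)
qed

end

section \<open>Pro-p families attached to the coordinates\<close>

context zp_algebra
begin

lemma pro_p_family_one_plus_p_mult:
  assumes carrier: "\<And>x. x \<in> X \<Longrightarrow> M x \<in> carrier_mat n n"
    and entries: "\<And>i j. i < n \<Longrightarrow> j < n \<Longrightarrow> (\<lambda>x. M x $$ (i,j)) \<in> A"
  shows "pro_p_family n (\<lambda>x. 1\<^sub>m n + of_nat p \<cdot>\<^sub>m M x)"
proof -
  have index:
    "(1\<^sub>m n + of_nat p \<cdot>\<^sub>m M x) $$ (i,j) = (if i = j then 1 else 0) + of_nat p * M x $$ (i,j)"
    if "x \<in> X" "i < n" "j < n" for x i j
    using carrier_matD[OF carrier[OF that(1)]] that by simp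
  have entry: "(\<lambda>x. of_nat p * M x $$ (i,j)) \<in> pA" if "i < n" "j < n" for i j
    using entries[OF that] by (rule pA_p_mult)
  show ?thesis
  proof (rule pro_p_familyI)
    fix i j
    show "(\<lambda>x. (1\<^sub>m n + of_nat p \<cdot>\<^sub>m M x) $$ (i,j)) \<in> A" if "j < i" "i < n"
      by (rule A_cong[OF pA_imp_A[OF entry]]) (use that index in auto)
    show "(\<lambda>x. (1\<^sub>m n + of_nat p \<cdot>\<^sub>m M x) $$ (i,j)) \<in> pA" if "i < j" "j < n"
      by (rule pA_cong[OF entry]) (use that index in auto)
    show "(\<lambda>x. (1\<^sub>m n + of_nat p \<cdot>\<^sub>m M x) $$ (i,i) - 1) \<in> pA" if "i < n"
      by (rule pA_cong[OF entry]) (use that index in auto)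
  qed (use carrier in auto)
qed

lemma pro_p_family_addrow_mat:
  assumes "i < n" "j < n" "i \<noteq> j" "y \<in> A" "i < j \<Longrightarrow> y \<in> pA"
  shows "pro_p_family n (\<lambda>x. addrow_mat n (y x) i j)"
proof (rule pro_p_familyI)
  fix a b
  show "(\<lambda>x. addrow_mat n (y x) i j $$ (a,b)) \<in> A" if "b < a" "a < n"
    using that assms by (cases "a = i \<and> b = j") (auto simp: A_const)
  show "(\<lambda>x. addrow_mat n (y x) i j $$ (a,b)) \<in> pA" if "a < b" "b < n"
    using that assms by (cases "a = i \<and> b = j") (auto simp: pA_0)
  show "(\<lambda>x. addrow_mat n (y x) i j $$ (a,a) - 1) \<in> pA" if "a < n"
    using that assms by (cases "a = i") (auto simp: pA_0)
qed simp

lemma pro_p_family_elementary_product: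
  assumes "\<And>i j. (i,j) \<in> set ps \<Longrightarrow> i < n \<and> j < n \<and> i \<noteq> j"
    and "\<And>i j. (i,j) \<in> set ps \<Longrightarrow> (\<lambda>x. y x (i,j)) \<in> A"
    and "\<And>i j. (i,j) \<in> set ps \<Longrightarrow> i < j \<Longrightarrow> (\<lambda>x. y x (i,j)) \<in> pA"
  shows "pro_p_family n (\<lambda>x. elementary_product n (y x) ps)"
  using assms
proof (induction ps)
  case Nil
  then show ?case by (simp add: elementary_product_def pro_p_family_one)
next
  case (Cons ij ps)
  obtain i j where ij: "ij = (i,j)" by fastforce
  have "pro_p_family n (\<lambda>x. addrow_mat n (y x (i,j)) i j * elementary_product n (y x) ps)"
    using Cons.prems unfolding ij
    by (intro pro_p_family_mult pro_p_family_addrow_mat Cons.IH) auto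
  then show ?case by (simp add: elementary_product_def ij)
qed

lemma pro_p_family_G_point:
  assumes z: "\<And>ij. ij \<in> all_pos n \<Longrightarrow> (\<lambda>x. z x ij) \<in> A"
    and lo: "set lo = {(i,j). j < i \<and> i < n}" and hi: "set hi = {(i,j). i < j \<and> j < n}"
  shows "pro_p_family n (\<lambda>x. G_point p n lo hi (z x))"
  unfolding G_point_def
proof (intro pro_p_family_mult)
  show "pro_p_family n (\<lambda>x. elementary_product n (z x) lo)"
    using z lo by (intro pro_p_family_elementary_product) (auto simp: all_pos_def)
  have "(\<lambda>x. of_nat p * z x (i,j)) \<in> pA" if "(i,j) \<in> set hi" for i j
    using that z hi by (intro pA_p_mult) (auto simp: all_pos_def)
  then show "pro_p_family n (\<lambda>x. elementary_product n (\<lambda>ij. of_nat p * z x ij) hi)"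
    using hi by (intro pro_p_family_elementary_product) (auto intro: pA_imp_A)
  show "pro_p_family n (\<lambda>x. mat_diag n (\<lambda>i. 1 + of_nat p * z x (i,i)))"
    using z
    by (intro pro_p_familyI) (auto simp: mat_diag_def A_const pA_0 all_pos_def intro!: pA_p_mult)
qed

lemma pro_p_family_Uw:
  assumes \<sigma>: "\<sigma> permutes {..<n}"
    and u: "\<And>x. x \<in> X \<Longrightarrow> u x \<in> Uw p n (perm_mat n \<sigma>)"
    and crd: "\<And>ij. ij \<in> Uw_pos n (perm_mat n \<sigma> :: 'k mat) \<Longrightarrow> (\<lambda>x. Uw_crd p (u x) ij) \<in> A"
  shows "pro_p_family n u"
proof (rule pro_p_familyI)
  let ?J = "Uw_pos n (perm_mat n \<sigma> :: 'k mat)"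
  show "u x \<in> carrier_mat n n" if "x \<in> X" for x
    using u[OF that] by (intro Iwahori_carrier Uw_imp_Iwahori)
  fix i j
  show "(\<lambda>x. u x $$ (i,j)) \<in> A" if "j < i" "i < n"
  proof (cases "(i,j) \<in> ?J")
    case True
    then show ?thesis using crd[OF True] that by (simp add: Uw_crd_def)
  next
    case False
    then show ?thesis
      using that by (intro A_cong[OF A_const[OF Zp_0]]) (auto simp: Uw_entry_eq_0[OF \<sigma> u])
  qed
  show "(\<lambda>x. u x $$ (i,j)) \<in> pA" if "i < j" "j < n"
  proof (cases "(i,j) \<in> ?J")
    case True
    then show ?thesis using crd[OF True] that by (simp add: Uw_crd_def pA_def)
  next
    case False
    then show ?thesis using that by (intro pA_cong[OF pA_0]) (auto simp: Uw_entry_eq_0[OF \<sigma> u])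
  qed
  show "(\<lambda>x. u x $$ (i,i) - 1) \<in> pA" if "i < n"
    by (rule pA_cong[OF pA_0]) (simp add: Uw_diag[OF \<sigma> u that])
qed

lemma A_Uw_crd:
  assumes g: "pro_p_family n g" and ij: "i < n" "j < n"
  shows "(\<lambda>x. Uw_crd p (g x) (i,j)) \<in> A"
proof (cases "i < j")
  case True
  then show ?thesis using pro_p_family_upper[OF g] ij by (simp add: Uw_crd_def pA_def)
next
  case False
  then show ?thesis using pro_p_family_entry[OF g] ij by (simp add: Uw_crd_def)
qed

end

section \<open>Analyticity of equivariant functions along pro-p families\<close>

context tate_space
begin

definition tate_Zp :: "('x \<Rightarrow> 'k) set" where
  "tate_Zp = {r \<in> tate_ball. \<forall>x\<in>X. r x \<in> Zp}"

lemma zp_algebra_tate_Zp: "zp_algebra p X tate_Zp"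
proof unfold_locales
  fix r assume r: "r \<in> tate_Zp"
  interpret Zp_valued: zp_algebra p ty X "{r. \<forall>x\<in>X. r x \<in> Zp}" by (rule zp_algebra_Zp_valued)
  show "(\<lambda>x. 1 / (1 + of_nat p * r x)) \<in> tate_Zp"
    using r tate_ball_inverse[of r] Zp_valued.A_inverse[of r] by (auto simp: tate_Zp_def)
next
  fix r s assume "r \<in> tate_Zp" "\<And>x. x \<in> X \<Longrightarrow> r x = s x"
  then show "s \<in> tate_Zp" using tate_ball_cong[of r s] by (auto simp: tate_Zp_def)
qed (auto simp: tate_Zp_def vabs_Zp
    intro: tate_ball_const tate_ball_add tate_ball_mult Zp_add Zp_mult)

sublocale zp_algebra p ty X tate_Zp
  by (rule zp_algebra_tate_Zp)

lemma tate_Zp_crd: "i \<in> I \<Longrightarrow> (\<lambda>x. crd x i) \<in> tate_Zp"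
  using tate_ball_crd crd_Zp by (auto simp: tate_Zp_def)

lemma tate_Zp_imp_tate_ball: "r \<in> tate_Zp \<Longrightarrow> r \<in> tate_ball"
  by (simp add: tate_Zp_def)

end

definition equivariant ::
  "nat \<Rightarrow> nat \<Rightarrow> (nat \<Rightarrow> 'k \<Rightarrow> 'k) \<Rightarrow> 'k mat \<Rightarrow> ('k::nonarch_field mat \<Rightarrow> 'k) \<Rightarrow> bool" where
  "equivariant p n \<chi> w f \<longleftrightarrow>
     (\<forall>g\<in>Iwahori p n. \<forall>b\<in>Pw p n w. f (g * b) = char_w n \<chi> w (minv b) * f g)"

lemma equivariantD:
  "equivariant p n \<chi> w f \<Longrightarrow> g \<in> Iwahori p n \<Longrightarrow> b \<in> Pw p n w \<Longrightarrow>
    f (g * b) = char_w n \<chi> w (minv b) * f g"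
  by (simp add: equivariant_def)

locale analytic_character = padic_field p ty
  for p :: nat and ty :: "'k::nonarch_field itself" +
  fixes n :: nat and \<sigma> :: "nat \<Rightarrow> nat" and c :: "nat \<Rightarrow> 'k" and \<chi> :: "nat \<Rightarrow> 'k \<Rightarrow> 'k"
  assumes \<sigma>: "\<sigma> permutes {..<n}"
    and char_one_plus_p_mult: "\<And>i u. i < n \<Longrightarrow> u \<in> Zp \<Longrightarrow>
      \<chi> i (1 + of_nat p * u) = padic_exp (c i * padic_log (1 + of_nat p * u))"
    and vabs_c_mult_p_less: "\<And>i. i < n \<Longrightarrow> vabs (c i * of_nat p) < exp_radius"
begin

abbreviation w :: "'k mat" where "w \<equiv> perm_mat n \<sigma>"

abbreviation Zp_expansion ::
  "((nat \<times> nat \<Rightarrow> 'k) \<Rightarrow> 'k) \<Rightarrow> ((nat \<times> nat \<Rightarrow> nat) \<Rightarrow> 'k) \<Rightarrow> bool" where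
  "Zp_expansion \<equiv> tate_expansion (all_pos n) (Zp_points (all_pos n)) (\<lambda>z. z)"

definition analytic_vector :: "('k mat \<Rightarrow> 'k) \<Rightarrow> bool" where
  "analytic_vector f \<longleftrightarrow> equivariant p n \<chi> w f \<and> (\<exists>a. Uw_expansion p n w f a)"

end

locale tate_character = tate_space p ty I X crd + analytic_character p ty n \<sigma> c \<chi>
  for p :: nat and ty :: "'k::nonarch_field itself"
    and I :: "'i set" and X :: "'x set" and crd :: "'x \<Rightarrow> 'i \<Rightarrow> 'k"
    and n :: nat and \<sigma> :: "nat \<Rightarrow> nat" and c :: "nat \<Rightarrow> 'k" and \<chi> :: "nat \<Rightarrow> 'k \<Rightarrow> 'k"
begin

lemma tate_ball_char_w:
  assumes b: "pro_p_family n b" "\<And>x. x \<in> X \<Longrightarrow> b x \<in> Pw p n w"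
  shows "(\<lambda>x. char_w n \<chi> w (minv (b x))) \<in> tate_ball"
proof (rule tate_ball_cong)
  define s where "s i x = (1 / b x $$ (\<sigma> i, \<sigma> i) - 1) / of_nat p" for i x
  have s: "s i \<in> tate_Zp" if "i < n" for i
    using one_plus_pA_inverse[OF pro_p_family_diag[OF b(1) permutes_less[OF \<sigma> that]]]
    by (simp add: pA_def s_def[abs_def])
  then show "(\<lambda>x. \<Prod>i<n. padic_exp (c i * padic_log (1 + of_nat p * s i x))) \<in> tate_ball"
    by (intro tate_ball_prod tate_ball_exp_log tate_Zp_imp_tate_ball vabs_c_mult_p_less) auto
  fix x assume x: "x \<in> X"
  have "\<chi> i (1 / b x $$ (\<sigma> i, \<sigma> i)) = padic_exp (c i * padic_log (1 + of_nat p * s i x))"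
    if "i < n" for i
    using char_one_plus_p_mult[OF that A_Zp[OF s[OF that] x]] by (simp add: s_def)
  then show "(\<Prod>i<n. padic_exp (c i * padic_log (1 + of_nat p * s i x))) = char_w n \<chi> w (minv (b x))"
    unfolding char_w_minv[OF \<sigma> b(2)[OF x]] by simp
qed

lemma
  assumes g: "pro_p_family n g" and x: "x \<in> X"
  shows pro_p_family_eq_lu: "g x = lu_lower \<sigma> n (g x) * lu_upper \<sigma> n (g x)"
    and lu_lower_in_Uw: "lu_lower \<sigma> n (g x) \<in> Uw p n w"
    and lu_upper_in_Pw: "lu_upper \<sigma> n (g x) \<in> Pw p n w"
proof -
  note lu = pro_p_family_carrier[OF g x] \<sigma> one_plus_pA_nonzero[OF schur_pivot_one_plus_pA[OF g \<sigma>] x]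
  show "g x = lu_lower \<sigma> n (g x) * lu_upper \<sigma> n (g x)" by (rule lu_decomposition[OF lu])
  have "lu_lower \<sigma> n (g x) \<in> Iwahori p n" "lu_upper \<sigma> n (g x) \<in> Iwahori p n"
    using pro_p_family_imp_pro_p_Iwahori[OF pro_p_family_lu_lower[OF g \<sigma>] x]
      pro_p_family_imp_pro_p_Iwahori[OF pro_p_family_lu_upper[OF g \<sigma>] x]
    by (auto intro: pro_p_Iwahori_imp_Iwahori)
  then show "lu_lower \<sigma> n (g x) \<in> Uw p n w" "lu_upper \<sigma> n (g x) \<in> Pw p n w"
    unfolding Uw_iff[OF \<sigma>] Pw_iff[OF \<sigma>]
    using lu_lower_diag[OF lu] lu_lower_eq_0[OF lu] lu_upper_eq_0[OF lu] by blast+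
qed

lemma analytic_along_pro_p_family:
  assumes f: "analytic_vector f" and g: "pro_p_family n g"
  shows "\<exists>b. tate_expansion I X crd (\<lambda>x. f (g x)) b"
proof -
  define u where "u x = lu_lower \<sigma> n (g x)" for x
  define b where "b x = lu_upper \<sigma> n (g x)" for x
  have u: "pro_p_family n u" "\<And>x. x \<in> X \<Longrightarrow> u x \<in> Uw p n w"
    unfolding u_def[abs_def] by (rule pro_p_family_lu_lower[OF g \<sigma>]) (rule lu_lower_in_Uw[OF g])
  have b: "pro_p_family n b" "\<And>x. x \<in> X \<Longrightarrow> b x \<in> Pw p n w"
    unfolding b_def[abs_def] by (rule pro_p_family_lu_upper[OF g \<sigma>]) (rule lu_upper_in_Pw[OF g])
  let ?J = "Uw_pos n w" and ?\<chi> = "\<lambda>x. char_w n \<chi> w (minv (b x))"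
  obtain a where a: "tate_expansion ?J (Uw p n w) (Uw_crd p) f a"
    using f by (auto simp: analytic_vector_def Uw_expansion_def)
  note null = tate_expansion_null_family[OF a]
  obtain C where C: "C > 0" "\<And>\<alpha>. \<alpha> \<in> multi_indices ?J \<Longrightarrow> vabs (a \<alpha>) \<le> C"
    using null_family_bounded[OF null] by blast
  have terms: "(\<lambda>x. ?\<chi> x * mpower ?J (Uw_crd p (u x)) \<alpha>) \<in> tate_ball" for \<alpha>
    unfolding mpower_def
    by (intro tate_ball_mult tate_ball_char_w[OF b] tate_ball_prod tate_ball_power
        tate_Zp_imp_tate_ball)
       (auto intro: A_Uw_crd[OF u(1)] dest: Uw_pos_less)
  have series:
    "((\<lambda>\<alpha>. a \<alpha> * (?\<chi> x * mpower ?J (Uw_crd p (u x)) \<alpha>)) has_sum f (g x)) (multi_indices ?J)"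
    if x: "x \<in> X" for x
  proof -
    have "f (g x) = ?\<chi> x * f (u x)"
      using equivariantD[of p n \<chi> w f, OF _ Uw_imp_Iwahori[OF u(2)[OF x]] b(2)[OF x]] f
        pro_p_family_eq_lu[OF g x] by (simp add: analytic_vector_def u_def b_def)
    then show ?thesis
      using has_sum_cmult_right[OF tate_expansion_has_sum[OF a u(2)[OF x]], of "?\<chi> x"]
      by (simp add: mult.left_commute)
  qed
  show ?thesis
    by (rule tate_expansion_null_sum[OF null terms series less_imp_le[OF C(1)] C(2)]) auto
qed

lemma analytic_along_pro_p_family_mult:
  assumes f: "analytic_vector f" and g: "pro_p_family n g" and h: "h \<in> Iwahori p n"
  shows "\<exists>b. tate_expansion I X crd (\<lambda>x. f (g x * h)) b"
proof -
  obtain k b where k: "k \<in> pro_p_Iwahori p n" and b: "b \<in> Pw p n w" and h_eq: "h = k * b"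
    using h \<sigma> by (rule Iwahori_eq_pro_p_mult_Pw)
  note gk = pro_p_family_mult[OF g pro_p_family_const[OF k]]
  obtain a where "tate_expansion I X crd (\<lambda>x. f (g x * k)) a"
    using analytic_along_pro_p_family[OF f gk] by blast
  then have "tate_expansion I X crd (\<lambda>x. char_w n \<chi> w (minv b) * f (g x * k))
      (\<lambda>\<alpha>. char_w n \<chi> w (minv b) * a \<alpha>)"
    by (rule tate_expansion_cmult)
  moreover have "char_w n \<chi> w (minv b) * f (g x * k) = f (g x * h)" if x: "x \<in> X" for x
  proof -
    have "g x * h = g x * k * b"
      unfolding h_eq using pro_p_family_carrier[OF g x]
        Iwahori_carrier[OF pro_p_Iwahori_imp_Iwahori[OF k]] Iwahori_carrier[OF Pw_imp_Iwahori[OF b]]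
      by (intro assoc_mult_mat[symmetric])
    then show ?thesis
      using f b equivariantD[of p n \<chi> w f "g x * k" b]
        pro_p_Iwahori_imp_Iwahori[OF pro_p_family_imp_pro_p_Iwahori[OF gk x]]
      by (simp add: analytic_vector_def)
  qed
  ultimately have "tate_expansion I X crd (\<lambda>x. f (g x * h)) (\<lambda>\<alpha>. char_w n \<chi> w (minv b) * a \<alpha>)"
    by (rule tate_expansion_cong[THEN iffD1, rotated])
  then show ?thesis by blast
qed

end

section \<open>The induced representation\<close>

lemma GL_Zp_add_p_mult_eq:
  fixes g :: "'k::nonarch_field mat"
  assumes "g \<in> GL_Zp n"
  shows "g + mat n n (\<lambda>ij. q * z ij) = (1\<^sub>m n + q \<cdot>\<^sub>m (mat n n z * minv g)) * g"
proof -
  note carrier = GL_Zp_carrier[OF assms] GL_Zp_carrier[OF GL_Zp_minv(1)[OF assms]]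
  have "(1\<^sub>m n + q \<cdot>\<^sub>m (mat n n z * minv g)) * g = g + q \<cdot>\<^sub>m (mat n n z * minv g * g)"
    using carrier
    by (subst add_mult_distrib_mat[of _ n n]) (auto simp: mult_smult_assoc_mat[of _ n n])
  also have "mat n n z * minv g * g = mat n n z"
    using carrier GL_Zp_minv(3)[OF assms] by (simp add: assoc_mult_mat[of _ n n _ n _ n])
  also have "g + q \<cdot>\<^sub>m mat n n z = g + mat n n (\<lambda>ij. q * z ij)"
    by (intro arg_cong2[of _ _ _ _ "(+)"] eq_matI) auto
  finally show ?thesis by simp
qed

lemma finite_all_pos: "finite (all_pos n)"
  by (simp add: all_pos_def)

context analytic_character
begin

lemma Uw_crd_Zp:
  assumes u: "u \<in> Uw p n w" and "ij \<in> Uw_pos n w"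
  shows "Uw_crd p u ij \<in> Zp"
proof -
  obtain i j where ij: "ij = (i,j)" "i < n" "j < n" using assms(2) Uw_pos_less by (cases ij) blast
  then show ?thesis
    using Uw_imp_Iwahori[OF u] GL_Zp_entry[OF Iwahori_GL_Zp[OF Uw_imp_Iwahori[OF u]], of i j]
    by (auto simp: Uw_crd_def Iwahori_def pZp_iff)
qed

lemma Uw_crd_onto:
  assumes z: "z \<in> Zp_points (Uw_pos n w)"
  shows "\<exists>u\<in>Uw p n w. \<forall>ij\<in>Uw_pos n w. Uw_crd p u ij = z ij"
proof
  let ?J = "Uw_pos n w"
  define u where "u = mat n n (\<lambda>(i,j). if i = j then 1 else if (i,j) \<in> ?J then
    (if i < j then of_nat p * z (i,j) else z (i,j)) else 0)"
  have zZp: "z ij \<in> Zp" if "ij \<in> ?J" for ij using z that by (simp add: Zp_points_def)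
  have "u \<in> pro_p_Iwahori p n"
  proof (rule pro_p_IwahoriI)
    show "u \<in> Mat_Zp n" using zZp by (auto simp: u_def Mat_Zp_def intro: Zp_mult)
  qed (use zZp in \<open>auto simp: u_def pZp_iff\<close>)
  moreover have "u $$ (\<sigma> i, \<sigma> j) = 0" if ij: "i < j" "j < n" for i j
  proof -
    have "\<sigma> i \<noteq> \<sigma> j" "(\<sigma> i, \<sigma> j) \<notin> ?J"
      using ij by (auto simp: Uw_pos_iff[OF \<sigma>] inj_eq[OF permutes_inj[OF \<sigma>]])
    then show ?thesis
      using permutes_less[OF \<sigma>, of i] permutes_less[OF \<sigma>, of j] ij by (simp add: u_def)
  qed
  ultimately show "u \<in> Uw p n w"
    unfolding Uw_iff[OF \<sigma>] using permutes_less[OF \<sigma>] pro_p_Iwahori_imp_Iwahori by (auto simp: u_def)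
  have "Uw_crd p u (i,j) = z (i,j)" if "(i,j) \<in> ?J" for i j
    using Uw_pos_less[OF that] Uw_pos_imp_neq[OF \<sigma> that] that by (simp add: Uw_crd_def u_def)
  then show "\<forall>ij\<in>?J. Uw_crd p u ij = z ij" by auto
qed

interpretation U: full_tate_space p ty "Uw_pos n w" "Uw p n w" "Uw_crd p"
  by unfold_locales (auto simp: finite_Uw_pos Uw_crd_Zp Uw_crd_onto vabs_Zp)

interpretation U: tate_character p ty "Uw_pos n w" "Uw p n w" "Uw_crd p" n \<sigma> c \<chi>
  by unfold_locales

interpretation Z: full_tate_space p ty "all_pos n" "Zp_points (all_pos n)" "\<lambda>z. z"
  by unfold_locales (auto simp: finite_all_pos Zp_points_def vabs_Zp)

interpretation Z: tate_character p ty "all_pos n" "Zp_points (all_pos n)" "\<lambda>z. z" n \<sigma> c \<chi>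
  by unfold_locales

lemma analytic_vector_locally_analytic:
  assumes f: "analytic_vector f"
  shows "locally_analytic_on_Iwahori p n f"
  unfolding locally_analytic_on_Iwahori_def
proof
  fix g :: "'k mat" assume g: "g \<in> Iwahori p n"
  note GL = Iwahori_GL_Zp[OF g]
  define k where "k = (\<lambda>z. 1\<^sub>m n + of_nat p \<cdot>\<^sub>m (mat n n z * minv g))"
  have carrier: "mat n n z * minv g \<in> carrier_mat n n" for z
    using GL_Zp_carrier[OF GL_Zp_minv(1)[OF GL]] by (intro mult_carrier_mat) auto
  have k: "Z.pro_p_family n k"
    unfolding k_def
  proof (rule Z.pro_p_family_one_plus_p_mult[OF carrier])
    fix i j assume ij: "i < n" "j < n"
    have "(\<lambda>z. \<Sum>l<n. z (i,l) * minv g $$ (l,j)) \<in> Z.tate_Zp"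
      using ij
      by (intro Z.A_sum Z.A_mult Z.A_const Z.tate_Zp_crd GL_Zp_entry[OF GL_Zp_minv(1)[OF GL]])
         (auto simp: all_pos_def)
    moreover have "(\<Sum>l<n. z (i,l) * minv g $$ (l,j)) = (mat n n z * minv g) $$ (i,j)" for z
      using ij mat_mult_index[of "mat n n z" n "minv g" i j] GL_Zp_carrier[OF GL_Zp_minv(1)[OF GL]]
      by (simp del: index_mult_mat(1))
    ultimately show "(\<lambda>z. (mat n n z * minv g) $$ (i,j)) \<in> Z.tate_Zp" by simp
  qed
  have nbhd: "g + mat n n (\<lambda>ij. of_nat p ^ 1 * z ij) = k z * g" for z
    unfolding k_def using GL_Zp_add_p_mult_eq[OF GL, of "of_nat p" z] by simp
  have "k z * g \<in> Iwahori p n" if "z \<in> Zp_points (all_pos n)" for z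
    using that
    by (intro Iwahori_mult[OF _ g] pro_p_Iwahori_imp_Iwahori Z.pro_p_family_imp_pro_p_Iwahori[OF k])
  moreover obtain b where "Zp_expansion (\<lambda>z. f (k z * g)) b"
    using Z.analytic_along_pro_p_family_mult[OF f k g] by blast
  ultimately show "\<exists>m::nat. (let nbhd = (\<lambda>z. g + mat n n (\<lambda>ij. of_nat p ^ m * z ij)) in
         (\<forall>z\<in>Zp_points (all_pos n). nbhd z \<in> Iwahori p n) \<and>
         (\<exists>a. tate_expansion (all_pos n) (Zp_points (all_pos n)) (\<lambda>z. z) (\<lambda>z. f (nbhd z)) a))"
    unfolding Let_def by (intro exI[of _ 1]) (simp only: nbhd, blast)
qed

lemma ind_iff: "f \<in> ind p n \<chi> w \<longleftrightarrow> (\<forall>g. g \<notin> Iwahori p n \<longrightarrow> f g = 0) \<and> analytic_vector f"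
  unfolding ind_def using analytic_vector_locally_analytic
  by (auto simp: analytic_vector_def equivariant_def)

lemma equivariant_mult_left:
  assumes f: "equivariant p n \<chi> w f" and h: "h \<in> Iwahori p n"
    and gb: "g \<in> Iwahori p n" "b \<in> Pw p n w"
  shows "f (h * (g * b)) = char_w n \<chi> w (minv b) * f (h * g)"
proof -
  have "h * (g * b) = (h * g) * b"
    using Iwahori_carrier h gb Pw_imp_Iwahori by (intro assoc_mult_mat[symmetric]) blast+
  then show ?thesis using equivariantD[OF f Iwahori_mult[OF h gb(1)] gb(2)] by simp
qed

lemma left_transl_ind:
  assumes h: "h \<in> pro_p_Iwahori p n" and f: "f \<in> ind p n \<chi> w"
  shows "left_transl p n h f \<in> ind p n \<chi> w"
proof -
  have f': "analytic_vector f" using f by (simp add: ind_iff)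
  note minv_h = minv_pro_p_Iwahori[OF h]
  have "equivariant p n \<chi> w (left_transl p n h f)"
    unfolding equivariant_def
  proof (intro ballI)
    fix g b :: "'k mat" assume gb: "g \<in> Iwahori p n" "b \<in> Pw p n w"
    then have "g * b \<in> Iwahori p n" by (intro Iwahori_mult Pw_imp_Iwahori[of b])
    then show "left_transl p n h f (g * b) = char_w n \<chi> w (minv b) * left_transl p n h f g"
      using f' equivariant_mult_left[OF _ pro_p_Iwahori_imp_Iwahori[OF minv_h] gb, of f] gb
      by (simp add: left_transl_def analytic_vector_def)
  qed
  moreover have "U.pro_p_family n (\<lambda>u. minv h * u)"
    by (intro U.pro_p_family_mult U.pro_p_family_const minv_h U.pro_p_family_Uw[OF \<sigma>] U.tate_Zp_crd)
  then obtain b where "tate_expansion (Uw_pos n w) (Uw p n w) (Uw_crd p) (\<lambda>u. f (minv h * u)) b"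
    using U.analytic_along_pro_p_family[OF f'] by blast
  then have "Uw_expansion p n w (left_transl p n h f) b"
    unfolding Uw_expansion_def
    by (rule tate_expansion_cong[THEN iffD1, rotated]) (simp add: left_transl_def Uw_imp_Iwahori)
  ultimately show ?thesis by (auto simp: ind_iff left_transl_def analytic_vector_def)
qed

context
  fixes f :: "'k mat \<Rightarrow> 'k" and lo hi :: "(nat \<times> nat) list"
  assumes f: "f \<in> ind p n \<chi> w"
    and lo: "set lo = {(i,j). j < i \<and> i < n}" and hi: "set hi = {(i,j). i < j \<and> j < n}"
begin

abbreviation G :: "(nat \<times> nat \<Rightarrow> 'k) \<Rightarrow> 'k mat" where "G \<equiv> G_point p n lo hi"

lemma analytic_vector_f: "analytic_vector f"
  using f by (simp add: ind_iff)

lemma pro_p_family_minv_G: "Z.pro_p_family n (\<lambda>z. minv (G z))"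
  by (intro Z.pro_p_family_minv Z.pro_p_family_G_point lo hi Z.tate_Zp_crd)

definition orbit_coeff :: "(nat \<times> nat \<Rightarrow> nat) \<Rightarrow> 'k mat \<Rightarrow> 'k" where
  "orbit_coeff \<alpha> g = (if g \<in> Iwahori p n then
     (THE b. Zp_expansion (\<lambda>z. f (minv (G z) * g)) b) \<alpha> else 0)"

lemma orbit_coeff_eqI:
  assumes "g \<in> Iwahori p n"
    and "Zp_expansion (\<lambda>z. f (minv (G z) * g)) b"
  shows "orbit_coeff \<alpha> g = b \<alpha>"
proof -
  have "(THE b. Zp_expansion (\<lambda>z. f (minv (G z) * g)) b) = b"
    using assms(2) Z.expansion_unique by blast
  then show ?thesis using assms(1) by (simp add: orbit_coeff_def)
qed

lemma tate_expansion_orbit_coeff: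
  assumes "g \<in> Iwahori p n"
  shows "Zp_expansion (\<lambda>z. f (minv (G z) * g)) (\<lambda>\<alpha>. orbit_coeff \<alpha> g)"
proof -
  obtain b where "Zp_expansion (\<lambda>z. f (minv (G z) * g)) b"
    using Z.analytic_along_pro_p_family_mult[OF analytic_vector_f pro_p_family_minv_G assms]
    by blast
  then show ?thesis using orbit_coeff_eqI[OF assms] by simp
qed

lemma equivariant_orbit_coeff: "equivariant p n \<chi> w (orbit_coeff \<alpha>)"
  unfolding equivariant_def
proof (intro ballI)
  fix g b :: "'k mat" assume gb: "g \<in> Iwahori p n" "b \<in> Pw p n w"
  have "Zp_expansion (\<lambda>z. f (minv (G z) * (g * b)))
      (\<lambda>\<alpha>. char_w n \<chi> w (minv b) * orbit_coeff \<alpha> g)"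
  proof (rule tate_expansion_cong[THEN iffD1])
    show "Zp_expansion (\<lambda>z. char_w n \<chi> w (minv b) * f (minv (G z) * g))
        (\<lambda>\<alpha>. char_w n \<chi> w (minv b) * orbit_coeff \<alpha> g)"
      by (rule tate_expansion_cmult[OF tate_expansion_orbit_coeff[OF gb(1)]])
    fix z :: "nat \<times> nat \<Rightarrow> 'k" assume "z \<in> Zp_points (all_pos n)"
    then have "minv (G z) \<in> Iwahori p n"
      by (intro pro_p_Iwahori_imp_Iwahori Z.pro_p_family_imp_pro_p_Iwahori[OF pro_p_family_minv_G])
    then show "char_w n \<chi> w (minv b) * f (minv (G z) * g) = f (minv (G z) * (g * b))"
      using analytic_vector_f gb by (simp add: equivariant_mult_left analytic_vector_def)
  qed
  then show "orbit_coeff \<alpha> (g * b) = char_w n \<chi> w (minv b) * orbit_coeff \<alpha> g"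
    using Iwahori_mult[OF gb(1) Pw_imp_Iwahori[OF gb(2)]] by (intro orbit_coeff_eqI)
qed

lemma orbit_map_analytic_on_product:
  "\<exists>a. tate_expansion (all_pos n <+> Uw_pos n w) (Zp_points (all_pos n) \<times> Uw p n w)
    (Plus_crd (\<lambda>z. z) (Uw_crd p)) (\<lambda>x. f (minv (G (fst x)) * snd x)) a"
proof -
  let ?I = "all_pos n" and ?J = "Uw_pos n w" and ?crd = "Plus_crd (\<lambda>z. z) (Uw_crd p)"
  interpret P: tate_character p ty "?I <+> ?J" "Zp_points ?I \<times> Uw p n w" ?crd n \<sigma> c \<chi>
    by unfold_locales
       (auto simp: finite_all_pos finite_Uw_pos Plus_crd_def Zp_points_def Uw_crd_Zp vabs_Zp)
  have z: "(\<lambda>x. fst x ij) \<in> P.tate_Zp" if "ij \<in> ?I" for ij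
    using P.tate_Zp_crd[of "Inl ij"] that by (auto simp: Plus_crd_def case_prod_unfold)
  have u: "(\<lambda>x. Uw_crd p (snd x) ij) \<in> P.tate_Zp" if "ij \<in> ?J" for ij
    using P.tate_Zp_crd[of "Inr ij"] that by (auto simp: Plus_crd_def case_prod_unfold)
  have "P.pro_p_family n (\<lambda>x. minv (G (fst x)) * snd x)"
    by (intro P.pro_p_family_mult P.pro_p_family_minv P.pro_p_family_G_point lo hi z
        P.pro_p_family_Uw[OF \<sigma>] u) auto
  then show ?thesis by (rule P.analytic_along_pro_p_family[OF analytic_vector_f])
qed

lemma orbit_coeff_expansions:
  obtains a
  where "null_family (multi_indices (all_pos n) \<times> multi_indices (Uw_pos n w)) (\<lambda>(\<alpha>, \<beta>). a \<alpha> \<beta>)"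
    and "\<And>\<alpha>. \<alpha> \<in> multi_indices (all_pos n) \<Longrightarrow>
      tate_expansion (Uw_pos n w) (Uw p n w) (Uw_crd p) (orbit_coeff \<alpha>) (a \<alpha>)"
proof -
  obtain a where a: "tate_expansion (all_pos n <+> Uw_pos n w) (Zp_points (all_pos n) \<times> Uw p n w)
      (Plus_crd (\<lambda>z. z) (Uw_crd p)) (\<lambda>x. f (minv (G (fst x)) * snd x)) a"
    using orbit_map_analytic_on_product by blast
  interpret P: tate_coordinates_pair "all_pos n" "Zp_points (all_pos n)" "\<lambda>z. z"
      "Uw_pos n w" "Uw p n w" "Uw_crd p" "\<lambda>x. f (minv (G (fst x)) * snd x)" a
    by unfold_locales (rule a)
  have orbit_coeff_eq: "P.fst_coeff \<alpha> u = orbit_coeff \<alpha> u" if "u \<in> Uw p n w" for \<alpha> u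
    using P.tate_expansion_fst[OF that]
    by (intro orbit_coeff_eqI[symmetric] Uw_imp_Iwahori[OF that]) simp
  show thesis
  proof (rule that[of "\<lambda>\<alpha> \<beta>. a (case_sum \<alpha> \<beta>)", OF P.null_family_coeff])
    fix \<alpha> :: "nat \<times> nat \<Rightarrow> nat" assume "\<alpha> \<in> multi_indices (all_pos n)"
    from P.tate_expansion_fst_coeff[OF this]
    show "tate_expansion (Uw_pos n w) (Uw p n w) (Uw_crd p) (orbit_coeff \<alpha>) (\<lambda>\<beta>. a (case_sum \<alpha> \<beta>))"
      by (rule tate_expansion_cong[THEN iffD1, rotated]) (rule orbit_coeff_eq)
  qed
qed

lemma orbit_coeff_ind:
  assumes "\<alpha> \<in> multi_indices (all_pos n)"
  shows "orbit_coeff \<alpha> \<in> ind p n \<chi> w"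
proof -
  obtain a where "Uw_expansion p n w (orbit_coeff \<alpha>) (a \<alpha>)"
    unfolding Uw_expansion_def using orbit_coeff_expansions assms by blast
  then show ?thesis
    using equivariant_orbit_coeff by (auto simp: ind_iff analytic_vector_def orbit_coeff_def)
qed

lemma orbit_coeff_tends_to_0: "tends_to_0 (all_pos n) (\<lambda>\<alpha>. ind_norm p n w (orbit_coeff \<alpha>))"
proof -
  let ?I = "all_pos n" and ?J = "Uw_pos n w"
  obtain a where null: "null_family (multi_indices ?I \<times> multi_indices ?J) (\<lambda>(\<alpha>, \<beta>). a \<alpha> \<beta>)"
    and a: "\<And>\<alpha>. \<alpha> \<in> multi_indices ?I \<Longrightarrow>
      tate_expansion ?J (Uw p n w) (Uw_crd p) (orbit_coeff \<alpha>) (a \<alpha>)"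
    using orbit_coeff_expansions by blast
  have "{\<alpha> \<in> multi_indices ?I. \<epsilon> \<le> \<bar>ind_norm p n w (orbit_coeff \<alpha>)\<bar>}
      = {\<alpha> \<in> multi_indices ?I. \<epsilon> \<le> ind_norm p n w (orbit_coeff \<alpha>)}" for \<epsilon>
    using U.gauss_norm_nonneg[OF a] by (auto simp: ind_norm_eq_gauss_norm)
  then show ?thesis
    using U.finite_gauss_norm_ge[OF null a] by (simp add: tends_to_0_def ind_norm_eq_gauss_norm)
qed

lemma orbit_series_converges:
  assumes z: "z \<in> Zp_points (all_pos n)"
  shows "((\<lambda>S. ind_norm p n w (\<lambda>x. left_transl p n (G z) f x -
      (\<Sum>\<alpha>\<in>S. mpower (all_pos n) z \<alpha> * orbit_coeff \<alpha> x))) \<longlongrightarrow> 0)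
    (finite_subsets_at_top (multi_indices (all_pos n)))"
proof -
  let ?I = "all_pos n" and ?J = "Uw_pos n w"
  obtain a where null: "null_family (multi_indices ?I \<times> multi_indices ?J) (\<lambda>(\<alpha>, \<beta>). a \<alpha> \<beta>)"
    and a: "\<And>\<alpha>. \<alpha> \<in> multi_indices ?I \<Longrightarrow>
      tate_expansion ?J (Uw p n w) (Uw_crd p) (orbit_coeff \<alpha>) (a \<alpha>)"
    using orbit_coeff_expansions by blast
  show ?thesis
    unfolding ind_norm_eq_gauss_norm
  proof (rule U.partial_sums_tendsto_gauss_norm)
    show "null_family (multi_indices ?I \<times> multi_indices ?J) (\<lambda>(\<alpha>, \<beta>). mpower ?I z \<alpha> * a \<alpha> \<beta>)"
      by (rule null_family_le[OF null])
         (auto intro: vabs_mult_le_right Z.vabs_mpower_crd_le_1[OF z])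
    show "tate_expansion ?J (Uw p n w) (Uw_crd p) (\<lambda>x. mpower ?I z \<alpha> * orbit_coeff \<alpha> x)
        (\<lambda>\<beta>. mpower ?I z \<alpha> * a \<alpha> \<beta>)" if "\<alpha> \<in> multi_indices ?I" for \<alpha>
      by (rule tate_expansion_cmult[OF a[OF that]])
    show "((\<lambda>\<alpha>. mpower ?I z \<alpha> * orbit_coeff \<alpha> u) has_sum left_transl p n (G z) f u)
        (multi_indices ?I)"
      if "u \<in> Uw p n w" for u
      using tate_expansion_has_sum[OF tate_expansion_orbit_coeff[OF Uw_imp_Iwahori[OF that]] z]
        Uw_imp_Iwahori[OF that] by (simp add: left_transl_def mult.commute)
  qed
qed

end

lemma left_transl_globally_analytic:
  "globally_analytic_action p n (ind p n \<chi> w) (ind_norm p n w) (left_transl p n)"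
  unfolding globally_analytic_action_def
proof (intro conjI allI impI ballI)
  fix lo hi :: "(nat \<times> nat) list" and f
  assume "distinct lo \<and> set lo = {(i,j). j < i \<and> i < n} \<and>
      distinct hi \<and> set hi = {(i,j). i < j \<and> j < n}"
    and f: "f \<in> ind p n \<chi> w"
  then have lo_hi: "set lo = {(i,j). j < i \<and> i < n}" "set hi = {(i,j). i < j \<and> j < n}" by auto
  show "\<exists>F. (\<forall>\<alpha>\<in>multi_indices (all_pos n). F \<alpha> \<in> ind p n \<chi> w) \<and>
      tends_to_0 (all_pos n) (\<lambda>\<alpha>. ind_norm p n w (F \<alpha>)) \<and>
      (\<forall>z\<in>Zp_points (all_pos n).
        ((\<lambda>S. ind_norm p n w (\<lambda>x. left_transl p n (G_point p n lo hi z) f x -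
          (\<Sum>\<alpha>\<in>S. mpower (all_pos n) z \<alpha> * F \<alpha> x))) \<longlongrightarrow> 0)
        (finite_subsets_at_top (multi_indices (all_pos n))))"
    by (intro exI[of _ "orbit_coeff f lo hi"] conjI ballI orbit_coeff_ind orbit_coeff_tends_to_0
        orbit_series_converges f lo_hi)
qed (rule left_transl_ind)

end

theorem theoremA3:
  fixes p n :: nat
    and c :: "nat \<Rightarrow> 'k::nonarch_field"
    and \<chi> :: "nat \<Rightarrow> 'k \<Rightarrow> 'k"
    and w :: "'k mat"
  assumes "prime p"
    and "n \<ge> 2"
    and "finite_extension_Qp p TYPE('k)"
    and "p > n + 1"
    and "\<And>i. i < n \<Longrightarrow> is_character (\<chi> i)"
    and "\<And>i u. i < n \<Longrightarrow> u \<in> Zp \<Longrightarrow>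
           \<chi> i (1 + of_nat p * u) = padic_exp (c i * padic_log (1 + of_nat p * u))"
    and "\<And>i. i < n \<Longrightarrow>
           padic_val p (c i) > ereal (real (ramification_index TYPE('k)) / (real p - 1) - 1)"
    and "w \<in> perm_matrices n"
  shows "globally_analytic_action p n (ind p n \<chi> w) (ind_norm p n w) (left_transl p n)"
proof -
  interpret padic_field p "TYPE('k)"
    using assms(1,3) by unfold_locales (auto simp: finite_extension_Qp_def)
  obtain \<sigma> where perm: "\<sigma> permutes {..<n}" "w = perm_mat n \<sigma>"
    using assms(8) by (auto simp: perm_matrices_eq)
  interpret analytic_character p "TYPE('k)" n \<sigma> c \<chi>
    using perm(1) assms(6)
      vabs_mult_p_less_exp_radius[OF assms(7) ramification_index_pos[OF assms(3)]]
    by unfold_locales auto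
  show ?thesis unfolding perm(2) by (rule left_transl_globally_analytic)
qed

end
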